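(* Let $R$ be an integral domain in which $2$ is invertible, let $n\ge1$, and let $d=1$, so that $g(x)=x$. Then $\mathrm{SupTr}(\mathfrak{H}_n^g)_{\bar 0}$ is a free $R$-module, and $$\operatorname{rank}_R\mathrm{SupTr}(\mathfrak{H}_n^g)_{\bar 0}=|\mathscr{MP}^{\mathsf s,0}_n|,$$ where $\mathscr{MP}^{\mathsf s,0}_n$ is the set of strict partitions of $n$ (partitions with distinct parts) having an even number of nonzero parts.
   Context: **Cyclotomic Sergeev algebra.** The affine Sergeev algebra $\mathfrak{H}_n$ is the $R$-superalgebra generated by even generators $s_1,\ldots,s_{n-1},x_1,\ldots,x_n$ and odd generators $c_1,\ldots,c_n$ subject to: $s_i^2=1$, $s_is_j=s_js_i$ for $|i-j|>1$, $s_is_{i+1}s_i=s_{i+1}s_is_{i+1}$; $x_ix_j=x_jx_i$; $c_i^2=1$, $c_ic_j=-c_jc_i$ for $i\ne j$; $s_ix_i=x_{i+1}s_i-(1+c_ic_{i+1})$; $s_ix_j=x_js_i$ for $j\ne i,i+1$; $s_ic_i=c_{i+1}s_i$, $s_ic_{i+1}=c_is_i$, $s_ic_j=c_js_i$ for $j\neq i,i+1$; $x_ic_i=-c_ix_i$, $x_ic_j=c_jx_i$ for $i\ne j$. Then $\mathfrak{H}_n^g:=\mathfrak{H}_n/I_g$, with $I_g$ the two-sided ideal generated by $g(x_1)$. (In general $g(x)=\sum_{0\le t\le d/2}a_{d-2t}x^{d-2t}$ with $a_d=1$; for $d=1$ this forces $g(x)=x$.) **Supercocenter.** For a superalgebra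 $A$ with parity $|\cdot|$, $[A,A]^-$ is the $R$-span of all supercommutators $xy-(-1)^{|x||y|}yx$ with $x,y$ homogeneous; $\mathrm{SupTr}(A)=A/[A,A]^-$, which is $\mathbb Z_2$-graded with $\mathrm{SupTr}(A)_{\bar 0}=A_{\bar 0}/[A,A]^-_{\bar 0}$. *)

theory Defs
  imports
    "HOL-Algebra.QuotRing"
    "HOL-Algebra.Algebraic_Closure_Type"
    "HOL-Library.Poly_Mapping"
    "HOL-Library.Z2"
    "HOL-Computational_Algebra.Polynomial"
begin

section \<open>Modules over a ground ring given as a type\<close>

definition lin_comb :: "('r::comm_ring_1, 'b, 'm) module_scheme \<Rightarrow> ('b \<Rightarrow>\<^sub>0 'r) \<Rightarrow> 'b" where
  "lin_comb M f = (\<Oplus>\<^bsub>M\<^esub>b\<in>Poly_Mapping.keys f. Poly_Mapping.lookup f b \<odot>\<^bsub>M\<^esub> b)"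

definition lin_span :: "('r::comm_ring_1, 'b, 'm) module_scheme \<Rightarrow> 'b set \<Rightarrow> 'b set" where
  "lin_span M V = {lin_comb M f | f. Poly_Mapping.keys f \<subseteq> V}"

definition lin_independent :: "('r::comm_ring_1, 'b, 'm) module_scheme \<Rightarrow> 'b set \<Rightarrow> bool" where
  "lin_independent M B \<longleftrightarrow>
     (\<forall>f. Poly_Mapping.keys f \<subseteq> B \<longrightarrow> lin_comb M f = \<zero>\<^bsub>M\<^esub> \<longrightarrow> f = 0)"

definition module_basis :: "('r::comm_ring_1, 'b, 'm) module_scheme \<Rightarrow> 'b set \<Rightarrow> bool" where
  "module_basis M B \<longleftrightarrow>
     B \<subseteq> carrier M \<and> lin_independent M B \<and> lin_span M B = carrier M"

definition free_module_of_rank :: "('r::comm_ring_1, 'b, 'm) module_scheme \<Rightarrow> nat \<Rightarrow> bool" where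
  "free_module_of_rank M k \<longleftrightarrow>
     module ring_of_type_algebra M \<and> (\<exists>B. module_basis M B \<and> finite B \<and> card B = k)"

text \<open>
  When \<open>N\<close> is only a submodule of \<open>M\<close>, the fields \<open>mult\<close> and \<open>one\<close> that the
  quotient inherits from \<open>Quot\<close> carry no meaning.
\<close>

definition quotient_module ::
    "('r, 'b, 'm) module_scheme \<Rightarrow> 'b set \<Rightarrow> ('r, 'b set) module" where
  "quotient_module M N =
     ring.extend (M Quot N) (module.fields (\<lambda>r A. \<Union>x\<in>A. N +>\<^bsub>M\<^esub> (r \<odot>\<^bsub>M\<^esub> x)))"


section \<open>Superalgebras\<close>

text \<open>The field \<open>bit\<close> serves as the group of parities; \<open>grade A i\<close> is the component
  of parity \<open>i\<close>.\<close>

record ('r, 'b) superalgebra = "('r, 'b) module" +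
  grade :: "bit \<Rightarrow> 'b set"

definition quotient_superalgebra ::
    "('r, 'b, 'm) superalgebra_scheme \<Rightarrow> 'b set \<Rightarrow> ('r, 'b set) superalgebra" where
  "quotient_superalgebra A I =
     module.extend (quotient_module A I) (superalgebra.fields (\<lambda>i. (\<lambda>x. I +>\<^bsub>A\<^esub> x) ` grade A i))"

definition parity_sign :: "bit \<Rightarrow> bit \<Rightarrow> 'r::comm_ring_1" where
  "parity_sign i j = (if i = 1 \<and> j = 1 then - 1 else 1)"

definition supercommutators :: "('r::comm_ring_1, 'b, 'm) superalgebra_scheme \<Rightarrow> 'b set" where
  "supercommutators A =
     {(x \<otimes>\<^bsub>A\<^esub> y) \<ominus>\<^bsub>A\<^esub> (parity_sign i j \<odot>\<^bsub>A\<^esub> (y \<otimes>\<^bsub>A\<^esub> x)) | x y i j.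
        x \<in> grade A i \<and> y \<in> grade A j}"

definition supercommutator_span :: "('r::comm_ring_1, 'b, 'm) superalgebra_scheme \<Rightarrow> 'b set" where
  "supercommutator_span A = lin_span A (supercommutators A)"

text \<open>The component of parity \<open>i\<close> of the supercocenter,
  \<open>A\<^sub>i\<close> modulo the part of \<open>[A, A]\<^sup>-\<close> of parity \<open>i\<close>.\<close>

definition SupTr :: "bit \<Rightarrow> ('r::comm_ring_1, 'b, 'm) superalgebra_scheme \<Rightarrow> ('r, 'b set) module" where
  "SupTr i A =
     quotient_module (A\<lparr>carrier := grade A i\<rparr>) (supercommutator_span A \<inter> grade A i)"


section \<open>Superalgebras given by generators and relations\<close>

text \<open>Words form the free monoid, written additively so that \<open>'g word \<Rightarrow>\<^sub>0 'r\<close> is the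
  ring of noncommutative polynomials in the letters \<open>'g\<close>.\<close>

datatype 'g word = Word (letters: "'g list")

instantiation word :: (type) monoid_add
begin

definition zero_word :: "'a word" where
  "0 = Word []"

definition plus_word :: "'a word \<Rightarrow> 'a word \<Rightarrow> 'a word" where
  "v + w = Word (letters v @ letters w)"

instance
  by standard (simp_all add: zero_word_def plus_word_def)

end

definition gen :: "'g \<Rightarrow> ('g word \<Rightarrow>\<^sub>0 'r::comm_ring_1)" where
  "gen u = Poly_Mapping.single (Word [u]) 1"

definition word_parity :: "('g \<Rightarrow> bit) \<Rightarrow> 'g word \<Rightarrow> bit" where
  "word_parity p w = (\<Sum>u\<leftarrow>letters w. p u)"

definition free_superalgebra ::
    "'g set \<Rightarrow> ('g \<Rightarrow> bit) \<Rightarrow> ('r::comm_ring_1, 'g word \<Rightarrow>\<^sub>0 'r) superalgebra" where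
  "free_superalgebra G p =
     \<lparr>carrier = {f. \<forall>w\<in>Poly_Mapping.keys f. set (letters w) \<subseteq> G},
      monoid.mult = (*), one = 1, zero = 0, add = (+),
      module.smult = (\<lambda>r f. Poly_Mapping.map ((*) r) f),
      grade = (\<lambda>i. {f. \<forall>w\<in>Poly_Mapping.keys f. set (letters w) \<subseteq> G \<and> word_parity p w = i})\<rparr>"

text \<open>A relation is a pair \<open>(l, r)\<close>, read as the equation \<open>l = r\<close>; \<open>Idl\<close> is the two-sided ideal.\<close>

definition relation_ideal ::
    "'g set \<Rightarrow> ('g \<Rightarrow> bit) \<Rightarrow> (('g word \<Rightarrow>\<^sub>0 'r::comm_ring_1) \<times> ('g word \<Rightarrow>\<^sub>0 'r)) set
       \<Rightarrow> ('g word \<Rightarrow>\<^sub>0 'r) set" where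
  "relation_ideal G p E = Idl\<^bsub>free_superalgebra G p\<^esub> {l - r | l r. (l, r) \<in> E}"

definition presented_superalgebra ::
    "'g set \<Rightarrow> ('g \<Rightarrow> bit) \<Rightarrow> (('g word \<Rightarrow>\<^sub>0 'r::comm_ring_1) \<times> ('g word \<Rightarrow>\<^sub>0 'r)) set
       \<Rightarrow> ('r, ('g word \<Rightarrow>\<^sub>0 'r) set) superalgebra" where
  "presented_superalgebra G p E =
     quotient_superalgebra (free_superalgebra G p) (relation_ideal G p E)"

definition presented_gen ::
    "'g set \<Rightarrow> ('g \<Rightarrow> bit) \<Rightarrow> (('g word \<Rightarrow>\<^sub>0 'r::comm_ring_1) \<times> ('g word \<Rightarrow>\<^sub>0 'r)) set
       \<Rightarrow> 'g \<Rightarrow> ('g word \<Rightarrow>\<^sub>0 'r) set" where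
  "presented_gen G p E u = relation_ideal G p E +>\<^bsub>free_superalgebra G p\<^esub> gen u"


section \<open>The affine and the cyclotomic Sergeev algebra\<close>

datatype sergeev_letter = Sg nat | Xg nat | Cg nat

fun sergeev_parity :: "sergeev_letter \<Rightarrow> bit" where
  "sergeev_parity (Sg i) = 0"
| "sergeev_parity (Xg i) = 0"
| "sergeev_parity (Cg i) = 1"

definition sergeev_letters :: "nat \<Rightarrow> sergeev_letter set" where
  "sergeev_letters n = Sg ` {1..<n} \<union> Xg ` {1..n} \<union> Cg ` {1..n}"

abbreviation sgen :: "nat \<Rightarrow> (sergeev_letter word \<Rightarrow>\<^sub>0 'r::comm_ring_1)" where
  "sgen i \<equiv> gen (Sg i)"

abbreviation xgen :: "nat \<Rightarrow> (sergeev_letter word \<Rightarrow>\<^sub>0 'r::comm_ring_1)" where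
  "xgen i \<equiv> gen (Xg i)"

abbreviation cgen :: "nat \<Rightarrow> (sergeev_letter word \<Rightarrow>\<^sub>0 'r::comm_ring_1)" where
  "cgen i \<equiv> gen (Cg i)"

inductive_set sergeev_relations ::
    "nat \<Rightarrow> ((sergeev_letter word \<Rightarrow>\<^sub>0 'r::comm_ring_1) \<times> (sergeev_letter word \<Rightarrow>\<^sub>0 'r)) set"
  for n :: nat
where
  ss_sq: "\<lbrakk>i \<in> {1..<n}\<rbrakk> \<Longrightarrow> (sgen i * sgen i, 1) \<in> sergeev_relations n"
| ss_comm: "\<lbrakk>i \<in> {1..<n}; j \<in> {1..<n}; i + 1 < j \<or> j + 1 < i\<rbrakk> \<Longrightarrow>
    (sgen i * sgen j, sgen j * sgen i) \<in> sergeev_relations n"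
| ss_braid: "\<lbrakk>i \<in> {1..<n}; i + 1 \<in> {1..<n}\<rbrakk> \<Longrightarrow>
    (sgen i * sgen (i + 1) * sgen i, sgen (i + 1) * sgen i * sgen (i + 1)) \<in> sergeev_relations n"
| xx_comm: "\<lbrakk>i \<in> {1..n}; j \<in> {1..n}\<rbrakk> \<Longrightarrow>
    (xgen i * xgen j, xgen j * xgen i) \<in> sergeev_relations n"
| cc_sq: "\<lbrakk>i \<in> {1..n}\<rbrakk> \<Longrightarrow> (cgen i * cgen i, 1) \<in> sergeev_relations n"
| cc_anticomm: "\<lbrakk>i \<in> {1..n}; j \<in> {1..n}; i \<noteq> j\<rbrakk> \<Longrightarrow>
    (cgen i * cgen j, - (cgen j * cgen i)) \<in> sergeev_relations n"
| sx: "\<lbrakk>i \<in> {1..<n}\<rbrakk> \<Longrightarrow>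
    (sgen i * xgen i, xgen (i + 1) * sgen i - (1 + cgen i * cgen (i + 1))) \<in> sergeev_relations n"
| sx_comm: "\<lbrakk>i \<in> {1..<n}; j \<in> {1..n}; j \<noteq> i; j \<noteq> i + 1\<rbrakk> \<Longrightarrow>
    (sgen i * xgen j, xgen j * sgen i) \<in> sergeev_relations n"
| sc: "\<lbrakk>i \<in> {1..<n}\<rbrakk> \<Longrightarrow> (sgen i * cgen i, cgen (i + 1) * sgen i) \<in> sergeev_relations n"
| sc': "\<lbrakk>i \<in> {1..<n}\<rbrakk> \<Longrightarrow> (sgen i * cgen (i + 1), cgen i * sgen i) \<in> sergeev_relations n"
| sc_comm: "\<lbrakk>i \<in> {1..<n}; j \<in> {1..n}; j \<noteq> i; j \<noteq> i + 1\<rbrakk> \<Longrightarrow>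
    (sgen i * cgen j, cgen j * sgen i) \<in> sergeev_relations n"
| xc_anticomm: "\<lbrakk>i \<in> {1..n}\<rbrakk> \<Longrightarrow> (xgen i * cgen i, - (cgen i * xgen i)) \<in> sergeev_relations n"
| xc_comm: "\<lbrakk>i \<in> {1..n}; j \<in> {1..n}; i \<noteq> j\<rbrakk> \<Longrightarrow>
    (xgen i * cgen j, cgen j * xgen i) \<in> sergeev_relations n"

definition affine_sergeev ::
    "nat \<Rightarrow> ('r::comm_ring_1, (sergeev_letter word \<Rightarrow>\<^sub>0 'r) set) superalgebra" where
  "affine_sergeev n =
     presented_superalgebra (sergeev_letters n) sergeev_parity (sergeev_relations n)"

definition affine_x :: "nat \<Rightarrow> nat \<Rightarrow> (sergeev_letter word \<Rightarrow>\<^sub>0 'r::comm_ring_1) set" where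
  "affine_x n i =
     presented_gen (sergeev_letters n) sergeev_parity (sergeev_relations n) (Xg i)"

definition eval_poly_at :: "('r::comm_ring_1, 'b, 'm) module_scheme \<Rightarrow> 'r poly \<Rightarrow> 'b \<Rightarrow> 'b" where
  "eval_poly_at A g y =
     (\<Oplus>\<^bsub>A\<^esub>k\<in>{..degree g}. poly.coeff g k \<odot>\<^bsub>A\<^esub> (y [^]\<^bsub>A\<^esub> k))"

definition cyclotomic_sergeev ::
    "nat \<Rightarrow> 'r::comm_ring_1 poly
       \<Rightarrow> ('r, (sergeev_letter word \<Rightarrow>\<^sub>0 'r) set set) superalgebra" where
  "cyclotomic_sergeev n g =
     quotient_superalgebra (affine_sergeev n)
       (Idl\<^bsub>affine_sergeev n\<^esub> {eval_poly_at (affine_sergeev n) g (affine_x n 1)})"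

definition cyclotomic_poly :: "nat \<Rightarrow> (nat \<Rightarrow> 'r::comm_ring_1) \<Rightarrow> 'r poly" where
  "cyclotomic_poly d a = (\<Sum>t\<le>d div 2. Polynomial.monom (a (d - 2 * t)) (d - 2 * t))"


section \<open>Strict partitions\<close>

definition strict_partitions :: "nat \<Rightarrow> nat list set" where
  "strict_partitions n = {l. sorted_wrt (>) l \<and> (\<forall>k\<in>set l. 0 < k) \<and> sum_list l = n}"

definition even_strict_partitions :: "nat \<Rightarrow> nat list set" where
  "even_strict_partitions n = {l \<in> strict_partitions n. even (length l)}"

end

theory Submission
  imports Defs "HOL-Library.Multiset" "HOL-Combinatorics.Orbits"
begin

text \<open>
  Since \<open>x\<^sub>1 = 0\<close>, the relation \<open>s\<^sub>i x\<^sub>i = x\<^bsub>i+1\<^esub> s\<^sub>i - (1 + c\<^sub>i c\<^bsub>i+1\<^esub>)\<close> expresses every \<open>x\<^sub>i\<close> through the \<open>s\<^sub>j\<close>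
  and \<open>c\<^sub>j\<close>, so only even words in the \<open>s\<^sub>j\<close> and \<open>c\<^sub>j\<close> matter. Modulo supercommutators such a word is zero
  or, up to sign, a product of blocks \<open>c\<^sub>m s\<^sub>m \<cdots> s\<^bsub>m+k-2\<^esub>\<close>, an odd generator times a \<open>k\<close>-cycle. Blocks are
  odd, so interchanging two neighbours changes the sign, and two blocks of equal length give an element
  whose double is zero. As 2 is invertible, the strict partitions with an even number of parts span.

  For the independence, every set \<open>\<Lambda>\<close> of even cardinality has a supertrace on the Sergeev algebra. It is
  supported on the products of a Clifford monomial and a permutation whose cycle lengths are distinct and
  form \<open>\<Lambda>\<close>, where each cycle contains an odd number of the Clifford indices. Its value there is the sign of
  sorting the Clifford generators into an order that depends on the permutation alone. On a product of blocks
  with lengths \<open>\<mu>\<close> it is 1 or 0 according to whether the parts of \<open>\<mu>\<close> form \<open>\<Lambda>\<close>. The Jucys--Murphy elements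
  supply the \<open>x\<^sub>i\<close> in the Sergeev algebra and so carry the supertrace back to the presentation.
\<close>

section \<open>Words in the Sergeev generators modulo supercommutators\<close>

text \<open>A cycle has no first element, so sorting along it is ambiguous. Another admissible order
  multiplies the sign of each pair inside a cycle by \<open>u x * u y\<close> for suitable signs
  \<open>u\<close>; an odd number of Clifford indices in the cycle makes this change cancel. Cycles
  of equal length would have no canonical order among themselves, hence the distinct lengths. The
  number of Clifford indices has the parity of \<open>card \<Lambda>\<close>, so for even
  cardinality the trace vanishes on odd words. The model is the quotient of the noncommutative
  polynomials by the common kernel of all functionals that respect the Clifford relations. The
  traces are such functionals and descend to it by construction. On the blocks they form a dual
  family, which together with spanning yields a basis. On the spanning side the decisive point is
  that a cycle without a Clifford generator equals its own negative modulo supercommutators: insert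
  \<open>c * c\<close>, carry one of the two factors once around the cycle, and it returns with the
  opposite sign.\<close>

definition sgn_comm :: "bool \<Rightarrow> bool \<Rightarrow> 'a::ring \<Rightarrow> 'a" where
  "sgn_comm p q x = (if p \<and> q then - x else x)"

lemma sgn_comm_simps [simp]:
  "sgn_comm False q x = x" "sgn_comm p False x = x" "sgn_comm True True x = - x"
  by (simp_all add: sgn_comm_def)

text \<open>The unit \<open>e\<close> is a parameter and not \<open>1\<close>, because the intended
  ring is a product over all \<open>n\<close>, in which one factor has only its own unit. The unit
  laws for \<open>e\<close> are therefore assumptions beside the relations.\<close>

locale sergeev_words =
  fixes n :: nat and e :: "'a::ring" and s c :: "nat \<Rightarrow> 'a"
  assumes e_e: "e * e = e"
    and e_s: "i \<in> {1..<n} \<Longrightarrow> e * s i = s i" and s_e: "i \<in> {1..<n} \<Longrightarrow> s i * e = s i"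
    and e_c: "i \<in> {1..n} \<Longrightarrow> e * c i = c i" and c_e: "i \<in> {1..n} \<Longrightarrow> c i * e = c i"
    and s_s: "i \<in> {1..<n} \<Longrightarrow> s i * s i = e"
    and s_comm: "\<lbrakk>i \<in> {1..<n}; j \<in> {1..<n}; i + 1 < j \<or> j + 1 < i\<rbrakk> \<Longrightarrow> s i * s j = s j * s i"
    and braid: "\<lbrakk>i \<in> {1..<n}; i + 1 \<in> {1..<n}\<rbrakk> \<Longrightarrow> s i * s (i + 1) * s i = s (i + 1) * s i * s (i + 1)"
    and c_c: "i \<in> {1..n} \<Longrightarrow> c i * c i = e"
    and c_anti: "\<lbrakk>i \<in> {1..n}; j \<in> {1..n}; i \<noteq> j\<rbrakk> \<Longrightarrow> c i * c j = - (c j * c i)"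
    and s_c: "i \<in> {1..<n} \<Longrightarrow> s i * c i = c (i + 1) * s i"
    and s_c': "i \<in> {1..<n} \<Longrightarrow> s i * c (i + 1) = c i * s i"
    and s_c_comm: "\<lbrakk>i \<in> {1..<n}; j \<in> {1..n}; j \<noteq> i; j \<noteq> i + 1\<rbrakk> \<Longrightarrow> s i * c j = c j * s i"
begin

text \<open>The interval is that of the strands touched: \<open>s i\<close> involves
  \<open>i\<close> and \<open>i + 1\<close>, hence its strict upper bound. Confinement to an
  interval makes a reduction strand by strand possible. Signs are included so that anticommutation
  does not leave the class, and the Boolean is the superparity.\<close>

inductive mon :: "nat \<Rightarrow> nat \<Rightarrow> bool \<Rightarrow> 'a \<Rightarrow> bool" for lo hi where
  mon_e: "mon lo hi False e"
| mon_neg: "mon lo hi p x \<Longrightarrow> mon lo hi p (- x)"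
| mon_s: "mon lo hi p x \<Longrightarrow> lo \<le> i \<Longrightarrow> i < hi \<Longrightarrow> mon lo hi p (x * s i)"
| mon_c: "mon lo hi p x \<Longrightarrow> lo \<le> i \<Longrightarrow> i \<le> hi \<Longrightarrow> mon lo hi (\<not> p) (x * c i)"

lemma mon_mono: "mon lo hi p x \<Longrightarrow> lo' \<le> lo \<Longrightarrow> hi \<le> hi' \<Longrightarrow> mon lo' hi' p x"
  by (induction rule: mon.induct) (auto intro: mon.intros)

lemma mon_r_e: "mon lo hi p x \<Longrightarrow> 1 \<le> lo \<Longrightarrow> hi \<le> n \<Longrightarrow> x * e = x"
  by (induction rule: mon.induct) (auto simp: e_e mult.assoc s_e c_e)

lemma mon_l_e: "mon lo hi p x \<Longrightarrow> 1 \<le> lo \<Longrightarrow> hi \<le> n \<Longrightarrow> e * x = x"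
  by (induction rule: mon.induct) (auto simp: e_e mult.assoc[symmetric] s_e c_e)

lemma mon_mult:
  assumes "mon lo hi q y" "mon lo hi p x" "1 \<le> lo" "hi \<le> n"
  shows "mon lo hi (p \<noteq> q) (x * y)"
  using assms
proof (induction rule: mon.induct)
  case mon_e
  then show ?case by (simp add: mon_r_e)
next
  case (mon_c q y i)
  then have "mon lo hi (p = q) (x * y * c i)" using mon.mon_c[of lo hi "p \<noteq> q" "x * y" i] by simp
  then show ?case by (simp add: mult.assoc add.assoc)
qed (auto simp: mult.assoc[symmetric] intro: mon.intros)

lemma mon_single_s: "lo \<le> i \<Longrightarrow> i < hi \<Longrightarrow> 1 \<le> lo \<Longrightarrow> hi \<le> n \<Longrightarrow> mon lo hi False (s i)"
  using mon_s[OF mon_e, of lo i hi] by (simp add: e_s)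

lemma mon_single_c: "lo \<le> i \<Longrightarrow> i \<le> hi \<Longrightarrow> 1 \<le> lo \<Longrightarrow> hi \<le> n \<Longrightarrow> mon lo hi True (c i)"
  using mon_c[OF mon_e, of lo i hi] by (simp add: e_c)

lemma mon_commute_s:
  assumes "mon lo hi p x" "1 \<le> lo" "hi \<le> n" "j \<in> {1..<n}" "hi < j \<or> j + 1 < lo"
  shows "x * s j = s j * x"
  using assms
proof (induction rule: mon.induct)
  case mon_e
  then show ?case by (simp add: e_s s_e)
next
  case (mon_s p x i)
  then have "s i * s j = s j * s i" by (intro s_comm) auto
  with mon_s show ?case by (metis mult.assoc)
next
  case (mon_c p x i)
  then have "s j * c i = c i * s j" by (intro s_c_comm) auto
  with mon_c show ?case by (metis mult.assoc)
qed auto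

lemma mon_commute_c:
  assumes "mon lo hi p x" "1 \<le> lo" "hi \<le> n" "j \<in> {1..n}" "hi < j \<or> j < lo"
  shows "x * c j = sgn_comm p True (c j * x)"
  using assms
proof (induction rule: mon.induct)
  case mon_e
  then show ?case by (simp add: e_c c_e)
next
  case (mon_neg p x)
  then show ?case by (cases p) auto
next
  case (mon_s p x i)
  then have "s i * c j = c j * s i" by (intro s_c_comm) auto
  then have "x * s i * c j = (x * c j) * s i" by (simp add: mult.assoc)
  with mon_s show ?case by (cases p) (auto simp: mult.assoc)
next
  case (mon_c p x i)
  then have "c i * c j = - (c j * c i)" by (intro c_anti) auto
  then have "x * c i * c j = - ((x * c j) * c i)" by (simp add: mult.assoc)
  with mon_c show ?case by (cases p) (auto simp: mult.assoc)
qed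

text \<open>Letters on disjoint strands commute, except that two Clifford letters anticommute. Over
  all pairs of letters this accumulates to the Koszul sign of the two words.\<close>

lemma mon_commute:
  assumes "mon lo' hi' q y" "mon lo hi p x" "1 \<le> lo" "hi \<le> n" "1 \<le> lo'" "hi' \<le> n" "hi < lo'"
  shows "x * y = sgn_comm p q (y * x)"
  using assms
proof (induction rule: mon.induct)
  case mon_e
  then show ?case by (simp add: mon_r_e mon_l_e)
next
  case (mon_neg q y)
  then show ?case by (cases p; cases q) auto
next
  case (mon_s q y i)
  then have "x * s i = s i * x" using mon_commute_s[OF mon_s.prems(1), of i] by auto
  with mon_s have "x * (y * s i) = sgn_comm p q (y * x) * s i" "y * x * s i = y * s i * x"
    by (simp_all add: mult.assoc[symmetric]) (simp add: mult.assoc)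
  then show ?case by (cases p; cases q) auto
next
  case (mon_c q y i)
  then have "x * c i = sgn_comm p True (c i * x)" using mon_commute_c[OF mon_c.prems(1), of i] by auto
  with mon_c have "x * (y * c i) = sgn_comm p q (y * x) * c i" "y * x * c i = sgn_comm p True (y * c i * x)"
    by (simp_all add: mult.assoc[symmetric])
       (cases p; simp add: mult.assoc)
  then show ?case by (cases p; cases q) auto
qed

text \<open>An analogue of the double coset decomposition of the symmetric group on
  \<open>m + 1\<close> strands with respect to that on \<open>m\<close> strands: the last strand is
  untouched, or carries one Clifford generator, or is reached by a single \<open>s m\<close>. The
  reduction to blocks peels off the last strand in this way. The induction on \<open>m\<close>
  serves the case where a second \<open>s m\<close> is appended, since the factor between the two
  has to be decomposed on fewer strands.\<close>

lemma mon_decompose: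
  assumes "mon 1 (Suc m) p x" "Suc m \<le> n"
  obtains (low) b where "mon 1 m p b" "x = b"
  | (cliff) b where "mon 1 m (\<not> p) b" "x = b * c (Suc m)"
  | (mid) b b' q where "1 \<le> m" "mon 1 m q b" "mon 1 m (p \<noteq> q) b'" "x = b * s m * b'"
proof -
  have "(\<exists>b. mon 1 m p b \<and> x = b) \<or> (\<exists>b. mon 1 m (\<not> p) b \<and> x = b * c (Suc m)) \<or>
    (1 \<le> m \<and> (\<exists>b b' q. mon 1 m q b \<and> mon 1 m (p \<noteq> q) b' \<and> x = b * s m * b'))" (is "?D m p x")
    using assms
  proof (induction m arbitrary: p x)
    case 0
    from this(1) show ?case
    proof (induction rule: mon.induct)
      case mon_e
      show ?case by (auto intro: mon.intros)
    next
      case (mon_neg p x)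
      then show ?case by (auto intro: mon.intros)
    next
      case (mon_c p x i)
      have i: "i = 1" using mon_c by auto
      from mon_c(4) 0 show ?case
        unfolding i by (auto simp: mult.assoc c_c mon_r_e)
    qed auto
  next
    case (Suc m)
    let ?m = "Suc m"
    have n: "1 \<le> ?m" "?m < n" using Suc.prems by auto
    have low: "?D ?m p x" if "mon 1 ?m p x" for p x using that by blast
    have cliff: "?D ?m p x" if "mon 1 ?m (\<not> p) b" "x = b * c (Suc ?m)" for p x b using that by blast
    have mid: "?D ?m p x" if "mon 1 ?m q b" "mon 1 ?m r b'" "r = (p \<noteq> q)" "x = b * s ?m * b'" for p x q b r b'
    proof -
      have "1 \<le> ?m \<and> mon 1 ?m q b \<and> mon 1 ?m (p \<noteq> q) b' \<and> x = b * s ?m * b'" using that by simp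
      then show ?thesis by blast
    qed
    from Suc.prems(1) show ?case
    proof (induction rule: mon.induct)
      case mon_e
      show ?case by (auto intro: mon.intros)
    next
      case (mon_neg p x)
      then show ?case
      proof (elim disjE conjE exE)
        fix b b' q assume "mon 1 ?m q b" "mon 1 ?m (p \<noteq> q) b'" "x = b * s ?m * b'"
        then have 1: "1 \<le> ?m \<and> mon 1 ?m q (- b) \<and> mon 1 ?m (p \<noteq> q) b' \<and> - x = - b * s ?m * b'"
          using n by (auto intro: mon.intros)
        show ?thesis by (rule disjI2, rule disjI2) (use 1 in blast)
      next
        fix b assume "mon 1 ?m p b" "x = b"
        then show ?thesis by (intro disjI1) (auto intro: mon.mon_neg)
      next
        fix b assume b: "mon 1 ?m (\<not> p) b" "x = b * c (Suc ?m)"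
        then have "mon 1 ?m (\<not> p) (- b) \<and> - x = - b * c (Suc ?m)" by (auto intro: mon.mon_neg)
        then show ?thesis by blast
      qed
    next
      case (mon_s p x i)
      from mon_s(4) show ?case
      proof (elim disjE conjE exE)
        fix b assume b: "mon 1 ?m p b" "x = b"
        show ?thesis
        proof (cases "i = ?m")
          case True
          have "s ?m * e = s ?m" using n s_e[of ?m] by simp
          then have "1 \<le> ?m \<and> mon 1 ?m p b \<and> mon 1 ?m (p \<noteq> p) e \<and> x * s i = b * s ?m * e"
            using b True by (simp add: mult.assoc mon_e)
          then show ?thesis by blast
        next
          case False
          with b mon_s have "mon 1 ?m p (b * s i)" by (intro mon.intros) auto
          with b show ?thesis by (intro low) simp
        qed
      next
        fix b assume b: "mon 1 ?m (\<not> p) b" "x = b * c (Suc ?m)"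
        show ?thesis
        proof (cases "i = ?m")
          case True
          have "c (Suc ?m) * s ?m = s ?m * c ?m" using s_c[of ?m] n by simp
          then have "x * s i = b * s ?m * c ?m" using b True by (simp add: mult.assoc)
          moreover have "mon 1 ?m True (c ?m)" using mon_single_c[of 1 ?m ?m] n by simp
          ultimately show ?thesis using b(1) by (intro mid[of "\<not> p" b True "c ?m"]) auto
        next
          case False
          then have "c (Suc ?m) * s i = s i * c (Suc ?m)"
            using mon_s n s_c_comm[of i "Suc ?m"] by auto
          then have "x * s i = b * s i * c (Suc ?m)" using b by (simp add: mult.assoc)
          moreover have "mon 1 ?m (\<not> p) (b * s i)" using b mon_s False by (intro mon.intros) auto
          ultimately show ?thesis by (intro cliff[of _ "b * s i"]) auto
        qed
      next
        fix b b' q assume b: "mon 1 ?m q b" "mon 1 ?m (p \<noteq> q) b'" "x = b * s ?m * b'"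
        show ?thesis
        proof (cases "i = ?m")
          case False
          then have "mon 1 ?m (p \<noteq> q) (b' * s i)" using b mon_s by (intro mon.intros) auto
          moreover have "x * s i = b * s ?m * (b' * s i)" using b by (simp add: mult.assoc)
          ultimately show ?thesis using b(1) by (intro mid[of q b "p \<noteq> q" "b' * s i"]) auto
        next
          case True
          \<comment> \<open>The factor \<open>b'\<close> between two copies of \<open>s ?m\<close>
            is split in turn. If it avoids strand \<open>?m\<close>, the copies cancel. If it ends
            in \<open>c ?m\<close>, this letter leaves as \<open>c (Suc ?m)\<close> and the copies
            cancel again. If it contains \<open>s m\<close>, the braid relation leaves a single
            \<open>s ?m\<close>.\<close>
          from Suc.IH[OF b(2)] n have "?D m (p \<noteq> q) b'" by auto
          then show ?thesis
          proof (elim disjE conjE exE)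
            fix v assume v: "mon 1 m (p \<noteq> q) v" "b' = v"
            then have "v * s ?m = s ?m * v" using n by (intro mon_commute_s) auto
            then have "x * s i = b * (s ?m * s ?m) * v"
              using b v True by (simp add: mult.assoc)
            then have "x * s i = b * v" using n s_s[of ?m] mon_r_e[OF b(1)] by simp
            moreover have "mon 1 ?m p (b * v)"
              using mon_mult[of 1 ?m "p \<noteq> q" v q b] b v n mon_mono[OF v(1), of 1 ?m] by (cases p; cases q; simp)
            ultimately show ?thesis by (intro low) simp
          next
            fix v assume "mon 1 m (\<not> (p \<noteq> q)) v" "b' = v * c ?m"
            then have v: "mon 1 m (p = q) v" "b' = v * c ?m" by simp_all
            then have vs: "v * s ?m = s ?m * v" using n by (intro mon_commute_s) auto
            have "x * s i = b * (s ?m * v) * (c ?m * s ?m)"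
              using b v True by (simp add: mult.assoc)
            also have "c ?m * s ?m = s ?m * c (Suc ?m)" using s_c'[of ?m] n by simp
            also have "b * (s ?m * v) * (s ?m * c (Suc ?m)) = b * (v * (s ?m * s ?m)) * c (Suc ?m)"
              unfolding vs[symmetric] by (simp add: mult.assoc)
            also have "v * (s ?m * s ?m) = v"
              using v n s_s[of ?m] mon_r_e[OF v(1)] by simp
            finally have "x * s i = b * v * c (Suc ?m)" .
            moreover have "mon 1 ?m (\<not> p) (b * v)"
              using mon_mult[of 1 ?m "p = q" v q b] b v n mon_mono[OF v(1), of 1 ?m]
              by (cases p; cases q; simp)
            ultimately show ?thesis by (intro cliff[of _ "b * v"]) auto
          next
            fix u v r assume m: "1 \<le> m" and v': "mon 1 m r u" "mon 1 m ((p \<noteq> q) \<noteq> r) v" "b' = u * s m * v"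
            have "((p \<noteq> q) \<noteq> r) = (p \<noteq> (q \<noteq> r))" by auto
            then have v: "mon 1 m r u" "mon 1 m (p \<noteq> (q \<noteq> r)) v" "b' = u * s m * v" using v' by simp_all
            have us: "u * s ?m = s ?m * u" and vs: "v * s ?m = s ?m * v"
              using n v by (auto intro: mon_commute_s)
            have "x * s i = b * (s ?m * u) * s m * (v * s ?m)"
              using b v True by (simp add: mult.assoc)
            also have "\<dots> = b * u * (s ?m * s m * s ?m) * v"
              unfolding us[symmetric] vs by (simp add: mult.assoc)
            also have "s ?m * s m * s ?m = s m * s ?m * s m"
              using braid[of m] n m by simp
            also have "b * u * (s m * s ?m * s m) * v = (b * u * s m) * s ?m * (s m * v)"
              by (simp add: mult.assoc)
            finally have eq: "x * s i = (b * u * s m) * s ?m * (s m * v)" .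
            have "mon 1 ?m (q \<noteq> r) (b * u)"
              using mon_mult[of 1 ?m r u q b] b v n mon_mono[OF v(1), of 1 ?m] by simp
            then have 1: "mon 1 ?m (q \<noteq> r) (b * u * s m)" using m by (intro mon.mon_s) auto
            have 2: "mon 1 ?m (p \<noteq> (q \<noteq> r)) (s m * v)"
              using mon_mult[of 1 ?m "p \<noteq> (q \<noteq> r)" v False "s m"] v n m mon_mono[OF v(2), of 1 ?m] mon_single_s[of 1 m ?m]
              by (cases p; cases q; simp)
            from eq 1 2 show ?thesis by (intro mid[of "q \<noteq> r" "b * u * s m" "p \<noteq> (q \<noteq> r)" "s m * v"]) auto
          qed
        qed
      qed
    next
      case (mon_c p x i)
      from mon_c(4) show ?case
      proof (elim disjE conjE exE)
        fix b assume b: "mon 1 ?m p b" "x = b"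
        show ?thesis
        proof (cases "i = Suc ?m")
          case True
          with b show ?thesis by (intro cliff[of _ b]) simp_all
        next
          case False
          with b mon_c have "mon 1 ?m (\<not> p) (b * c i)" by (intro mon.intros) auto
          with b show ?thesis by (intro low) simp
        qed
      next
        fix b assume b: "mon 1 ?m (\<not> p) b" "x = b * c (Suc ?m)"
        show ?thesis
        proof (cases "i = Suc ?m")
          case True
          then have "x * c i = b" using b n mon_r_e[OF b(1)] c_c[of "Suc ?m"] by (simp add: mult.assoc)
          with b show ?thesis by (intro low) simp
        next
          case False
          then have "c (Suc ?m) * c i = - (c i * c (Suc ?m))"
            using mon_c n c_anti[of "Suc ?m" i] by auto
          then have "x * c i = - (b * c i) * c (Suc ?m)" using b by (simp add: mult.assoc)
          moreover have "mon 1 ?m p (- (b * c i))" using mon.mon_c[of 1 ?m "\<not> p" b i] b mon_c(2,3) False by (simp add: mon.mon_neg)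
          ultimately show ?thesis by (intro cliff[of _ "- (b * c i)"]) simp_all
        qed
      next
        fix b b' q assume b: "mon 1 ?m q b" "mon 1 ?m (p \<noteq> q) b'" "x = b * s ?m * b'"
        show ?thesis
        proof (cases "i = Suc ?m")
          case False
          then have "mon 1 ?m (p = q) (b' * c i)" using mon.mon_c[of 1 ?m "p \<noteq> q" b' i] b(2) mon_c(2,3) by simp
          moreover have "x * c i = b * s ?m * (b' * c i)" using b by (simp add: mult.assoc)
          ultimately show ?thesis using b(1) by (intro mid[of q b "p = q" "b' * c i"]) auto
        next
          case True
          \<comment> \<open>Carried to the left through \<open>b'\<close> and \<open>s ?m\<close>,
            the generator on the last strand becomes \<open>c ?m\<close> and joins the left factor;
            the sign is put into \<open>b'\<close>.\<close>
          have "b' * c i = sgn_comm (p \<noteq> q) True (c i * b')" using b n True by (intro mon_commute_c) auto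
          moreover have "s ?m * c i = c ?m * s ?m" using s_c'[of ?m] n True by simp
          then have "s ?m * (c i * b') = c ?m * (s ?m * b')" by (simp only: mult.assoc[symmetric])
          moreover have "x * c i = b * s ?m * (b' * c i)" using b by (simp add: mult.assoc)
          ultimately have "x * c i = b * c ?m * s ?m * sgn_comm (p \<noteq> q) True b'"
            by (cases "p \<noteq> q") (auto simp: mult.assoc)
          moreover have "mon 1 ?m (\<not> q) (b * c ?m)" using b by (intro mon.intros) auto
          moreover have "mon 1 ?m (p \<noteq> q) (sgn_comm (p \<noteq> q) True b')" using b(2) by (auto simp: sgn_comm_def intro: mon.mon_neg)
          ultimately show ?thesis by (intro mid[of "\<not> q" "b * c ?m" "p \<noteq> q" "sgn_comm (p \<noteq> q) True b'"]) auto
        qed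
      qed
    qed
  qed
  then show thesis using that by blast
qed

end

section \<open>Cycles, blocks and the permutations that move strands\<close>

context sergeev_words
begin

text \<open>\<open>chain a k\<close> is the \<open>(k + 1)\<close>-cycle on the strands
  \<open>a\<close> to \<open>a + k\<close>: it sends each strand to the next one and the last back
  to \<open>a\<close>. A block of length \<open>k\<close> therefore uses
  \<open>chain m (k - 1)\<close>, and its Clifford generator sits on its first strand.\<close>

primrec chain :: "nat \<Rightarrow> nat \<Rightarrow> 'a" where
  "chain a 0 = e"
| "chain a (Suc k) = s a * chain (Suc a) k"

primrec blocks :: "nat \<Rightarrow> nat list \<Rightarrow> 'a" where
  "blocks m [] = e"
| "blocks m (k # ks) = c m * chain m (k - 1) * blocks (m + k) ks"

lemma mon_chain: "1 \<le> a \<Longrightarrow> a + k \<le> n \<Longrightarrow> mon a (a + k) False (chain a k)"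
proof (induction k arbitrary: a)
  case (Suc k)
  have "mon (Suc a) (Suc a + k) False (chain (Suc a) k)" using Suc by (intro Suc.IH) auto
  then have "mon a (a + Suc k) False (chain (Suc a) k)" by (rule mon_mono) auto
  with Suc show ?case using mon_mult[of a "a + Suc k" False "chain (Suc a) k" False "s a"] mon_single_s[of a a "a + Suc k"]
    by auto
qed (auto intro: mon.intros)

lemma chain_c_last: "1 \<le> a \<Longrightarrow> a + k \<le> n \<Longrightarrow> chain a k * c (a + k) = c a * chain a k"
proof (induction k arbitrary: a)
  case 0
  then show ?case by (simp add: e_c c_e)
next
  case (Suc k)
  have "chain (Suc a) k * c (Suc a + k) = c (Suc a) * chain (Suc a) k" using Suc by (intro Suc.IH) auto
  moreover have "s a * c (Suc a) = c a * s a" using s_c'[of a] Suc.prems by auto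
  ultimately show ?case by (simp add: mult.assoc) (metis mult.assoc)
qed

lemma chain_c: "1 \<le> a \<Longrightarrow> a + k \<le> n \<Longrightarrow> a \<le> j \<Longrightarrow> j < a + k \<Longrightarrow> chain a k * c j = c (Suc j) * chain a k"
proof (induction k arbitrary: a)
  case (Suc k)
  show ?case
  proof (cases "j = a")
    case True
    have "chain (Suc a) k * c a = c a * chain (Suc a) k"
      using mon_commute_c[OF mon_chain[of "Suc a" k], of a] Suc.prems by simp
    moreover have "s a * c a = c (Suc a) * s a" using s_c[of a] Suc.prems by auto
    ultimately show ?thesis using True by (simp add: mult.assoc) (metis mult.assoc)
  next
    case False
    have "chain (Suc a) k * c j = c (Suc j) * chain (Suc a) k" using Suc False by (intro Suc.IH) auto
    moreover have "s a * c (Suc j) = c (Suc j) * s a" using Suc.prems False by (intro s_c_comm) auto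
    ultimately show ?thesis by (simp add: mult.assoc) (metis mult.assoc)
  qed
qed simp

lemma mon_blocks:
  "1 \<le> m \<Longrightarrow> m + sum_list ks \<le> Suc N \<Longrightarrow> N \<le> n \<Longrightarrow> \<forall>k\<in>set ks. 0 < k \<Longrightarrow> mon m N (odd (length ks)) (blocks m ks)"
proof (induction ks arbitrary: m)
  case (Cons k ks)
  have "mon (m + k) N (odd (length ks)) (blocks (m + k) ks)" using Cons by (intro Cons.IH) auto
  then have 1: "mon m N (odd (length ks)) (blocks (m + k) ks)" by (rule mon_mono) auto
  have "mon m (m + (k - 1)) False (chain m (k - 1))" using Cons.prems by (intro mon_chain) auto
  then have 2: "mon m N False (chain m (k - 1))" using Cons.prems by (elim mon_mono) auto
  have 3: "mon m N True (c m)" using Cons.prems by (intro mon_single_c) auto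
  from mon_mult[OF 1 mon_mult[OF 2 3]] Cons.prems show ?case by (simp add: even_Suc)
qed (auto intro: mon.intros)

text \<open>The product \<open>s (j + b - 1) * ... * s j\<close>. It carries strand \<open>j\<close>
  past the next \<open>b\<close> strands, each of which moves down by one; \<open>desc_inv\<close>
  has the same letters in reverse order.\<close>

primrec desc :: "nat \<Rightarrow> nat \<Rightarrow> 'a" where
  "desc j 0 = e"
| "desc j (Suc b) = s (j + b) * desc j b"

primrec desc_inv :: "nat \<Rightarrow> nat \<Rightarrow> 'a" where
  "desc_inv j 0 = e"
| "desc_inv j (Suc b) = desc_inv j b * s (j + b)"

lemma mon_desc: "1 \<le> j \<Longrightarrow> j + b \<le> n \<Longrightarrow> mon j (j + b) False (desc j b)"
proof (induction b)
  case (Suc b)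
  then have "mon j (j + Suc b) False (desc j b)" by (intro mon_mono[OF Suc.IH]) auto
  with Suc show ?case using mon_mult[of j "j + Suc b" False "desc j b" False "s (j + b)"]
      mon_single_s[of j "j + b" "j + Suc b"] by auto
qed (auto intro: mon.intros)

lemma mon_desc_inv: "1 \<le> j \<Longrightarrow> j + b \<le> n \<Longrightarrow> mon j (j + b) False (desc_inv j b)"
proof (induction b)
  case (Suc b)
  then have "mon j (j + Suc b) False (desc_inv j b)" by (intro mon_mono[OF Suc.IH]) auto
  then show ?case by (auto intro: mon.intros)
qed (auto intro: mon.intros)

lemma desc_desc_inv: "1 \<le> j \<Longrightarrow> j + b \<le> n \<Longrightarrow> desc j b * desc_inv j b = e \<and> desc_inv j b * desc j b = e"
proof (induction b)
  case (Suc b)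
  have "desc j (Suc b) * desc_inv j (Suc b) = s (j + b) * (desc j b * desc_inv j b) * s (j + b)"
    by (simp add: mult.assoc)
  also have "\<dots> = e" using Suc s_s[of "j + b"] by (simp add: s_e)
  finally have 1: "desc j (Suc b) * desc_inv j (Suc b) = e" .
  have "desc_inv j (Suc b) * desc j (Suc b) = desc_inv j b * (s (j + b) * s (j + b)) * desc j b"
    by (simp add: mult.assoc)
  also have "\<dots> = e"
    using Suc s_s[of "j + b"] mon_r_e[OF mon_desc_inv, of j b] by simp
  finally show ?case using 1 by simp
qed (simp add: e_e)

lemma desc_c_first: "1 \<le> j \<Longrightarrow> j + b \<le> n \<Longrightarrow> desc j b * c j = c (j + b) * desc j b"
proof (induction b)
  case (Suc b)
  then have "desc j b * c j = c (j + b) * desc j b" by auto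
  moreover have "s (j + b) * c (j + b) = c (Suc (j + b)) * s (j + b)" using s_c[of "j + b"] Suc.prems by auto
  ultimately show ?case by (simp add: mult.assoc) (metis mult.assoc)
qed (simp add: e_c c_e)

lemma desc_c:
  "1 \<le> j \<Longrightarrow> j + b \<le> n \<Longrightarrow> j \<le> i \<Longrightarrow> i < j + b \<Longrightarrow> desc j b * c (Suc i) = c i * desc j b"
proof (induction b)
  case (Suc b)
  show ?case
  proof (cases "i = j + b")
    case True
    have "desc j b * c (Suc i) = c (Suc i) * desc j b"
      using mon_commute_c[OF mon_desc[of j b], of "Suc i"] Suc.prems True by simp
    moreover have "s (j + b) * c (Suc i) = c i * s (j + b)" using s_c'[of "j + b"] True Suc.prems by auto
    ultimately show ?thesis by (simp add: mult.assoc) (metis mult.assoc)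
  next
    case False
    then have "desc j b * c (Suc i) = c i * desc j b" using Suc by auto
    moreover have "s (j + b) * c i = c i * s (j + b)" using Suc.prems False by (intro s_c_comm) auto
    ultimately show ?thesis by (simp add: mult.assoc) (metis mult.assoc)
  qed
qed simp

lemma desc_s:
  "1 \<le> j \<Longrightarrow> j + b \<le> n \<Longrightarrow> j \<le> i \<Longrightarrow> Suc i < j + b \<Longrightarrow> desc j b * s (Suc i) = s i * desc j b"
proof (induction b)
  case (Suc b)
  show ?case
  proof (cases "Suc i = j + b")
    case True
    with Suc.prems obtain b' where b: "b = Suc b'" by (cases b) auto
    with True have i: "i = j + b'" by auto
    have "desc j b' * s (Suc i) = s (Suc i) * desc j b'"
      using mon_commute_s[OF mon_desc[of j b'], of "Suc i"] Suc.prems b i by simp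
    moreover have "s (Suc i) * s i * s (Suc i) = s i * s (Suc i) * s i"
      using braid[of i] Suc.prems by auto
    ultimately show ?thesis using b i by (simp add: mult.assoc) (metis mult.assoc)
  next
    case False
    then have "desc j b * s (Suc i) = s i * desc j b" using Suc by auto
    moreover have "s (j + b) * s i = s i * s (j + b)" using Suc.prems False by (intro s_comm) auto
    ultimately show ?thesis by (simp add: mult.assoc) (metis mult.assoc)
  qed
qed simp

text \<open>Two neighbouring strands carried in parallel past \<open>b\<close> others still cross
  each other in the same way afterwards. Each further strand costs one braid move.\<close>

lemma desc_desc_s:
  "1 \<le> j \<Longrightarrow> Suc j + b \<le> n \<Longrightarrow> desc j b * desc (Suc j) b * s j = s (j + b) * desc j b * desc (Suc j) b"
proof (induction b)
  case (Suc b)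
  let ?p = "s (j + b)" and ?q = "s (Suc (j + b))" and ?g = "desc j b * desc (Suc j) b"
  have "desc j b * ?q = ?q * desc j b"
    using mon_commute_s[OF mon_desc[of j b], of "Suc (j + b)"] Suc.prems by simp
  then have eq: "desc j (Suc b) * desc (Suc j) (Suc b) = ?p * ?q * ?g"
    by (simp add: mult.assoc) (metis mult.assoc)
  have "?p * ?q * ?g * s j = ?p * ?q * (?g * s j)" by (simp add: mult.assoc)
  also have "?g * s j = ?p * ?g" using Suc by (simp add: mult.assoc)
  also have "?p * ?q * (?p * ?g) = (?p * ?q * ?p) * ?g" by (simp add: mult.assoc)
  also have "?p * ?q * ?p = ?q * ?p * ?q" using braid[of "j + b"] Suc.prems by auto
  finally show ?case unfolding mult.assoc[of _ _ "desc (Suc j) (Suc b)"] eq by (simp add: mult.assoc)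
qed (simp add: e_s s_e e_e mult.assoc)

text \<open>Moves \<open>a\<close> strands starting at position \<open>m\<close> across the next \<open>b\<close> strands.\<close>

primrec shuffle :: "nat \<Rightarrow> nat \<Rightarrow> nat \<Rightarrow> 'a" where
  "shuffle m b 0 = e"
| "shuffle m b (Suc a) = shuffle m b a * desc (m + a) b"

primrec shuffle_inv :: "nat \<Rightarrow> nat \<Rightarrow> nat \<Rightarrow> 'a" where
  "shuffle_inv m b 0 = e"
| "shuffle_inv m b (Suc a) = desc_inv (m + a) b * shuffle_inv m b a"

lemma mon_shuffle: "1 \<le> m \<Longrightarrow> m + a + b \<le> Suc N \<Longrightarrow> N \<le> n \<Longrightarrow> mon m N False (shuffle m b a)"
proof (induction a)
  case (Suc a)
  have "mon m N False (desc (m + a) b)" using Suc.prems by (intro mon_mono[OF mon_desc]) auto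
  moreover have "mon m N False (shuffle m b a)" using Suc by auto
  ultimately show ?case using mon_mult[of m N False _ False] Suc.prems by auto
qed (auto intro: mon.intros)

lemma mon_shuffle_inv: "1 \<le> m \<Longrightarrow> m + a + b \<le> Suc N \<Longrightarrow> N \<le> n \<Longrightarrow> mon m N False (shuffle_inv m b a)"
proof (induction a)
  case (Suc a)
  have "mon m N False (desc_inv (m + a) b)" using Suc.prems by (intro mon_mono[OF mon_desc_inv]) auto
  moreover have "mon m N False (shuffle_inv m b a)" using Suc by auto
  ultimately show ?case using mon_mult[of m N False _ False] Suc.prems by auto
qed (auto intro: mon.intros)

lemma shuffle_inv_shuffle:
  "1 \<le> m \<Longrightarrow> m + a + b \<le> Suc n \<Longrightarrow>
    shuffle_inv m b a * shuffle m b a = e \<and> shuffle m b a * shuffle_inv m b a = e"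
proof (induction a)
  case (Suc a)
  then have IH: "shuffle_inv m b a * shuffle m b a = e" "shuffle m b a * shuffle_inv m b a = e" by auto
  have d: "desc (m + a) b * desc_inv (m + a) b = e" "desc_inv (m + a) b * desc (m + a) b = e"
    using desc_desc_inv[of "m + a" b] Suc.prems by auto
  have "shuffle_inv m b (Suc a) * shuffle m b (Suc a)
    = desc_inv (m + a) b * (shuffle_inv m b a * shuffle m b a) * desc (m + a) b" by (simp add: mult.assoc)
  also have "\<dots> = e" using IH d mon_r_e[OF mon_desc_inv, of "m + a" b] Suc.prems by simp
  finally have 1: "shuffle_inv m b (Suc a) * shuffle m b (Suc a) = e" .
  have "shuffle m b (Suc a) * shuffle_inv m b (Suc a)
    = shuffle m b a * (desc (m + a) b * desc_inv (m + a) b) * shuffle_inv m b a" by (simp add: mult.assoc)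
  also have "\<dots> = e" using IH d mon_r_e[OF mon_shuffle, of m a b n] Suc.prems by simp
  finally show ?case using 1 by simp
qed (simp add: e_e)

lemma shuffle_c1:
  "1 \<le> m \<Longrightarrow> m + a + b \<le> Suc n \<Longrightarrow> m \<le> j \<Longrightarrow> j < m + a \<Longrightarrow> shuffle m b a * c j = c (j + b) * shuffle m b a"
proof (induction a)
  case (Suc a)
  show ?case
  proof (cases "j = m + a")
    case True
    have "desc (m + a) b * c j = c (j + b) * desc (m + a) b" using Suc.prems True by (simp add: desc_c_first)
    moreover have "shuffle m b a * c (j + b) = c (j + b) * shuffle m b a"
      using mon_commute_c[OF mon_shuffle[of m a b "m + a + b - 1"], of "j + b"] Suc.prems True by auto
    ultimately show ?thesis by (simp add: mult.assoc) (metis mult.assoc)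
  next
    case False
    have "desc (m + a) b * c j = c j * desc (m + a) b"
      using mon_commute_c[OF mon_desc[of "m + a" b], of j] Suc.prems False by auto
    moreover have "shuffle m b a * c j = c (j + b) * shuffle m b a" using Suc False by auto
    ultimately show ?thesis by (simp add: mult.assoc) (metis mult.assoc)
  qed
qed simp

lemma shuffle_s1:
  "1 \<le> m \<Longrightarrow> m + a + b \<le> Suc n \<Longrightarrow> m \<le> j \<Longrightarrow> Suc j < m + a \<Longrightarrow> shuffle m b a * s j = s (j + b) * shuffle m b a"
proof (induction a)
  case (Suc a)
  show ?case
  proof (cases "Suc j = m + a")
    case True
    with Suc.prems obtain a' where a: "a = Suc a'" by (cases a) auto
    with True have j: "j = m + a'" by simp
    have c: "shuffle m b a' * s (j + b) = s (j + b) * shuffle m b a'"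
      using mon_commute_s[OF mon_shuffle[of m a' b "m + a' + b - 1"], of "j + b"] Suc.prems a j by auto
    have d: "desc j b * desc (Suc j) b * s j = s (j + b) * desc j b * desc (Suc j) b"
      using Suc.prems a j by (intro desc_desc_s) auto
    have eq: "shuffle m b (Suc a) = shuffle m b a' * (desc j b * desc (Suc j) b)"
      using a j by (simp add: mult.assoc)
    have "shuffle m b (Suc a) * s j = shuffle m b a' * (desc j b * desc (Suc j) b * s j)"
      unfolding eq by (simp only: mult.assoc)
    also have "\<dots> = shuffle m b a' * s (j + b) * (desc j b * desc (Suc j) b)"
      unfolding d by (simp only: mult.assoc)
    finally show ?thesis unfolding c eq by (simp only: mult.assoc)
  next
    case False
    have "desc (m + a) b * s j = s j * desc (m + a) b"
      using mon_commute_s[OF mon_desc[of "m + a" b], of j] Suc.prems False by auto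
    moreover have "shuffle m b a * s j = s (j + b) * shuffle m b a" using Suc False by auto
    ultimately show ?thesis by (simp add: mult.assoc) (metis mult.assoc)
  qed
qed simp

lemma shuffle_c2:
  "1 \<le> m \<Longrightarrow> m + a + b \<le> Suc n \<Longrightarrow> m \<le> i \<Longrightarrow> i < m + b \<Longrightarrow> shuffle m b a * c (i + a) = c i * shuffle m b a"
proof (induction a)
  case 0
  then show ?case by (simp add: e_c c_e)
next
  case (Suc a)
  have "desc (m + a) b * c (Suc (i + a)) = c (i + a) * desc (m + a) b" using Suc.prems by (intro desc_c) auto
  moreover have "shuffle m b a * c (i + a) = c i * shuffle m b a" using Suc by auto
  ultimately show ?case by (simp add: mult.assoc) (metis mult.assoc)
qed

lemma shuffle_s2:
  "1 \<le> m \<Longrightarrow> m + a + b \<le> Suc n \<Longrightarrow> m \<le> i \<Longrightarrow> Suc i < m + b \<Longrightarrow> shuffle m b a * s (i + a) = s i * shuffle m b a"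
proof (induction a)
  case 0
  then show ?case by (simp add: e_s s_e)
next
  case (Suc a)
  have "desc (m + a) b * s (Suc (i + a)) = s (i + a) * desc (m + a) b" using Suc.prems by (intro desc_s) auto
  moreover have "shuffle m b a * s (i + a) = s i * shuffle m b a" using Suc by auto
  ultimately show ?case by (simp add: mult.assoc) (metis mult.assoc)
qed

lemma intertwine_chain:
  assumes "g * e = e * g"
  shows "(\<forall>i<k. g * s (j + i) = s (j' + i) * g) \<Longrightarrow> g * chain j k = chain j' k * g"
proof (induction k arbitrary: j j')
  case 0
  show ?case using assms by (simp only: chain.simps)
next
  case (Suc k)
  have "\<forall>i<k. g * s (Suc j + i) = s (Suc j' + i) * g"
  proof (intro allI impI)
    fix i assume "i < k"
    then have "g * s (j + Suc i) = s (j' + Suc i) * g" using Suc.prems by blast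
    then show "g * s (Suc j + i) = s (Suc j' + i) * g" by (simp only: add_Suc add_Suc_right)
  qed
  then have IH: "g * chain (Suc j) k = chain (Suc j') k * g" by (rule Suc.IH)
  have "g * s (j + 0) = s (j' + 0) * g" using Suc.prems by blast
  then have "g * s j * chain (Suc j) k = s j' * (g * chain (Suc j) k)" by (simp only: add_0_right mult.assoc)
  then show ?case by (simp only: chain.simps IH mult.assoc)
qed

end

section \<open>Reduction of words to products of blocks modulo supercommutators\<close>

locale sergeev_trace = sergeev_words n e s c for n :: nat and e :: "'a::ring" and s c +
  fixes N :: "'a set"
  assumes N_zero: "0 \<in> N" and N_diff: "x \<in> N \<Longrightarrow> y \<in> N \<Longrightarrow> x - y \<in> N"
    and N_comm: "mon 1 n p x \<Longrightarrow> mon 1 n p y \<Longrightarrow> x * y - sgn_comm p p (y * x) \<in> N"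
    and N_half: "mon 1 n False x \<Longrightarrow> x + x \<in> N \<Longrightarrow> x \<in> N"
begin

lemma N_uminus: "x \<in> N \<Longrightarrow> - x \<in> N" using N_diff[OF N_zero, of x] by simp
lemma N_add: "x \<in> N \<Longrightarrow> y \<in> N \<Longrightarrow> x + y \<in> N" using N_diff[of x "- y"] N_uminus by simp

text \<open>Insert \<open>c (Suc m) * c (Suc m) = e\<close> and let \<open>r\<close> contain one of
  the two generators. Modulo \<open>N\<close> the other one may be taken from the left of
  \<open>r\<close> to the right, where the cycle shifts its index by one. After a full turn it is
  back with the opposite sign, so twice the element lies in \<open>N\<close> and
  \<open>N_half\<close> applies.\<close>

lemma uncliff_in_N:
  assumes b: "mon 1 m p b" and t: "mon (Suc (Suc (m + k))) n p t" and n: "Suc m + k \<le> n"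
  shows "b * chain (Suc m) k * t \<in> N"
proof -
  let ?m = "Suc m"
  define S where "S = chain ?m k"
  define r where "r = b * c ?m * S * t"
  have mS: "mon ?m (?m + k) False S" unfolding S_def using n by (intro mon_chain) auto
  have m1: "mon 1 n p b" "mon 1 n p t" "mon 1 n False S" "mon 1 n True (c ?m)"
    using n mon_mono[OF b, of 1 n] mon_mono[OF t, of 1 n] mon_mono[OF mS, of 1 n] mon_single_c[of 1 ?m n] by auto
  have r: "mon 1 n True r"
    using mon_mult[OF m1(2) mon_mult[OF m1(3) mon_mult[OF m1(4) m1(1)]]] unfolding r_def by simp
  have left: "b * c j * c ?m * S * t = sgn_comm p True (c j * r)" if "?m \<le> j" "j \<le> ?m + k" for j
  proof -
    have "b * c j = sgn_comm p True (c j * b)" using that n by (intro mon_commute_c[OF b]) auto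
    then show ?thesis unfolding r_def by (cases p) (simp_all add: mult.assoc[symmetric])
  qed
  have right: "r * c j = sgn_comm p True (b * c ?m * (S * c j) * t)" if "?m \<le> j" "j \<le> ?m + k" for j
  proof -
    have "t * c j = sgn_comm p True (c j * t)" using that n by (intro mon_commute_c[OF t]) auto
    then show ?thesis unfolding r_def by (cases p) (simp_all add: mult.assoc)
  qed
  have comm: "c j * r + r * c j \<in> N" if "?m \<le> j" "j \<le> ?m + k" for j
    using N_comm[OF mon_single_c[of 1 j n] r] that n by simp
  have be: "b * c ?m * (c ?m * S) * t = b * S * t"
  proof -
    have "b * c ?m * (c ?m * S) * t = b * (c ?m * c ?m) * S * t" by (simp only: mult.assoc)
    then show ?thesis using c_c[of ?m] n mon_r_e[OF b] by simp
  qed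
  \<comment> \<open>Each step of the turn keeps the sign: the sign of the supercommutator with
    \<open>r\<close> and the sign from exchanging the two Clifford generators cancel.\<close>
  have 1: "b * S * t - b * c (?m + j) * c ?m * S * t \<in> N" if "j \<le> k" for j
    using that
  proof (induction j)
    case 0
    then show ?case using be by (simp add: mult.assoc N_zero)
  next
    case (Suc j)
    then have j: "?m \<le> ?m + j" "?m + j \<le> ?m + k" by auto
    have "S * c (?m + j) = c (?m + Suc j) * S" unfolding S_def using chain_c[of ?m k "?m + j"] Suc.prems n by simp
    moreover have "c ?m * c (?m + Suc j) = - (c (?m + Suc j) * c ?m)" using Suc.prems n by (intro c_anti) auto
    ultimately have "b * c ?m * (S * c (?m + j)) * t = - (b * c (?m + Suc j) * c ?m * S * t)"
      by (simp add: mult.assoc[symmetric]) (simp add: mult.assoc)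
    with right[OF j] left[OF j] comm[OF j]
    have "b * c (?m + j) * c ?m * S * t - b * c (?m + Suc j) * c ?m * S * t \<in> N"
      by (cases p) (auto dest: N_uminus)
    from N_add[OF this Suc.IH] Suc.prems show ?case by simp
  qed
  \<comment> \<open>At the last strand the cycle returns the generator to strand \<open>?m\<close>,
    where it meets its twin and squares to \<open>e\<close>. No exchange takes place, so the sign of
    the supercommutator survives.\<close>
  have "S * c (?m + k) = c ?m * S" unfolding S_def using n by (intro chain_c_last) auto
  then have "r * c (?m + k) = sgn_comm p True (b * S * t)" using right[of "?m + k"] be by simp
  with left[of "?m + k"] comm[of "?m + k"] have "b * c (?m + k) * c ?m * S * t + b * S * t \<in> N"
    by (cases p) (auto dest: N_uminus)
  from N_add[OF 1[of k] this] have "b * S * t + b * S * t \<in> N" by simp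
  moreover have "mon 1 n False (b * S * t)"
    using mon_mult[OF m1(2) mon_mult[OF m1(3) m1(1)]] by simp
  ultimately show ?thesis using N_half unfolding S_def by blast
qed

definition same_class :: "'a \<Rightarrow> 'a \<Rightarrow> bool" where
  "same_class x y \<longleftrightarrow> x - y \<in> N \<or> x + y \<in> N"

lemma same_class_trans: "same_class x y \<Longrightarrow> same_class y z \<Longrightarrow> same_class x z"
  using N_add[of "x - y" "y - z"] N_add[of "x - y" "y + z"] N_diff[of "x + y" "y - z"] N_diff[of "x + y" "y + z"]
  unfolding same_class_def by auto

lemma same_class_uminus: "same_class (- x) x"
  by (simp add: same_class_def N_zero)

lemma same_class_N: "same_class x y \<Longrightarrow> y \<in> N \<Longrightarrow> x \<in> N"
  using N_add[of "x - y" y] N_diff[of "x + y" y] unfolding same_class_def by auto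

definition reducible :: "'a \<Rightarrow> bool" where
  "reducible x \<longleftrightarrow> x \<in> N \<or> (\<exists>ks. (\<forall>k\<in>set ks. 0 < k) \<and> sum_list ks = n \<and> even (length ks) \<and>
     same_class x (blocks 1 ks))"

lemma reducible_same: "same_class x y \<Longrightarrow> reducible y \<Longrightarrow> reducible x"
  unfolding reducible_def using same_class_trans same_class_N by blast

lemma reducible_diff: "x - y \<in> N \<Longrightarrow> reducible y \<Longrightarrow> reducible x"
  by (rule reducible_same[of x y]) (simp_all add: same_class_def)

lemma reducible_uminus: "reducible x \<Longrightarrow> reducible (- x)"
  using reducible_same same_class_uminus by blast

text \<open>The strands beyond \<open>m + k\<close> carry finished blocks, the chain starting at
  strand \<open>m\<close> is a cycle under construction, and \<open>a\<close> is confined to strands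
  up to \<open>m\<close>. Decomposing \<open>a\<close> at strand \<open>m\<close> decides about the
  cycle: without a Clifford generator there the word vanishes, with one the cycle becomes a finished
  block, and with an \<open>s (m - 1)\<close> it grows by one strand. In the last two cases the
  induction continues at \<open>m - 1\<close>, unless no strand is left.\<close>

lemma reducible_open_block:
  assumes "mon 1 m (odd (length ks)) a" "1 \<le> m" "m + k + sum_list ks = n" "\<forall>k\<in>set ks. 0 < k"
  shows "reducible (a * chain m k * blocks (Suc (m + k)) ks)"
  using assms
proof (induction m arbitrary: a k ks)
  case (Suc m)
  define t where "t = blocks (Suc (Suc m + k)) ks"
  define S where "S = chain (Suc m) k"
  have t: "mon (Suc (Suc (m + k))) n (odd (length ks)) t"
    unfolding t_def using Suc.prems mon_blocks[of "Suc (Suc m + k)" ks n] by simp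
  have S: "mon (Suc m) (Suc m + k) False S" unfolding S_def using Suc.prems by (intro mon_chain) auto
  have n: "Suc m \<le> n" using Suc.prems by auto
  have goal: "a * chain (Suc m) k * blocks (Suc (Suc m + k)) ks = a * S * t" by (simp add: S_def t_def)
  from Suc.prems(1) n show ?case unfolding goal
  proof (cases rule: mon_decompose)
    case (low b)
    then have "b * S * t \<in> N" using uncliff_in_N[OF low(1) t] Suc.prems by (simp add: S_def)
    then show "reducible (a * S * t)" using low by (simp add: reducible_def)
  next
    case (cliff b)
    then have eq: "a * S * t = b * blocks (Suc m) (Suc k # ks)" by (simp add: S_def t_def mult.assoc)
    show "reducible (a * S * t)"
    proof (cases "m = 0")
      case False
      have "reducible (b * chain m 0 * blocks (Suc (m + 0)) (Suc k # ks))"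
        using cliff Suc.prems False by (intro Suc.IH) auto
      then show ?thesis unfolding eq using mon_r_e[OF cliff(1)] n by simp
    next
      case True
      \<comment> \<open>No strand is left, so the remaining word is a signed unit. Being even, it
        forces the number of blocks to be even.\<close>
      have pm: "b' = e \<and> \<not> q \<or> b' = - e \<and> \<not> q" if "mon 1 0 q b'" for q b'
        using that by (induction rule: mon.induct) auto
      from pm[OF cliff(1)[unfolded True]] have b: "b = e \<or> b = - e" and ev: "even (length (Suc k # ks))" by auto
      let ?y = "blocks 1 (Suc k # ks)"
      have "e * ?y = ?y"
        using True Suc.prems mon_l_e[OF mon_blocks[of 1 "Suc k # ks" n]] by simp
      then have "a * S * t - ?y = 0 \<or> a * S * t + ?y = 0" unfolding eq using b True by auto
      then have "same_class (a * S * t) ?y" by (auto simp: same_class_def N_zero)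
      then show ?thesis unfolding reducible_def using ev True Suc.prems
        by (intro disjI2 exI[of _ "Suc k # ks"]) auto
    qed
  next
    case (mid b b' q)
    note b = mid(2) and b' = mid(3)
    have p: "(odd (length ks) \<noteq> q) = (odd (length ks) = (\<not> q))" by simp
    \<comment> \<open>The factor \<open>b'\<close> lies on strands below the chain and the blocks,
      so it passes both to the right end and from there, by a supercommutator, to the front.\<close>
    have c1: "b' * S = S * b'" using mon_commute[OF S b'] n Suc.prems by simp
    have c2: "b' * t = sgn_comm (odd (length ks) \<noteq> q) (odd (length ks)) (t * b')"
      using mon_commute[OF t b'] n Suc.prems by simp
    define z where "z = b * s m * S * t"
    have m1: "mon 1 n q b" "mon 1 n False (s m)" "mon 1 n False S" "mon 1 n (odd (length ks)) t"
      "mon 1 n (odd (length ks) \<noteq> q) b'"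
      using mon_mono[OF b, of 1 n] mon_mono[OF t, of 1 n] mon_mono[OF S, of 1 n] mon_mono[OF b', of 1 n]
        mon_single_s[of 1 m n] mid(1) Suc.prems by auto
    have z: "mon 1 n (odd (length ks) \<noteq> q) z"
      unfolding z_def using mon_mult[OF m1(4) mon_mult[OF m1(3) mon_mult[OF m1(2) m1(1)]]]
      by (cases "odd (length ks)"; cases q) auto
    have "a * S * t = b * s m * S * (b' * t)" using mid(4) c1 by (simp add: mult.assoc)
    then have eq: "a * S * t = sgn_comm (odd (length ks) \<noteq> q) (odd (length ks)) (z * b')"
      unfolding c2 z_def by (simp add: sgn_comm_def mult.assoc)
    have "b' * b * chain m (Suc k) = b' * b * s m * S" by (simp add: S_def mult.assoc)
    moreover have "reducible (b' * b * chain m (Suc k) * blocks (Suc (m + Suc k)) ks)"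
      using mon_mult[OF b b'] mid(1) Suc.prems by (intro Suc.IH) (cases "odd (length ks)"; cases q; auto)+
    ultimately have "reducible (b' * z)" by (simp add: z_def t_def mult.assoc)
    moreover have "z * b' - sgn_comm (odd (length ks) \<noteq> q) (odd (length ks) \<noteq> q) (b' * z) \<in> N"
      by (rule N_comm[OF z m1(5)])
    ultimately have "reducible (z * b')"
      using reducible_diff reducible_uminus by (auto simp: sgn_comm_def split: if_splits)
    then show "reducible (a * S * t)" unfolding eq by (simp add: sgn_comm_def reducible_uminus)
  qed
qed simp

lemma reducible_mon: "mon 1 n False a \<Longrightarrow> 1 \<le> n \<Longrightarrow> reducible a"
  using reducible_open_block[of n "[]" a 0] mon_r_e[of 1 n False a] by simp

lemma blocks_append:
  "1 \<le> m \<Longrightarrow> m + sum_list (ks @ ls) \<le> Suc n \<Longrightarrow> \<forall>k\<in>set (ks @ ls). 0 < k \<Longrightarrow>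
    blocks m (ks @ ls) = blocks m ks * blocks (m + sum_list ks) ls"
proof (induction ks arbitrary: m)
  case Nil
  then show ?case using mon_l_e[OF mon_blocks[of m ls n]] by simp
next
  case (Cons k ks)
  then have "blocks (m + k) (ks @ ls) = blocks (m + k) ks * blocks (m + k + sum_list ks) ls"
    by (intro Cons.IH) auto
  then show ?case by (simp add: mult.assoc add.assoc)
qed

text \<open>Conjugation by the shuffle \<open>g\<close> carries the two blocks to each other's
  places, but in the order \<open>D1 * D2\<close>. Being even, \<open>g\<close> costs no sign, while
  restoring the order of the odd elements \<open>D1\<close> and \<open>D2\<close> costs one.\<close>

lemma blocks_swap:
  assumes "\<forall>k\<in>set (ks @ k # l # ls). 0 < k" "sum_list (ks @ k # l # ls) = n" "even (length (ks @ k # l # ls))"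
  shows "blocks 1 (ks @ k # l # ls) + blocks 1 (ks @ l # k # ls) \<in> N"
proof -
  define m where "m = 1 + sum_list ks"
  define p where "p = odd (length ks)"
  define P where "P = blocks 1 ks"
  define t where "t = blocks (m + k + l) ls"
  define B1 where "B1 = c m * chain m (k - 1)"
  define B2 where "B2 = c (m + k) * chain (m + k) (l - 1)"
  define D1 where "D1 = c (m + l) * chain (m + l) (k - 1)"
  define D2 where "D2 = c m * chain m (l - 1)"
  define g where "g = shuffle m l k"
  define h where "h = shuffle_inv m l k"
  have pos: "0 < k" "0 < l" "1 \<le> m" "m + k + l \<le> Suc n" using assms by (auto simp: m_def)
  have ls: "odd (length ls) = p" using assms by (auto simp: p_def)
  have P: "mon 1 n p P" unfolding P_def p_def using assms by (intro mon_blocks) auto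
  have t: "mon (m + k + l) n p t" unfolding t_def ls[symmetric] using assms by (intro mon_blocks) (auto simp: m_def)
  have g1: "mon m (m + k + l - 1) False g" unfolding g_def using pos by (intro mon_shuffle) auto
  have g: "mon 1 n False g" and h: "mon 1 n False h"
    unfolding g_def h_def using pos mon_mono[OF mon_shuffle[of m k l n], of 1 n] mon_mono[OF mon_shuffle_inv[of m k l n], of 1 n]
    by auto
  have hg: "h * g = e" "g * h = e" unfolding g_def h_def using shuffle_inv_shuffle[of m k l] pos by auto
  have ge: "g * e = e * g" using mon_l_e[OF g] mon_r_e[OF g] by simp
  have "g * s (m + i) = s (m + l + i) * g" if "i < k - 1" for i
    using shuffle_s1[of m k l "m + i"] that pos unfolding g_def by (simp add: ac_simps)
  then have "g * chain m (k - 1) = chain (m + l) (k - 1) * g" by (intro intertwine_chain[OF ge]) blast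
  moreover have "g * c m = c (m + l) * g" using shuffle_c1[of m k l m] pos unfolding g_def by auto
  ultimately have gB1: "g * B1 = D1 * g" unfolding B1_def D1_def by (metis mult.assoc)
  have "g * s (m + k + i) = s (m + i) * g" if "i < l - 1" for i
    using shuffle_s2[of m k l "m + i"] that pos unfolding g_def by (simp add: ac_simps)
  then have "g * chain (m + k) (l - 1) = chain m (l - 1) * g" by (intro intertwine_chain[OF ge]) blast
  moreover have "g * c (m + k) = c m * g" using shuffle_c2[of m k l m] pos unfolding g_def by auto
  ultimately have gB2: "g * B2 = D2 * g" unfolding B2_def D2_def by (metis mult.assoc)
  have D1: "mon (m + l) (m + l + (k - 1)) True D1"
    using mon_mult[OF mon_chain[of "m + l" "k - 1"] mon_single_c[of "m + l" "m + l"]] pos unfolding D1_def by simp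
  have D2: "mon m (m + (l - 1)) True D2"
    using mon_mult[OF mon_chain[of m "l - 1"] mon_single_c[of m m]] pos unfolding D2_def by simp
  have DD: "D2 * D1 = - (D1 * D2)" using mon_commute[OF D1 D2] pos by simp
  have tg: "g * t = t * g" using mon_commute[OF t g1] pos by simp
  have D1': "mon 1 n True D1" and D2': "mon 1 n True D2" and t': "mon 1 n p t"
    using mon_mono[OF D1, of 1 n] mon_mono[OF D2, of 1 n] mon_mono[OF t, of 1 n] pos by auto
  \<comment> \<open>Chosen so that \<open>h * u\<close> is the given product of blocks and
    \<open>u * h\<close> the conjugated one; their difference is a supercommutator of even
    words.\<close>
  define u where "u = P * D1 * D2 * t * g"
  have u: "mon 1 n False u"
    using mon_mult[OF g mon_mult[OF t' mon_mult[OF D2' mon_mult[OF D1' P]]]] unfolding u_def by (cases p) auto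
  have PD: "mon 1 n False (P * D1 * D2 * t)"
    using mon_mult[OF t' mon_mult[OF D2' mon_mult[OF D1' P]]] by (cases p) auto
  have "mon 1 (m - 1) p P" unfolding P_def p_def using assms by (intro mon_blocks) (auto simp: m_def)
  then have "P * h = h * P"
    using mon_commute[OF mon_shuffle_inv[of m k l n], of 1 "m - 1" p P] pos unfolding h_def by auto
  then have "h * u = P * (h * (D1 * D2 * t * g))" by (simp only: u_def mult.assoc[symmetric])
  also have "D1 * D2 * t * g = D1 * D2 * g * t" by (simp only: tg mult.assoc)
  also have "D1 * D2 * g = g * (B1 * B2)"
    by (simp only: mult.assoc gB2[symmetric]) (simp only: mult.assoc[symmetric] gB1[symmetric])
  also have "P * (h * (g * (B1 * B2) * t)) = P * (h * g) * B1 * B2 * t" by (simp add: mult.assoc)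
  also have "P * (h * g) = P" using hg mon_r_e[OF P] by simp
  finally have hu: "h * u = P * B1 * B2 * t" .
  have "u * h = P * D1 * D2 * t * (g * h)" by (simp add: u_def mult.assoc)
  also have "\<dots> = P * D1 * D2 * t" using hg mon_r_e[OF PD] by simp
  finally have uh: "u * h = P * D1 * D2 * t" .
  have "h * u - u * h \<in> N" using N_comm[OF h u] by simp
  then have *: "P * B1 * B2 * t - P * D1 * D2 * t \<in> N" unfolding hu uh .
  have "P * D2 * D1 * t = - (P * D1 * D2 * t)"
  proof -
    have "P * D2 * D1 * t = P * (D2 * D1) * t" by (simp only: mult.assoc)
    then show ?thesis unfolding DD by (simp add: mult.assoc)
  qed
  with * have "P * B1 * B2 * t + P * D2 * D1 * t \<in> N" by simp
  moreover have "blocks 1 (ks @ k # l # ls) = P * B1 * B2 * t"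
    using assms by (subst blocks_append) (auto simp: P_def B1_def B2_def t_def m_def mult.assoc)
  moreover have "blocks 1 (ks @ l # k # ls) = P * D2 * D1 * t"
    using assms by (subst blocks_append) (auto simp: P_def D1_def D2_def t_def m_def mult.assoc ac_simps)
  ultimately show ?thesis by simp
qed

text \<open>The prefix \<open>hs\<close> holds the parts already in place, and the next part of
  \<open>ls\<close> is brought to the front by adjacent interchanges. The sign of the rearrangement
  is not tracked.\<close>

lemma blocks_mset:
  assumes "mset ks = mset ls" "\<forall>k\<in>set (hs @ ks). 0 < k" "sum_list (hs @ ks) = n" "even (length (hs @ ks))"
  shows "same_class (blocks 1 (hs @ ks)) (blocks 1 (hs @ ls))"
  using assms
proof (induction ls arbitrary: hs ks)
  case Nil
  then show ?case by (simp add: same_class_def N_zero)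
next
  case (Cons l ls)
  then have "l \<in> set ks" by (metis list.set_intros(1) set_mset_mset)
  then obtain us vs where ks: "ks = us @ l # vs" by (auto dest: split_list)
  have move: "same_class (blocks 1 (hs @ us @ l # vs)) (blocks 1 (hs @ l # us @ vs))"
    using Cons.prems(2-4) unfolding ks
  proof (induction us arbitrary: vs rule: rev_induct)
    case Nil
    then show ?case by (simp add: same_class_def N_zero)
  next
    case (snoc u us)
    have "same_class (blocks 1 ((hs @ us) @ u # l # vs)) (blocks 1 ((hs @ us) @ l # u # vs))"
      unfolding same_class_def using snoc.prems by (intro disjI2 blocks_swap) auto
    moreover have "same_class (blocks 1 (hs @ us @ l # (u # vs))) (blocks 1 (hs @ l # us @ (u # vs)))"
      using snoc.prems by (intro snoc.IH) auto
    ultimately show ?case using same_class_trans by auto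
  qed
  have "same_class (blocks 1 ((hs @ [l]) @ (us @ vs))) (blocks 1 ((hs @ [l]) @ ls))"
    using Cons.prems ks by (intro Cons.IH) auto
  with move show ?case using same_class_trans by (simp add: ks)
qed

theorem spanning:
  assumes "mon 1 n False a" "1 \<le> n"
  shows "a \<in> N \<or> (\<exists>ks. sorted_wrt (>) ks \<and> (\<forall>k\<in>set ks. 0 < k) \<and> sum_list ks = n \<and> even (length ks) \<and>
     (a - blocks 1 ks \<in> N \<or> a + blocks 1 ks \<in> N))"
proof -
  have "reducible a" using assms by (rule reducible_mon)
  then consider "a \<in> N" | ks where "\<forall>k\<in>set ks. 0 < k" "sum_list ks = n" "even (length ks)"
    "same_class a (blocks 1 ks)" unfolding reducible_def by blast
  then show ?thesis
  proof cases
    case 2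
    show ?thesis
    proof (cases "distinct ks")
      case True
      define ls where "ls = rev (sort ks)"
      have ls: "mset ls = mset ks" "set ls = set ks" "sum_list ls = sum_list ks" "length ls = length ks"
        unfolding ls_def by (simp_all add: sum_list_rev) (metis mset_sort sum_mset_sum_list)
      have "sorted_wrt (>) ls"
        unfolding ls_def sorted_wrt_rev using True by (simp add: strict_sorted_iff)
      moreover have "same_class (blocks 1 ks) (blocks 1 ls)"
        using blocks_mset[of ks ls "[]"] ls 2 by simp
      with 2(4) have "same_class a (blocks 1 ls)" by (rule same_class_trans)
      ultimately show ?thesis using 2 ls unfolding same_class_def
        by (intro disjI2 exI[of _ ls]) auto
    next
      case False
      then obtain us vs ws k where ks: "ks = us @ [k] @ vs @ [k] @ ws" using not_distinct_decomp by blast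
      let ?ls = "k # k # us @ vs @ ws"
      have "same_class (blocks 1 ks) (blocks 1 ?ls)"
        using blocks_mset[of ks ?ls "[]"] 2 by (simp add: ks)
      with 2(4) have *: "same_class a (blocks 1 ?ls)" by (rule same_class_trans)
      have "blocks 1 ?ls + blocks 1 ?ls \<in> N" using blocks_swap[of "[]" k k "us @ vs @ ws"] 2 by (simp add: ks)
      moreover have "mon 1 n (odd (length ?ls)) (blocks 1 ?ls)"
        using 2 by (intro mon_blocks) (auto simp: ks)
      moreover have "odd (length ?ls) = False" using 2(3) by (auto simp: ks)
      ultimately have "blocks 1 ?ls \<in> N" by (metis N_half)
      with * have "a \<in> N" by (rule same_class_N)
      then show ?thesis by simp
    qed
  qed simp
qed

end

section \<open>Jucys--Murphy elements\<close>

text \<open>Under \<open>x\<^sub>1 = 0\<close> the relation between \<open>s\<^sub>i\<close> and \<open>x\<^sub>i\<close> determines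
  all the \<open>x\<^sub>i\<close>.\<close>

locale infinite_sergeev =
  fixes s c :: "nat \<Rightarrow> 'a::ring_1"
  assumes s_s: "s i * s i = 1"
    and s_comm: "i + 1 < j \<or> j + 1 < i \<Longrightarrow> s i * s j = s j * s i"
    and braid: "s i * s (i + 1) * s i = s (i + 1) * s i * s (i + 1)"
    and c_c: "c i * c i = 1"
    and c_anti: "i \<noteq> j \<Longrightarrow> c i * c j = - (c j * c i)"
    and s_c: "s i * c i = c (i + 1) * s i"
    and s_c': "s i * c (i + 1) = c i * s i"
    and s_c_comm: "j \<noteq> i \<Longrightarrow> j \<noteq> i + 1 \<Longrightarrow> s i * c j = c j * s i"
begin

text \<open>The recursion is the relation between \<open>s i\<close> and \<open>x i\<close>, solved
  for the next element by multiplying with \<open>s i\<close> on the right. Strands are numbered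
  from 1, so the value at 0 is a filler.\<close>

fun murphy :: "nat \<Rightarrow> 'a" where
  "murphy 0 = 0"
| "murphy (Suc 0) = 0"
| "murphy (Suc (Suc i)) = s (Suc i) * murphy (Suc i) * s (Suc i) + s (Suc i) + c (Suc i) * c (Suc (Suc i)) * s (Suc i)"

lemma murphy_Suc: "1 \<le> i \<Longrightarrow> murphy (Suc i) = s i * murphy i * s i + s i + c i * c (Suc i) * s i"
  by (cases i) auto

lemma s_murphy: "1 \<le> i \<Longrightarrow> s i * murphy i = murphy (i + 1) * s i - (1 + c i * c (i + 1))"
  by (simp add: murphy_Suc distrib_right mult.assoc s_s)

lemma s_s_left: "s i * (s i * x) = x"
  by (simp add: mult.assoc[symmetric] s_s)

lemma c_c_left: "c i * (c i * x) = x"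
  by (simp add: mult.assoc[symmetric] c_c)

definition commutes :: "'a \<Rightarrow> 'a \<Rightarrow> bool" where
  "commutes x y \<longleftrightarrow> x * y = y * x"

lemma commutes_add: "commutes x a \<Longrightarrow> commutes x b \<Longrightarrow> commutes x (a + b)"
  by (simp add: commutes_def distrib_left distrib_right)

lemma commutes_mult: "commutes x a \<Longrightarrow> commutes x b \<Longrightarrow> commutes x (a * b)"
  by (simp add: commutes_def) (metis mult.assoc)

lemma commutes_sym: "commutes x y \<Longrightarrow> commutes y x"
  by (simp add: commutes_def)

lemma commutes_0: "commutes x 0"
  by (simp add: commutes_def)

lemma commutes_s_s: "i + 1 < j \<or> j + 1 < i \<Longrightarrow> commutes (s i) (s j)"
  unfolding commutes_def by (rule s_comm)

lemma commutes_s_c: "j \<noteq> i \<Longrightarrow> j \<noteq> i + 1 \<Longrightarrow> commutes (s i) (c j)"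
  by (simp add: commutes_def s_c_comm)

lemma commutes_c_cc: "j \<noteq> i \<Longrightarrow> j \<noteq> k \<Longrightarrow> commutes (c j) (c i * c k)"
proof -
  assume "j \<noteq> i" "j \<noteq> k"
  then have "c j * c i = - (c i * c j)" "c j * c k = - (c k * c j)" using c_anti by blast+
  then have "c j * c i * c k = c i * (c k * c j)" by (simp add: mult.assoc)
  then show ?thesis by (simp add: commutes_def mult.assoc)
qed

text \<open>\<open>murphy k\<close> is built from the \<open>s i\<close> and the even products
  \<open>c i * c (Suc i)\<close> with \<open>i < k\<close> alone.\<close>

lemma commutes_murphy:
  assumes "\<And>i. 1 \<le> i \<Longrightarrow> i < k \<Longrightarrow> commutes x (s i)" "\<And>i. 1 \<le> i \<Longrightarrow> i < k \<Longrightarrow> commutes x (c i * c (Suc i))"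
  shows "commutes x (murphy k)"
  using assms
proof (induction k rule: murphy.induct)
  case (3 i)
  have s: "commutes x (s (Suc i))" and cc: "commutes x (c (Suc i) * c (Suc (Suc i)))" by (auto intro: "3.prems")
  have "commutes x (murphy (Suc i))" by (intro "3.IH") (auto intro: "3.prems")
  then have "commutes x (s (Suc i) * murphy (Suc i) * s (Suc i))" by (intro commutes_mult s)
  then show ?case unfolding murphy.simps by (intro commutes_add s commutes_mult[OF cc s])
qed (auto intro: commutes_0)

lemma s_murphy_high: "k < j \<Longrightarrow> commutes (s j) (murphy k)"
  by (intro commutes_murphy commutes_s_s commutes_mult commutes_s_c) auto

text \<open>Unfolding twice down to \<open>murphy i\<close> gives a sum of five terms. Conjugation
  by \<open>s i\<close> fixes the one with \<open>murphy i\<close>, by the braid relation, and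
  interchanges the other four in pairs.\<close>

lemma s_murphy_adjacent:
  assumes "1 \<le> i"
  shows "commutes (s i) (murphy (Suc (Suc i)))"
proof -
  let ?a = "s i" and ?b = "s (Suc i)" and ?X = "murphy i"
  let ?c1 = "c i" and ?c2 = "c (Suc i)" and ?c3 = "c (Suc (Suc i))"
  have br: "?a * ?b * ?a = ?b * ?a * ?b" using braid[of i] by simp
  have bX: "?b * ?X = ?X * ?b" using s_murphy_high[of i "Suc i"] by (simp add: commutes_def)
  have ac3: "?a * ?c3 = ?c3 * ?a" and ac2: "?a * ?c2 = ?c1 * ?a" and ac1: "?a * ?c1 = ?c2 * ?a"
    and bc1: "?b * ?c1 = ?c1 * ?b" and bc2: "?b * ?c2 = ?c3 * ?b" and bc3: "?b * ?c3 = ?c2 * ?b"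
    using s_c[of i] s_c'[of i] s_c[of "Suc i"] s_c'[of "Suc i"] s_c_comm[of "Suc (Suc i)" i] s_c_comm[of i "Suc i"]
    by simp_all
  have eq: "murphy (Suc (Suc i)) = ?b * ?a * ?X * ?a * ?b + (?b * ?a * ?b + ?c1 * ?c3 * (?b * ?a * ?b)) + (?b + ?c2 * ?c3 * ?b)"
  proof -
    have "?b * (?c1 * ?c2 * ?a) * ?b = (?b * ?c1) * ?c2 * ?a * ?b" by (simp only: mult.assoc)
    also have "\<dots> = ?c1 * (?b * ?c2) * ?a * ?b" unfolding bc1 by (simp only: mult.assoc)
    also have "\<dots> = ?c1 * ?c3 * (?b * ?a * ?b)" unfolding bc2 by (simp only: mult.assoc)
    finally have "?b * (?c1 * ?c2 * ?a) * ?b = ?c1 * ?c3 * (?b * ?a * ?b)" .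
    moreover have "murphy (Suc (Suc i)) = ?b * (?a * ?X * ?a + ?a + ?c1 * ?c2 * ?a) * ?b + ?b + ?c2 * ?c3 * ?b"
      using assms by (simp add: murphy_Suc)
    ultimately show ?thesis by (simp add: distrib_left distrib_right mult.assoc add.assoc)
  qed
  have 1: "?a * (?b * ?a * ?X * ?a * ?b) = (?b * ?a * ?X * ?a * ?b) * ?a"
  proof -
    have "?a * (?b * ?a * ?X * ?a * ?b) = (?a * ?b * ?a) * ?X * ?a * ?b" by (simp only: mult.assoc)
    also have "\<dots> = ?b * ?a * (?b * ?X) * ?a * ?b" unfolding br by (simp only: mult.assoc)
    also have "\<dots> = ?b * ?a * ?X * (?b * ?a * ?b)" unfolding bX by (simp only: mult.assoc)
    also have "\<dots> = (?b * ?a * ?X * ?a * ?b) * ?a" unfolding br[symmetric] by (simp only: mult.assoc)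
    finally show ?thesis .
  qed
  have bab_a: "?a * (?b * ?a * ?b) = ?b * ?a"
    unfolding br[symmetric] by (simp only: mult.assoc s_s_left)
  have a_bab: "(?b * ?a * ?b) * ?a = ?a * ?b"
    unfolding br[symmetric] by (simp add: mult.assoc s_s)
  have 2: "?a * (?c1 * ?c3 * (?b * ?a * ?b)) = (?c2 * ?c3 * ?b) * ?a"
  proof -
    have "?a * (?c1 * ?c3 * (?b * ?a * ?b)) = (?a * ?c1) * ?c3 * (?b * ?a * ?b)" by (simp only: mult.assoc)
    also have "\<dots> = ?c2 * (?a * ?c3) * (?b * ?a * ?b)" unfolding ac1 by (simp only: mult.assoc)
    also have "\<dots> = ?c2 * ?c3 * (?a * (?b * ?a * ?b))" unfolding ac3 by (simp only: mult.assoc)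
    finally show ?thesis unfolding bab_a by (simp only: mult.assoc)
  qed
  have 3: "?a * (?c2 * ?c3 * ?b) = (?c1 * ?c3 * (?b * ?a * ?b)) * ?a"
  proof -
    have "?a * (?c2 * ?c3 * ?b) = (?a * ?c2) * ?c3 * ?b" by (simp only: mult.assoc)
    also have "\<dots> = ?c1 * (?a * ?c3) * ?b" unfolding ac2 by (simp only: mult.assoc)
    also have "\<dots> = ?c1 * ?c3 * (?a * ?b)" unfolding ac3 by (simp only: mult.assoc)
    finally show ?thesis unfolding a_bab[symmetric] by (simp only: mult.assoc)
  qed
  show ?thesis unfolding commutes_def eq distrib_left distrib_right 1 2 3 bab_a a_bab by (simp add: add_ac)
qed

lemma s_murphy_low:
  assumes "1 \<le> j" "Suc j < k"
  shows "commutes (s j) (murphy k)"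
  using assms
proof (induction k)
  case (Suc k)
  show ?case
  proof (cases "Suc j = k")
    case True
    then show ?thesis using s_murphy_adjacent[of j] Suc.prems by simp
  next
    case False
    have s: "commutes (s j) (s k)" and cc: "commutes (s j) (c k * c (Suc k))"
      using Suc.prems False by (intro commutes_s_s commutes_s_c commutes_mult; simp)+
    have "commutes (s j) (murphy k)" using Suc False by simp
    then have "commutes (s j) (s k * murphy k * s k)" by (intro commutes_mult s)
    moreover have "murphy (Suc k) = s k * murphy k * s k + s k + c k * c (Suc k) * s k"
      using Suc.prems by (intro murphy_Suc) auto
    ultimately show ?thesis by (auto intro: commutes_add s commutes_mult[OF cc s])
  qed
qed simp

lemma murphy_c: "j \<noteq> k \<Longrightarrow> commutes (murphy k) (c j)"
  and murphy_c_anti: "murphy k * c k = - (c k * murphy k)"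
proof (induction k arbitrary: j)
  case 0
  case 1
  show ?case by (simp add: commutes_def)
next
  case 0
  case 2
  show ?case by simp
next
  case (Suc k)
  consider "k = 0" | "1 \<le> k" by linarith
  note kcases = this
  let ?X = "murphy k" and ?s = "s k" and ?c = "c k" and ?d = "c (Suc k)"
  have cd: "?d * ?c = - (?c * ?d)" by (rule c_anti) simp
  have sc: "?s * ?c = ?d * ?s" "?s * ?d = ?c * ?s" using s_c[of k] s_c'[of k] by simp_all
  have dc: "?d * (?c * x) = - (?c * (?d * x))" for x using cd by (simp add: mult.assoc[symmetric])
  have sc': "?s * (?c * x) = ?d * (?s * x)" "?s * (?d * x) = ?c * (?s * x)" for x
    using sc by (simp_all add: mult.assoc[symmetric])
  {
    case 1
    from kcases show ?case
    proof cases
      assume "k = 0"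
      then show ?thesis by (simp add: commutes_def)
    next
      assume k: "1 \<le> k"
      show ?thesis
      proof (cases "j = k")
        case False
        have s: "commutes (c j) (s k)" using 1 False by (intro commutes_sym[OF commutes_s_c]) auto
        have cc: "commutes (c j) (c k * c (Suc k))" using 1 False by (intro commutes_c_cc) auto
        have "commutes (c j) (murphy k)" by (rule commutes_sym) (use Suc.IH(1)[of j] False in auto)
        then have sXs: "commutes (c j) (s k * murphy k * s k)" by (intro commutes_mult s)
        show ?thesis unfolding murphy_Suc[OF k]
          by (rule commutes_sym) (intro commutes_add sXs s commutes_mult[OF cc s])
      next
        \<comment> \<open>For \<open>j = k\<close> the terms \<open>s k\<close> and
          \<open>c k * c (Suc k) * s k\<close> do not commute with \<open>c k\<close> one by one:
          multiplying the one on the right gives what multiplying the other on the left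
          gives.\<close>
        case True
        have "commutes ?X ?d" using Suc.IH(1) by simp
        then have "?X * ?d = ?d * ?X" by (simp add: commutes_def)
        then have Xd: "?X * (?d * x) = ?d * (?X * x)" for x by (simp add: mult.assoc[symmetric])
        show ?thesis unfolding True commutes_def using k
          by (simp add: murphy_Suc distrib_left distrib_right mult.assoc sc sc' Xd c_c_left add_ac)
      qed
    qed
  next
    case 2
    from kcases show ?case
    proof cases
      assume "k = 0"
      then show ?thesis by simp
    next
      assume k: "1 \<le> k"
      have "?X * ?c = - (?c * ?X)" by (rule Suc.IH)
      then have Xc: "?X * (?c * x) = - (?c * (?X * x))" for x by (simp add: mult.assoc[symmetric])
      show ?thesis using k
        by (simp add: murphy_Suc distrib_left distrib_right mult.assoc sc sc' Xc dc c_c_left add_ac)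
    qed
  }
qed

lemma murphy_commute: "murphy j * murphy k = murphy k * murphy j"
proof -
  have *: "commutes (murphy k) (murphy j)" if "j < k" for j k
  proof (rule commutes_murphy)
    fix i assume "1 \<le> i" "i < j"
    with that show "commutes (murphy k) (s i)" by (intro commutes_sym[OF s_murphy_low]) auto
    from that \<open>i < j\<close> show "commutes (murphy k) (c i * c (Suc i))" by (intro commutes_mult murphy_c) auto
  qed
  show ?thesis using *[of j k] *[of k j] by (cases j k rule: linorder_cases) (auto simp: commutes_def)
qed

end

section \<open>Traces of Clifford words times permutations\<close>

lemma permutes_permutation: "w permutes {1..n} \<Longrightarrow> permutation w" for n :: nat
  unfolding permutation_permutes by blast

lemma orbit_eq:
  assumes "permutation w" "j \<in> orbit w i"
  shows "orbit w j = orbit w i"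
  using assms(2)
  by induction (simp_all add: permutation_orbit_step[OF assms(1)])

text \<open>For \<open>\<sigma>\<close> coming from a total order this is the sign of sorting the
  list. General sign functions are allowed, so that two orders can be compared pair by pair through
  the product of their signs.\<close>

primrec pair_sign :: "('a \<Rightarrow> 'a \<Rightarrow> int) \<Rightarrow> 'a list \<Rightarrow> int" where
  "pair_sign \<sigma> [] = 1"
| "pair_sign \<sigma> (x # xs) = prod_list (map (\<sigma> x) xs) * pair_sign \<sigma> xs"

lemma prod_list_map_mult:
  "prod_list (map (\<lambda>x. f x * g x) xs) = prod_list (map f xs) * (prod_list (map g xs) :: 'a::comm_monoid_mult)"
  by (induction xs) (simp_all add: ac_simps)

lemma pair_sign_snoc: "pair_sign \<sigma> (xs @ [y]) = pair_sign \<sigma> xs * prod_list (map (\<lambda>x. \<sigma> x y) xs)"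
  by (induction xs) (simp_all add: ac_simps)

lemma pair_sign_mult: "pair_sign (\<lambda>x y. \<sigma> x y * \<tau> x y) xs = pair_sign \<sigma> xs * pair_sign \<tau> xs"
  by (induction xs) (simp_all add: prod_list_map_mult ac_simps)

lemma pair_sign_map: "pair_sign \<sigma> (map g xs) = pair_sign (\<lambda>x y. \<sigma> (g x) (g y)) xs"
  by (induction xs) (simp_all add: comp_def)

text \<open>A value \<open>\<sigma> i j = 1\<close> means that \<open>i\<close> comes before \<open>j\<close> when a product of Clifford generators is
  sorted: larger cycles of \<open>w\<close> first, and each cycle against its cyclic order. The last condition
  says the latter without choosing a starting point.\<close>

definition orientation :: "(nat \<Rightarrow> nat) \<Rightarrow> (nat \<Rightarrow> nat \<Rightarrow> int) \<Rightarrow> bool" where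
  "orientation w \<sigma> \<longleftrightarrow>
     (\<forall>i j. \<sigma> i j = 1 \<or> \<sigma> i j = - 1) \<and> (\<forall>i. \<sigma> i i = 1) \<and> (\<forall>i j. i \<noteq> j \<longrightarrow> \<sigma> j i = - \<sigma> i j) \<and>
     (\<forall>i j. card (orbit w j) < card (orbit w i) \<longrightarrow> \<sigma> i j = 1) \<and>
     (\<forall>i. \<exists>t. \<forall>l\<in>orbit w i. \<sigma> i l * \<sigma> l (w i) = t)"

lemma orientationD:
  assumes "orientation w \<sigma>"
  shows "\<sigma> i j = 1 \<or> \<sigma> i j = - 1" "\<sigma> i i = 1" "i \<noteq> j \<Longrightarrow> \<sigma> j i = - \<sigma> i j"
    "card (orbit w j) < card (orbit w i) \<Longrightarrow> \<sigma> i j = 1" "\<exists>t. \<forall>l\<in>orbit w i. \<sigma> i l * \<sigma> l (w i) = t"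
  using assms unfolding orientation_def by (meson)+

lemma orientation_sq: "orientation w \<sigma> \<Longrightarrow> \<sigma> i j * \<sigma> i j = 1"
  using orientationD(1)[of w \<sigma> i j] by auto

text \<open>Each cycle is cut at its minimum and positions along it are counted from there; within a
  cycle, later positions come first.\<close>

lemma orientation_exists:
  assumes w: "permutation w"
  shows "\<exists>\<sigma>. orientation w \<sigma>"
proof -
  define b where "b i = Min (orbit w i)" for i
  define pos where "pos i = (LEAST k. (w ^^ k) (b i) = i)" for i
  have fin: "finite (orbit w i)" for i
    using finite_orbit[OF permutation_self_in_orbit[OF w]] .
  have self: "i \<in> orbit w i" for i using permutation_self_in_orbit[OF w] .
  have inj: "inj w" using w permutation_bijective bij_is_inj by blast
  have b: "b i \<in> orbit w i" for i unfolding b_def using fin self by (intro Min_in) auto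
  have b_eq: "b j = b i" if "j \<in> orbit w i" for i j unfolding b_def orbit_eq[OF w that] ..
  have ib: "i \<in> orbit w (b i)" for i using self[of i] orbit_eq[OF w b[of i]] by simp
  have "\<exists>k. (w ^^ k) (b i) = i" for i
  proof -
    from ib[of i] obtain k where "i = (w ^^ k) (b i)" unfolding orbit_altdef_permutation[OF w] by auto
    then show ?thesis by metis
  qed
  then have pos: "(w ^^ pos i) (b i) = i" for i unfolding pos_def by (rule LeastI_ex)
  have pos_le: "pos i \<le> k" if "(w ^^ k) (b i) = i" for i k unfolding pos_def using that by (rule Least_le)
  have pos_inj: "i = j" if "orbit w i = orbit w j" "pos i = pos j" for i j
    using pos[of i] pos[of j] that by (simp add: b_def)
  define \<sigma> :: "nat \<Rightarrow> nat \<Rightarrow> int" where "\<sigma> i j = (if orbit w i = orbit w j then (if pos j \<le> pos i then 1 else - 1)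
      else if card (orbit w j) < card (orbit w i) then 1 else if card (orbit w i) < card (orbit w j) then - 1
      else if i \<le> j then 1 else - 1)" for i j
  have "\<sigma> j i = - \<sigma> i j" if "i \<noteq> j" for i j
  proof (cases "orbit w i = orbit w j")
    case True
    then have "pos i \<noteq> pos j" using that pos_inj by blast
    then show ?thesis using True by (simp add: \<sigma>_def)
  next
    case False
    then show ?thesis using that by (simp add: \<sigma>_def)
  qed
  moreover have "\<exists>t. \<forall>l\<in>orbit w i. \<sigma> i l * \<sigma> l (w i) = t" for i
  proof (cases "w i = b i")
    \<comment> \<open>Across the cut: \<open>i\<close> has the last position and \<open>w i\<close>
      the first, so both factors are 1 for every \<open>l\<close> in the cycle.\<close>
    case True
    have bw: "b (w i) = b i" using b_eq[of "w i" i] orbit.base by fast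
    have "pos (w i) \<le> 0" using True bw by (intro pos_le) simp
    moreover have "(w ^^ Suc (pos i)) (b i) = b i" using pos[of i] True by simp
    then have "orbit w (b i) = {(w ^^ m) (b i) | m. m < Suc (pos i)}" by (intro orbit_altdef_bounded) auto
    then have orb: "orbit w i = {(w ^^ m) (b i) | m. m < Suc (pos i)}" using orbit_eq[OF w b[of i]] by simp
    have "pos l \<le> pos i" if "l \<in> orbit w i" for l
    proof -
      have "l \<in> {(w ^^ m) (b i) | m. m < Suc (pos i)}" using that by (simp only: orb)
      then obtain m where "m < Suc (pos i)" "l = (w ^^ m) (b i)" by blast
      then show ?thesis using pos_le[of m l] b_eq[OF that] by simp
    qed
    ultimately have "\<forall>l\<in>orbit w i. \<sigma> i l * \<sigma> l (w i) = 1"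
      unfolding \<sigma>_def using orbit_eq[OF w] permutation_orbit_step[OF w, of i] by auto
    then show ?thesis by blast
  next
    \<comment> \<open>Away from the cut the positions of \<open>i\<close> and \<open>w i\<close> are
      consecutive. No \<open>l\<close> lies strictly between them, so exactly one of the two factors
      is \<open>- 1\<close>.\<close>
    case False
    have bw: "b (w i) = b i" using b_eq[of "w i" i] orbit.base by fast
    have "(w ^^ Suc (pos i)) (b (w i)) = w i" using pos[of i] bw by simp
    then have 1: "pos (w i) \<le> Suc (pos i)" by (rule pos_le)
    have "pos (w i) \<noteq> 0" using False pos[of "w i"] bw by (metis funpow_0)
    then obtain k where k: "pos (w i) = Suc k" using not0_implies_Suc by blast
    then have "w ((w ^^ k) (b i)) = w i" using pos[of "w i"] bw by simp
    then have "pos i \<le> k" using inj by (intro pos_le) (auto dest: injD)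
    with 1 k have "pos (w i) = Suc (pos i)" by simp
    then have "\<forall>l\<in>orbit w i. \<sigma> i l * \<sigma> l (w i) = - 1"
      unfolding \<sigma>_def using orbit_eq[OF w] permutation_orbit_step[OF w, of i] by auto
    then show ?thesis by blast
  qed
  moreover have "\<sigma> i j = 1 \<or> \<sigma> i j = - 1" "\<sigma> i i = 1" for i j by (simp_all add: \<sigma>_def)
  moreover have "\<sigma> i j = 1" if "card (orbit w j) < card (orbit w i)" for i j
  proof -
    have "orbit w i \<noteq> orbit w j" using that by auto
    then show ?thesis using that by (simp add: \<sigma>_def)
  qed
  ultimately have "orientation w \<sigma>"
    unfolding orientation_def by blast
  then show ?thesis by blast
qed

definition odd_content :: "nat \<Rightarrow> (nat \<Rightarrow> nat) \<Rightarrow> nat list \<Rightarrow> bool" where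
  "odd_content n w L \<longleftrightarrow> (\<forall>i\<in>{1..n}. odd (length (filter (\<lambda>l. l \<in> orbit w i) L)))"

definition distinct_cycles :: "nat \<Rightarrow> (nat \<Rightarrow> nat) \<Rightarrow> bool" where
  "distinct_cycles n w \<longleftrightarrow>
     (\<forall>i\<in>{1..n}. \<forall>j\<in>{1..n}. card (orbit w i) = card (orbit w j) \<longrightarrow> orbit w i = orbit w j)"

text \<open>Each \<open>u y\<close> occurs once for every other entry of its class in
  \<open>L\<close>, that is, as often as the size of the class minus one. Since \<open>u y\<close>
  squares to 1, a successor in the exponent replaces the subtraction.\<close>

lemma pair_sign_coboundary:
  fixes u :: "'a \<Rightarrow> int"
  assumes "\<And>x y. x \<in> set L \<Longrightarrow> y \<in> set L \<Longrightarrow> \<rho> x y = (if E x y then u x * u y else 1)"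
    and "\<And>x. E x x" "\<And>x y. E x y \<Longrightarrow> E y x" "\<And>x. u x * u x = 1"
  shows "pair_sign \<rho> L = prod_list (map (\<lambda>y. u y ^ Suc (length (filter (E y) L))) L)"
  using assms(1)
proof (induction L)
  case (Cons x L)
  note outer = Cons.prems
  have row: "prod_list (map (\<rho> x) K) = u x ^ length (filter (E x) K) * prod_list (map (\<lambda>y. if E y x then u y else 1) K)"
    if "set K \<subseteq> set L" for K
    using that
  proof (induction K)
    case (Cons y K)
    moreover have "\<rho> x y = (if E x y then u x * u y else 1)" using Cons.prems by (intro outer) auto
    ultimately show ?case using assms(3) by (auto simp: ac_simps)
  qed simp
  have IH: "pair_sign \<rho> L = prod_list (map (\<lambda>y. u y ^ Suc (length (filter (E y) L))) L)"
    using Cons.prems by (intro Cons.IH) auto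
  define P where "P = prod_list (map (\<lambda>y. if E y x then u y else 1) L)"
  define Q where "Q = prod_list (map (\<lambda>y. u y ^ Suc (length (filter (E y) L))) L)"
  have A: "prod_list (map (\<lambda>y. u y ^ Suc (length (filter (E y) (x # L)))) L)
    = prod_list (map (\<lambda>y. (if E y x then u y else 1) * u y ^ Suc (length (filter (E y) L))) L)"
    by (intro arg_cong[of _ _ prod_list] map_cong) auto
  have B: "u x ^ Suc (length (filter (E x) (x # L))) = u x ^ length (filter (E x) L)"
    using assms(2,4) by (simp add: mult.assoc[symmetric])
  have row_L: "prod_list (map (\<rho> x) L) = u x ^ length (filter (E x) L) * P" using row[of L] by (simp add: P_def)
  show ?case
    unfolding list.map prod_list.Cons B A prod_list_map_mult pair_sign.simps row_L IH
    unfolding P_def[symmetric] Q_def[symmetric] by (simp only: mult.assoc)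
qed simp

text \<open>The two orientations differ by the symmetric sign \<open>\<rho>\<close>. Distinct cycle
  lengths force it to be 1 across cycles, and within a cycle it is a coboundary
  \<open>u l * u m\<close>. Odd content makes every exponent of \<open>u\<close> even. Hence the
  choice of an orientation in the trace is immaterial.\<close>

lemma pair_sign_unique:
  assumes w: "permutation w" and \<sigma>: "orientation w \<sigma>" and \<tau>: "orientation w \<tau>"
    and dist: "distinct_cycles n w" and L: "set L \<subseteq> {1..n}" and odd: "odd_content n w L"
  shows "pair_sign \<sigma> L = pair_sign \<tau> L"
proof -
  define \<rho> where "\<rho> i j = \<sigma> i j * \<tau> i j" for i j
  have sq: "\<rho> i j * \<rho> i j = 1" for i j
    using orientationD(1)[OF \<sigma>, of i j] orientationD(1)[OF \<tau>, of i j] unfolding \<rho>_def by auto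
  have sym: "\<rho> i j = \<rho> j i" for i j
    using orientationD(3)[OF \<sigma>, of i j] orientationD(3)[OF \<tau>, of i j] unfolding \<rho>_def by (cases "i = j") auto
  have diag: "\<rho> i i = 1" for i using orientationD(2)[OF \<sigma>] orientationD(2)[OF \<tau>] by (simp add: \<rho>_def)
  have cross: "\<rho> i j = 1" if "i \<in> {1..n}" "j \<in> {1..n}" "orbit w i \<noteq> orbit w j" for i j
  proof -
    have "card (orbit w j) \<noteq> card (orbit w i)"
      using that dist unfolding distinct_cycles_def by fastforce
    then consider "card (orbit w j) < card (orbit w i)" | "card (orbit w i) < card (orbit w j)" by linarith
    then show ?thesis
    proof cases
      case 1
      then show ?thesis using orientationD(4)[OF \<sigma> 1] orientationD(4)[OF \<tau> 1] by (simp add: \<rho>_def)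
    next
      case 2
      then have "\<rho> j i = 1" using orientationD(4)[OF \<sigma> 2] orientationD(4)[OF \<tau> 2] by (simp add: \<rho>_def)
      then show ?thesis using sym by simp
    qed
  qed
  \<comment> \<open>The constants that the two orientations assign to \<open>i\<close> are the same
    for \<open>l\<close> and \<open>l'\<close>, and the square of their product is 1, so they drop
    out.\<close>
  have step: "\<rho> l (w i) * \<rho> l' (w i) = \<rho> l i * \<rho> l' i" if "l \<in> orbit w i" "l' \<in> orbit w i" for l l' i
  proof -
    obtain t t' where t: "\<forall>l\<in>orbit w i. \<sigma> i l * \<sigma> l (w i) = t" "\<forall>l\<in>orbit w i. \<tau> i l * \<tau> l (w i) = t'"
      using orientationD(5)[OF \<sigma>, of i] orientationD(5)[OF \<tau>, of i] by blast
    have "\<rho> i m * \<rho> m (w i) = t * t'" if "m \<in> orbit w i" for m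
    proof -
      have "\<rho> i m * \<rho> m (w i) = (\<sigma> i m * \<sigma> m (w i)) * (\<tau> i m * \<tau> m (w i))" by (simp add: \<rho>_def ac_simps)
      then show ?thesis using t that by simp
    qed
    then have eq: "\<rho> m (w i) = t * t' * \<rho> m i" if "m \<in> orbit w i" for m
      using that sq[of i m] sym[of i m] by (metis mult.left_commute mult.right_neutral mult.commute)
    have "(t * t') * (t * t') = 1"
      using eq[of i] permutation_self_in_orbit[OF w, of i] diag[of i] sq[of i "w i"] by auto
    moreover have "\<rho> l (w i) * \<rho> l' (w i) = (t * t') * (t * t') * (\<rho> l i * \<rho> l' i)"
      unfolding eq[OF that(1)] eq[OF that(2)] by (simp only: ac_simps)
    ultimately show ?thesis by simp
  qed
  \<comment> \<open>By \<open>step\<close> the product does not change while \<open>m\<close> runs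
    along the orbit; its value is read off at \<open>m = l'\<close>.\<close>
  have const: "\<rho> l m * \<rho> l' m = \<rho> l l'" if "m \<in> orbit w l'" "l \<in> orbit w l'" for l l' m
    using that(1)
  proof induction
    case base
    then show ?case using step[of l l' l'] that(2) permutation_self_in_orbit[OF w] diag by simp
  next
    case (step y)
    then show ?case
      using \<open>\<And>l l' i. l \<in> orbit w i \<Longrightarrow> l' \<in> orbit w i \<Longrightarrow> \<rho> l (w i) * \<rho> l' (w i) = \<rho> l i * \<rho> l' i\<close>[of l y l']
        that(2) orbit_eq[OF w step(1)] permutation_self_in_orbit[OF w, of l'] by simp
  qed
  define u where "u i = \<rho> (Min (orbit w i)) i" for i
  have "\<rho> l m = u l * u m" if "orbit w l = orbit w m" for l m
  proof -
    define b where "b = Min (orbit w l)"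
    have "b \<in> orbit w l" unfolding b_def
      using finite_orbit[OF permutation_self_in_orbit[OF w]] permutation_self_in_orbit[OF w] by (intro Min_in) auto
    then have ob: "orbit w b = orbit w l" by (rule orbit_eq[OF w])
    have "\<rho> l m * \<rho> b m = \<rho> l b"
      using permutation_self_in_orbit[OF w] ob that by (intro const) auto
    then have "\<rho> l m = \<rho> l b * \<rho> b m" using sq[of b m] by (metis mult.assoc mult.right_neutral)
    then show ?thesis unfolding u_def b_def[symmetric] using that by (simp add: b_def sym)
  qed
  then have "\<rho> x y = (if orbit w x = orbit w y then u x * u y else 1)" if "x \<in> set L" "y \<in> set L" for x y
  proof -
    have "x \<in> {1..n}" "y \<in> {1..n}" using that L by blast+
    with cross[of x y] \<open>\<And>l m. orbit w l = orbit w m \<Longrightarrow> \<rho> l m = u l * u m\<close>[of x y] show ?thesis by simp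
  qed
  then have "pair_sign \<rho> L = prod_list (map (\<lambda>y. u y ^ Suc (length (filter (\<lambda>x. orbit w y = orbit w x) L))) L)"
    by (intro pair_sign_coboundary) (auto simp: u_def sq)
  also have "\<dots> = prod_list (map (\<lambda>y. 1) L)"
  proof (intro arg_cong[of _ _ prod_list] map_cong refl)
    fix y assume y: "y \<in> set L"
    have "(\<lambda>x. orbit w y = orbit w x) = (\<lambda>x. x \<in> orbit w y)"
      using orbit_eq[OF w] permutation_self_in_orbit[OF w] by blast
    then have "odd (length (filter (\<lambda>x. orbit w y = orbit w x) L))"
      using odd y L unfolding odd_content_def by auto
    then obtain k where "Suc (length (filter (\<lambda>x. orbit w y = orbit w x) L)) = 2 * k" by (metis evenE even_Suc)
    moreover have "u y ^ 2 = 1" using sq by (simp add: u_def power2_eq_square)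
    ultimately show "u y ^ Suc (length (filter (\<lambda>x. orbit w y = orbit w x) L)) = 1"
      by (simp only: power_mult power_one)
  qed
  also have "\<dots> = 1" by (induction L) auto
  finally have "pair_sign \<rho> L = 1" .
  moreover have "\<rho> = (\<lambda>x y. \<sigma> x y * \<tau> x y)" by (simp add: \<rho>_def fun_eq_iff)
  ultimately have "pair_sign \<sigma> L * pair_sign \<tau> L = 1" by (simp add: pair_sign_mult)
  then have "pair_sign \<sigma> L = 1 \<and> pair_sign \<tau> L = 1 \<or> pair_sign \<sigma> L = - 1 \<and> pair_sign \<tau> L = - 1"
    by (simp only: zmult_eq_1_iff)
  then show ?thesis by linarith
qed

text \<open>The value on \<open>(L, w)\<close> of the trace attached to a set of cycle lengths \<open>\<Lambda>\<close>, where \<open>(L, w)\<close> stands for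
  the product of the Clifford generators listed in \<open>L\<close> followed by the permutation \<open>w\<close>.\<close>

definition cycle_trace :: "nat \<Rightarrow> nat set \<Rightarrow> nat list \<times> (nat \<Rightarrow> nat) \<Rightarrow> int" where
  "cycle_trace n \<Lambda> = (\<lambda>(L, w).
     if w permutes {1..n} \<and> distinct_cycles n w \<and> (\<lambda>i. card (orbit w i)) ` {1..n} = \<Lambda> \<and> odd_content n w L
     then pair_sign (SOME \<sigma>. orientation w \<sigma>) L else 0)"

lemma pair_sign_square:
  assumes "\<And>i j. \<sigma> i j * \<sigma> i j = 1" "\<And>i. \<sigma> i i = 1"
  shows "pair_sign \<sigma> (us @ i # i # vs) = pair_sign \<sigma> (us @ vs)"
proof (induction us)
  case Nil
  have "prod_list (map (\<sigma> i) vs) * prod_list (map (\<sigma> i) vs) = 1"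
    unfolding prod_list_map_mult[symmetric] assms(1) by (induction vs) auto
  then show ?case using assms(2) by (simp add: mult.assoc[symmetric])
next
  case (Cons x us)
  then show ?case using assms(1)[of x i] by (simp add: ac_simps)
qed

lemma pair_sign_swap:
  assumes "\<sigma> j i = - \<sigma> i j"
  shows "pair_sign \<sigma> (us @ j # i # vs) = - pair_sign \<sigma> (us @ i # j # vs)"
  by (induction us) (simp_all add: assms ac_simps)

lemma some_orientation: "w permutes {1..n} \<Longrightarrow> orientation w (SOME \<sigma>. orientation w \<sigma>)" for n :: nat
  by (rule someI_ex[OF orientation_exists[OF permutes_permutation]])

lemma cycle_trace_square: "cycle_trace n \<Lambda> (us @ i # i # vs, w) = cycle_trace n \<Lambda> (us @ vs, w)"
proof -
  have "odd_content n w (us @ i # i # vs) = odd_content n w (us @ vs)" by (auto simp: odd_content_def)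
  moreover have "pair_sign (SOME \<sigma>. orientation w \<sigma>) (us @ i # i # vs) = pair_sign (SOME \<sigma>. orientation w \<sigma>) (us @ vs)"
    if "w permutes {1..n}"
    using orientation_sq[OF some_orientation[OF that]] orientationD(2)[OF some_orientation[OF that]]
    by (rule pair_sign_square)
  ultimately show ?thesis unfolding cycle_trace_def by auto
qed

lemma cycle_trace_swap:
  "i \<noteq> j \<Longrightarrow> cycle_trace n \<Lambda> (us @ j # i # vs, w) = - cycle_trace n \<Lambda> (us @ i # j # vs, w)"
proof -
  assume ij: "i \<noteq> j"
  have "odd_content n w (us @ j # i # vs) = odd_content n w (us @ i # j # vs)" by (auto simp: odd_content_def)
  moreover have "pair_sign (SOME \<sigma>. orientation w \<sigma>) (us @ j # i # vs) = - pair_sign (SOME \<sigma>. orientation w \<sigma>) (us @ i # j # vs)"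
    if "w permutes {1..n}"
    using orientationD(3)[OF some_orientation[OF that] ij] by (rule pair_sign_swap)
  ultimately show ?thesis unfolding cycle_trace_def by auto
qed

lemma cycle_trace_eq:
  assumes "w permutes {1..n}" "orientation w \<sigma>" "distinct_cycles n w" "(\<lambda>i. card (orbit w i)) ` {1..n} = \<Lambda>"
    "odd_content n w L" "set L \<subseteq> {1..n}"
  shows "cycle_trace n \<Lambda> (L, w) = pair_sign \<sigma> L"
proof -
  have "permutation w" using assms(1) by (rule permutes_permutation)
  then have "pair_sign (SOME \<sigma>. orientation w \<sigma>) L = pair_sign \<sigma> L"
    using assms some_orientation[OF assms(1)] by (intro pair_sign_unique)
  then show ?thesis using assms by (simp add: cycle_trace_def)
qed

text \<open>There are as many cycles as distinct lengths, and each takes an odd number of entries of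
  \<open>L\<close>. Modulo 2 the length of \<open>L\<close> is thus the number of cycles.\<close>

lemma even_length_odd_content:
  assumes w: "w permutes {1..n}" and "distinct_cycles n w" "odd_content n w L" "set L \<subseteq> {1..n}"
  shows "even (length L) \<longleftrightarrow> even (card ((\<lambda>i. card (orbit w i)) ` {1..n}))"
proof -
  have p: "permutation w" using w by (rule permutes_permutation)
  define Orb where "Orb = orbit w ` {1..n}"
  have len: "(\<Sum>C\<in>Orb. length (filter (\<lambda>l. l \<in> C) K)) = length K" if "set K \<subseteq> {1..n}" for K
    using that
  proof (induction K)
    case (Cons x K)
    have "(\<Sum>C\<in>Orb. length (filter (\<lambda>l. l \<in> C) (x # K)))
      = (\<Sum>C\<in>Orb. (if C = orbit w x then 1 else 0) + length (filter (\<lambda>l. l \<in> C) K))"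
    proof (rule sum.cong)
      fix C assume "C \<in> Orb"
      then obtain i where C: "C = orbit w i" by (auto simp: Orb_def)
      have "x \<in> C \<longleftrightarrow> C = orbit w x"
        unfolding C using orbit_eq[OF p, of x i] permutation_self_in_orbit[OF p, of x] by auto
      then show "length (filter (\<lambda>l. l \<in> C) (x # K)) = (if C = orbit w x then 1 else 0) + length (filter (\<lambda>l. l \<in> C) K)"
        by simp
    qed simp
    moreover have "finite Orb" "orbit w x \<in> Orb" using Cons.prems by (auto simp: Orb_def)
    ultimately show ?case using Cons by (simp add: sum.distrib)
  qed simp
  have "even (length L) \<longleftrightarrow> even (\<Sum>C\<in>Orb. length (filter (\<lambda>l. l \<in> C) L))" using len assms by simp
  also have "\<dots> \<longleftrightarrow> even (card {C\<in>Orb. odd (length (filter (\<lambda>l. l \<in> C) L))})"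
    by (subst even_sum_iff) (auto simp: Orb_def)
  also have "{C\<in>Orb. odd (length (filter (\<lambda>l. l \<in> C) L))} = Orb"
    using assms by (auto simp: Orb_def odd_content_def)
  also have "card Orb = card (card ` Orb)"
    using assms(2) by (intro card_image[symmetric]) (auto simp: Orb_def distinct_cycles_def inj_on_def)
  finally show ?thesis by (simp add: Orb_def image_image)
qed

section \<open>Invariance of the traces under rotation and conjugation\<close>

lemma cycle_trace_odd:
  assumes "even (card \<Lambda>)" "odd (length L)" "set L \<subseteq> {1..n}"
  shows "cycle_trace n \<Lambda> (L, w) = 0"
proof (rule ccontr)
  assume "cycle_trace n \<Lambda> (L, w) \<noteq> 0"
  then have c: "w permutes {1..n}" "distinct_cycles n w" "odd_content n w L" "(\<lambda>i. card (orbit w i)) ` {1..n} = \<Lambda>"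
    unfolding cycle_trace_def by (simp_all split: if_splits)
  from even_length_odd_content[OF c(1-3) assms(3)] show False unfolding c(4) using assms by blast
qed

text \<open>Behind \<open>w\<close>, the generator \<open>c i\<close> acts as \<open>c (w i)\<close>
  at the end of the list. In the change of sign an entry of \<open>L\<close> outside the cycle of
  \<open>i\<close> contributes \<open>- 1\<close> and one inside contributes the constant
  \<open>t\<close>. Odd content leaves an even number of entries of \<open>L\<close> inside, hence
  an odd number outside.\<close>

lemma cycle_trace_rotate:
  assumes i: "i \<in> {1..n}" and L: "set L \<subseteq> {1..n}" and odd: "odd (length L)"
  shows "cycle_trace n \<Lambda> (i # L, w) = - cycle_trace n \<Lambda> (L @ [w i], w)"
proof (cases "w permutes {1..n} \<and> distinct_cycles n w \<and> (\<lambda>i. card (orbit w i)) ` {1..n} = \<Lambda> \<and> odd_content n w (i # L)")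
  case True
  define \<sigma> where "\<sigma> = (SOME \<sigma>. orientation w \<sigma>)"
  have p: "permutation w" using True permutes_permutation by blast
  have \<sigma>: "orientation w \<sigma>" unfolding \<sigma>_def using True some_orientation by blast
  have mem: "w i \<in> orbit w j \<longleftrightarrow> i \<in> orbit w j" for j
    using orbit_eq[OF p, of i j] orbit_eq[OF p, of "w i" j] permutation_orbit_step[OF p, of i]
      permutation_self_in_orbit[OF p] by metis
  have oc: "odd_content n w (L @ [w i])" using True mem by (auto simp: odd_content_def)
  obtain t where t: "\<forall>l\<in>orbit w i. \<sigma> i l * \<sigma> l (w i) = t" using orientationD(5)[OF \<sigma>] by blast
  \<comment> \<open>Across cycles the comparison depends on the cycle lengths only, and these agree
    for \<open>i\<close> and \<open>w i\<close>.\<close>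
  have other: "\<sigma> i l * \<sigma> l (w i) = - 1" if l: "l \<in> {1..n}" "l \<notin> orbit w i" for l
  proof -
    have "orbit w l \<noteq> orbit w i" using l permutation_self_in_orbit[OF p, of l] by auto
    then have "card (orbit w l) \<noteq> card (orbit w i)"
      using True i l unfolding distinct_cycles_def by fastforce
    then consider "card (orbit w l) < card (orbit w i)" | "card (orbit w i) < card (orbit w l)" by linarith
    then have "\<sigma> l (w i) = \<sigma> l i"
    proof cases
      case 1
      then have "l \<noteq> i" "l \<noteq> w i" using permutation_orbit_step[OF p, of i] by auto
      then show ?thesis
        using orientationD(4)[OF \<sigma> 1] orientationD(4)[OF \<sigma>, of l "w i"] 1 permutation_orbit_step[OF p, of i]
          orientationD(3)[OF \<sigma>, of i l] orientationD(3)[OF \<sigma>, of "w i" l] by auto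
    next
      case 2
      then show ?thesis
        using orientationD(4)[OF \<sigma> 2] orientationD(4)[OF \<sigma>, of "w i" l] permutation_orbit_step[OF p, of i] by simp
    qed
    moreover have "\<sigma> l i = - \<sigma> i l" using l permutation_self_in_orbit[OF p, of i] by (intro orientationD(3)[OF \<sigma>]) auto
    ultimately show ?thesis using orientation_sq[OF \<sigma>, of i l] by simp
  qed
  have "prod_list (map (\<lambda>l. \<sigma> i l * \<sigma> l (w i)) K)
    = t ^ length (filter (\<lambda>l. l \<in> orbit w i) K) * (- 1) ^ length (filter (\<lambda>l. l \<notin> orbit w i) K)"
    if "set K \<subseteq> {1..n}" for K
    using that by (induction K) (auto simp: t other)
  then have "prod_list (map (\<lambda>l. \<sigma> i l * \<sigma> l (w i)) L)
    = t ^ length (filter (\<lambda>l. l \<in> orbit w i) L) * (- 1) ^ length (filter (\<lambda>l. l \<notin> orbit w i) L)"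
    using L by blast
  moreover have even: "even (length (filter (\<lambda>l. l \<in> orbit w i) L))"
  proof -
    have "odd (length (filter (\<lambda>l. l \<in> orbit w i) (i # L)))" using True i unfolding odd_content_def by blast
    then show ?thesis using permutation_self_in_orbit[OF p, of i] by simp
  qed
  moreover have "odd (length (filter (\<lambda>l. l \<notin> orbit w i) L))"
    using odd even sum_length_filter_compl[of "\<lambda>l. l \<in> orbit w i" L] by (metis even_add)
  moreover have "t = 1 \<or> t = - 1"
    using t permutation_self_in_orbit[OF p, of i] orientationD(1)[OF \<sigma>, of i "w i"] orientationD(2)[OF \<sigma>, of i] by auto
  then have "t ^ k = 1" if "even k" for k :: nat using that by auto
  ultimately have "prod_list (map (\<sigma> i) L) * prod_list (map (\<lambda>l. \<sigma> l (w i)) L) = - 1"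
    by (simp add: prod_list_map_mult)
  then have "prod_list (map (\<sigma> i) L) = - prod_list (map (\<lambda>l. \<sigma> l (w i)) L)"
    by (auto simp: zmult_eq_neg1_iff)
  then show ?thesis using True oc by (simp add: cycle_trace_def \<sigma>_def[symmetric] pair_sign_snoc)
next
  \<comment> \<open>The support conditions only see which cycle an entry belongs to, and
    \<open>i\<close> and \<open>w i\<close> share one, so both traces vanish together.\<close>
  case False
  have "\<not> (w permutes {1..n} \<and> distinct_cycles n w \<and> (\<lambda>i. card (orbit w i)) ` {1..n} = \<Lambda> \<and> odd_content n w (L @ [w i]))"
  proof
    assume a: "w permutes {1..n} \<and> distinct_cycles n w \<and> (\<lambda>i. card (orbit w i)) ` {1..n} = \<Lambda> \<and> odd_content n w (L @ [w i])"
    then have p: "permutation w" using permutes_permutation by blast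
    have mem: "w i \<in> orbit w j \<longleftrightarrow> i \<in> orbit w j" for j
      using orbit_eq[OF p, of i j] orbit_eq[OF p, of "w i" j] permutation_orbit_step[OF p, of i]
        permutation_self_in_orbit[OF p] by metis
    have len: "length (filter (\<lambda>l. l \<in> orbit w j) (L @ [w i])) = length (filter (\<lambda>l. l \<in> orbit w j) (i # L))" for j
      using mem[of j] by (cases "i \<in> orbit w j") auto
    have "odd_content n w (i # L) = odd_content n w (L @ [w i])" unfolding odd_content_def len ..
    with a False show False by blast
  qed
  then show ?thesis using False by (auto simp: cycle_trace_def)
qed

lemma orbit_conj:
  assumes "\<And>x. s (s x) = x"
  shows "orbit (s \<circ> w \<circ> s) (s i) = s ` orbit w i"
proof (intro equalityI subsetI)
  fix x assume "x \<in> orbit (s \<circ> w \<circ> s) (s i)"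
  then show "x \<in> s ` orbit w i"
    by induction (auto simp: assms intro: orbit.intros)
next
  have "s y \<in> orbit (s \<circ> w \<circ> s) (s i)" if "y \<in> orbit w i" for y
    using that
  proof induction
    case base
    then show ?case using orbit.base[of "s \<circ> w \<circ> s" "s i"] by (simp add: assms comp_def)
  next
    case (step y)
    then show ?case using orbit.step[OF step.IH] by (simp add: assms comp_def)
  qed
  then show "x \<in> orbit (s \<circ> w \<circ> s) (s i)" if "x \<in> s ` orbit w i" for x using that by auto
qed

text \<open>An orientation transported along \<open>s\<close> is an orientation of the conjugate
  with the same pair signs. By uniqueness of the sign it may replace the one chosen in the
  definition.\<close>

lemma cycle_trace_conj:
  assumes s: "s permutes {1..n}" "\<And>x. s (s x) = x" and L: "set L \<subseteq> {1..n}"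
  shows "cycle_trace n \<Lambda> (map s L, s \<circ> w \<circ> s) = cycle_trace n \<Lambda> (L, w)"
proof -
  have *: "cycle_trace n \<Lambda> (map s L, s \<circ> w \<circ> s) = cycle_trace n \<Lambda> (L, w)"
    if c: "w permutes {1..n} \<and> distinct_cycles n w \<and> (\<lambda>i. card (orbit w i)) ` {1..n} = \<Lambda> \<and> odd_content n w L"
      and L: "set L \<subseteq> {1..n}" for L w
  proof -
    let ?v = "s \<circ> w \<circ> s"
    have orb: "orbit ?v i = s ` orbit w (s i)" for i using orbit_conj[of s w "s i"] s(2) by simp
    have injs: "inj s" by (metis s(2) injI)
    have card: "card (orbit ?v i) = card (orbit w (s i))" for i
      unfolding orb using injs by (intro card_image) (auto intro: inj_on_subset)
    have sn: "s i \<in> {1..n} \<longleftrightarrow> i \<in> {1..n}" for i using permutes_in_image[OF s(1)] .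
    have simg: "s ` {1..n} = {1..n}" using permutes_image[OF s(1)] .
    define \<sigma> where "\<sigma> = (SOME \<sigma>. orientation w \<sigma>)"
    have \<sigma>: "orientation w \<sigma>" unfolding \<sigma>_def using c some_orientation by blast
    define \<tau> where "\<tau> i j = \<sigma> (s i) (s j)" for i j
    have neq: "i \<noteq> j \<Longrightarrow> s i \<noteq> s j" for i j using injs by (auto dest: injD)
    have "orientation ?v \<tau>"
      unfolding orientation_def \<tau>_def card
    proof (intro conjI allI impI)
      fix i
      obtain t where t: "\<forall>l\<in>orbit w (s i). \<sigma> (s i) l * \<sigma> l (w (s i)) = t" using orientationD(5)[OF \<sigma>] by blast
      then show "\<exists>t. \<forall>l\<in>orbit ?v i. \<sigma> (s i) (s l) * \<sigma> (s l) (s (?v i)) = t"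
        unfolding orb by (intro exI[of _ t]) (auto simp: s(2))
    qed (use orientationD[OF \<sigma>] neq in blast)+
    moreover have "?v permutes {1..n}" using c s(1) by (intro permutes_compose) auto
    moreover have "distinct_cycles n ?v"
      unfolding distinct_cycles_def card unfolding orb
    proof (intro ballI impI)
      fix i j assume "i \<in> {1..n}" "j \<in> {1..n}" "card (orbit w (s i)) = card (orbit w (s j))"
      then have "orbit w (s i) = orbit w (s j)" using c sn unfolding distinct_cycles_def by blast
      then show "s ` orbit w (s i) = s ` orbit w (s j)" by simp
    qed
    moreover have "(\<lambda>i. card (orbit ?v i)) ` {1..n} = \<Lambda>"
    proof -
      have "(\<lambda>i. card (orbit ?v i)) ` {1..n} = (\<lambda>i. card (orbit w i)) ` (s ` {1..n})"
        unfolding card image_image ..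
      then show ?thesis using c simg by simp
    qed
    moreover have "odd_content n ?v (map s L)"
      unfolding odd_content_def
    proof
      fix i assume i: "i \<in> {1..n}"
      have "(\<lambda>l. l \<in> orbit ?v i) \<circ> s = (\<lambda>l. l \<in> orbit w (s i))"
        unfolding orb by (auto simp: inj_image_mem_iff[OF injs] fun_eq_iff)
      then have "filter (\<lambda>l. l \<in> orbit ?v i) (map s L) = map s (filter (\<lambda>l. l \<in> orbit w (s i)) L)"
        unfolding filter_map by (rule arg_cong)
      then show "odd (length (filter (\<lambda>l. l \<in> orbit ?v i) (map s L)))"
        using c i sn[of i] by (simp add: odd_content_def)
    qed
    moreover have "set (map s L) \<subseteq> {1..n}" using L sn by auto
    ultimately have "cycle_trace n \<Lambda> (map s L, ?v) = pair_sign \<tau> (map s L)" by (intro cycle_trace_eq) auto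
    also have "\<dots> = pair_sign \<sigma> L" unfolding pair_sign_map \<tau>_def by (simp add: s(2))
    also have "\<dots> = cycle_trace n \<Lambda> (L, w)" using c by (simp add: cycle_trace_def \<sigma>_def)
    finally show ?thesis .
  qed
  \<comment> \<open>The claim \<open>*\<close> settles the case of a nonzero right-hand side. A
    nonzero left-hand side is reduced to it by conjugating back with the involution
    \<open>s\<close>.\<close>
  have ss: "s \<circ> (s \<circ> w \<circ> s) \<circ> s = w" "map s (map s L) = L" using s(2) by (auto simp: fun_eq_iff map_idI)
  have sL: "set (map s L) \<subseteq> {1..n}" using L permutes_in_image[OF s(1)] by auto
  show ?thesis
  proof (cases "cycle_trace n \<Lambda> (L, w) = 0 \<and> cycle_trace n \<Lambda> (map s L, s \<circ> w \<circ> s) = 0")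
    case False
    then consider "cycle_trace n \<Lambda> (L, w) \<noteq> 0" | "cycle_trace n \<Lambda> (map s L, s \<circ> w \<circ> s) \<noteq> 0" by blast
    then show ?thesis
    proof cases
      case 1
      then show ?thesis using L by (intro *) (auto simp: cycle_trace_def split: if_splits)
    next
      case 2
      then have "cycle_trace n \<Lambda> (map s (map s L), s \<circ> (s \<circ> w \<circ> s) \<circ> s) = cycle_trace n \<Lambda> (map s L, s \<circ> w \<circ> s)"
        using sL by (intro *) (auto simp: cycle_trace_def split: if_splits)
      then show ?thesis unfolding ss by simp
    qed
  qed simp
qed

lemma cycle_trace_transpose:
  assumes s: "s permutes {1..n}" "\<And>x. s (s x) = x" and L: "set L \<subseteq> {1..n}"
  shows "cycle_trace n \<Lambda> (map s L, s \<circ> w) = cycle_trace n \<Lambda> (L, w \<circ> s)"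
proof -
  have "s \<circ> (w \<circ> s) \<circ> s = s \<circ> w" using s(2) by (auto simp: fun_eq_iff)
  then show ?thesis using cycle_trace_conj[OF s L, of \<Lambda> "w \<circ> s"] by simp
qed

section \<open>Linear extension of maps on words\<close>

lemma poly_mapping_induct [case_names zero single add]:
  assumes "P 0" "\<And>k v. P (Poly_Mapping.single k v)" "\<And>f g. P f \<Longrightarrow> P g \<Longrightarrow> P (f + g)"
  shows "P (f :: 'b \<Rightarrow>\<^sub>0 'c::comm_monoid_add)"
proof (induction f rule: update_induct)
  case const
  show ?case by (rule assms)
next
  case (update f a b)
  have "Poly_Mapping.update a b f = f + Poly_Mapping.single a b"
    using update(1) by (intro poly_mapping_eqI)
      (auto simp: lookup_update lookup_add lookup_single in_keys_iff when_def)
  then show ?case using assms(2,3) update by simp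
qed

text \<open>A central homomorphism turns a ring type into an algebra over the scalars. It is used
  for the scalars themselves, where functionals take their values, and for the model.\<close>

locale scalar_hom =
  fixes S :: "'r::comm_ring_1 \<Rightarrow> 'b::ring_1"
  assumes S_add: "S (a + b) = S a + S b" and S_mult: "S (a * b) = S a * S b" and S_1: "S 1 = 1"
    and S_central: "S a * x = x * S a"
begin

lemma S_left: "x * (S a * y) = S a * (x * y)"
  unfolding mult.assoc[symmetric] S_central[of a x] ..

lemma S_0: "S 0 = 0"
  using S_add[of 0 0] by simp

definition lin_ext :: "('w \<Rightarrow> 'b) \<Rightarrow> ('w \<Rightarrow>\<^sub>0 'r) \<Rightarrow> 'b" where
  "lin_ext h f = (\<Sum>w\<in>Poly_Mapping.keys f. S (Poly_Mapping.lookup f w) * h w)"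

lemma lin_ext_superset:
  "finite A \<Longrightarrow> Poly_Mapping.keys f \<subseteq> A \<Longrightarrow> lin_ext h f = (\<Sum>w\<in>A. S (Poly_Mapping.lookup f w) * h w)"
  unfolding lin_ext_def by (intro sum.mono_neutral_left) (auto simp: S_0 in_keys_iff)

lemma lin_ext_0 [simp]: "lin_ext h 0 = 0"
  by (simp add: lin_ext_def)

lemma lin_ext_single [simp]: "lin_ext h (Poly_Mapping.single w r) = S r * h w"
  by (cases "r = 0") (simp_all add: lin_ext_def S_0)

lemma lin_ext_add: "lin_ext h (f + g) = lin_ext h f + lin_ext h g"
proof -
  let ?A = "Poly_Mapping.keys f \<union> Poly_Mapping.keys g"
  have "lin_ext h (f + g) = (\<Sum>w\<in>?A. S (Poly_Mapping.lookup (f + g) w) * h w)"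
    by (intro lin_ext_superset keys_add) auto
  also have "\<dots> = (\<Sum>w\<in>?A. S (Poly_Mapping.lookup f w) * h w) + (\<Sum>w\<in>?A. S (Poly_Mapping.lookup g w) * h w)"
    by (simp add: lookup_add S_add distrib_right sum.distrib)
  also have "(\<Sum>w\<in>?A. S (Poly_Mapping.lookup f w) * h w) = lin_ext h f"
    by (intro lin_ext_superset[symmetric]) auto
  also have "(\<Sum>w\<in>?A. S (Poly_Mapping.lookup g w) * h w) = lin_ext h g"
    by (intro lin_ext_superset[symmetric]) auto
  finally show ?thesis .
qed

lemma lin_ext_uminus: "lin_ext h (- f) = - lin_ext h f"
  using lin_ext_add[of h f "- f"] by (simp add: add_eq_0_iff)

lemma lin_ext_diff: "lin_ext h (f - g) = lin_ext h f - lin_ext h g"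
  using lin_ext_add[of h f "- g"] by (simp add: lin_ext_uminus)

lemma lin_ext_single_mult:
  fixes g :: "'w::monoid_add \<Rightarrow>\<^sub>0 'r"
  shows "lin_ext h (Poly_Mapping.single u a * g) = S a * lin_ext (\<lambda>v. h (u + v)) g"
  by (induction g rule: poly_mapping_induct)
    (simp_all add: mult_single S_mult lin_ext_add distrib_left mult.assoc)

lemma lin_ext_mult_left:
  fixes f g :: "'w::monoid_add \<Rightarrow>\<^sub>0 'r"
  shows "lin_ext h (f * g) = lin_ext (\<lambda>u. lin_ext (\<lambda>v. h (u + v)) g) f"
  by (induction f rule: poly_mapping_induct) (simp_all add: lin_ext_single_mult distrib_right lin_ext_add)

lemma lin_ext_mult_single:
  fixes f :: "'w::monoid_add \<Rightarrow>\<^sub>0 'r"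
  shows "lin_ext h (f * Poly_Mapping.single v b) = S b * lin_ext (\<lambda>u. h (u + v)) f"
  by (induction f rule: poly_mapping_induct)
    (simp_all add: mult_single S_mult lin_ext_add distrib_left distrib_right mult.assoc S_central[of b] mult.commute[of _ b])

lemma lin_ext_mult_right:
  fixes f g :: "'w::monoid_add \<Rightarrow>\<^sub>0 'r"
  shows "lin_ext h (f * g) = lin_ext (\<lambda>v. lin_ext (\<lambda>u. h (u + v)) f) g"
  by (induction g rule: poly_mapping_induct) (simp_all add: lin_ext_mult_single distrib_left lin_ext_add)

lemma lin_ext_mult_const: "lin_ext (\<lambda>v. x * h v) g = x * lin_ext h g"
proof (induction g rule: poly_mapping_induct)
  case (single w r)
  show ?case by (simp add: mult.assoc[symmetric] S_central[of r x])
qed (simp_all add: lin_ext_add distrib_left)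

lemma lin_ext_const_mult: "lin_ext (\<lambda>v. h v * x) g = lin_ext h g * x"
  by (induction g rule: poly_mapping_induct) (simp_all add: lin_ext_add distrib_right mult.assoc)

lemma lin_ext_hom:
  fixes f g :: "'w::monoid_add \<Rightarrow>\<^sub>0 'r"
  assumes "\<And>u v. h (u + v) = h u * h v"
  shows "lin_ext h (f * g) = lin_ext h f * lin_ext h g"
  unfolding lin_ext_mult_left assms lin_ext_mult_const lin_ext_const_mult ..

end

interpretation id_scalar: scalar_hom "\<lambda>x::'r::comm_ring_1. x"
  by unfold_locales (simp_all add: distrib_left mult.commute)

section \<open>A concrete model of the Sergeev algebra\<close>

text \<open>Transpositions are pushed to the right through the Clifford letters; the resulting list
  of Clifford indices is left unsimplified. Skipping \<open>Xg i\<close> is a default: the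
  \<open>x i\<close> enter the model as Jucys-Murphy elements, whose words contain no such
  letter.\<close>

fun nform :: "sergeev_letter list \<Rightarrow> nat list \<times> (nat \<Rightarrow> nat)" where
  "nform [] = ([], id)"
| "nform (Sg i # u) = (map (transpose i (Suc i)) (fst (nform u)), transpose i (Suc i) \<circ> snd (nform u))"
| "nform (Cg i # u) = (i # fst (nform u), snd (nform u))"
| "nform (Xg i # u) = nform u"

definition pmult :: "nat list \<times> (nat \<Rightarrow> nat) \<Rightarrow> nat list \<times> (nat \<Rightarrow> nat) \<Rightarrow> nat list \<times> (nat \<Rightarrow> nat)" where
  "pmult p q = (fst p @ map (snd p) (fst q), snd p \<circ> snd q)"

lemma nform_append: "nform (u @ v) = pmult (nform u) (nform v)"
  by (induction u rule: nform.induct) (auto simp: pmult_def)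

lemma inj_nform: "inj (snd (nform u))"
proof (induction u rule: nform.induct)
  case (2 i u)
  have "inj (transpose i (Suc i))" by (metis injI transpose_involutory)
  then show ?case using 2 by (simp only: nform.simps snd_conv inj_compose)
qed auto

definition clifford_invariant :: "(nat list \<times> (nat \<Rightarrow> nat) \<Rightarrow> 'r::comm_ring_1) \<Rightarrow> bool" where
  "clifford_invariant \<phi> \<longleftrightarrow> (\<forall>us i vs w. \<phi> (us @ i # i # vs, w) = \<phi> (us @ vs, w)) \<and>
     (\<forall>us i j vs w. i \<noteq> j \<longrightarrow> \<phi> (us @ j # i # vs, w) = - \<phi> (us @ i # j # vs, w))"

lemma clifford_invariantI:
  assumes "\<And>us i vs w. \<phi> (us @ i # i # vs, w) = \<phi> (us @ vs, w)"
    and "\<And>us i j vs w. i \<noteq> j \<Longrightarrow> \<phi> (us @ j # i # vs, w) = - \<phi> (us @ i # j # vs, w)"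
  shows "clifford_invariant \<phi>"
  unfolding clifford_invariant_def by (intro conjI allI impI assms)

lemma clifford_invariantD:
  assumes "clifford_invariant \<phi>"
  shows "\<phi> (us @ i # i # vs, w) = \<phi> (us @ vs, w)"
    and "i \<noteq> j \<Longrightarrow> \<phi> (us @ j # i # vs, w) = - \<phi> (us @ i # j # vs, w)"
  using assms unfolding clifford_invariant_def by blast+

text \<open>Injectivity enters because letters that anticommute must keep distinct indices after
  renaming.\<close>

lemma clifford_invariant_left:
  assumes "clifford_invariant \<phi>" "inj (snd p)"
  shows "clifford_invariant (\<lambda>q. \<phi> (pmult p q))"
proof -
  have neq: "snd p i \<noteq> snd p j" if "i \<noteq> j" for i j using assms(2) that by (auto dest: injD)
  have 1: "\<phi> (pmult p (us @ i # i # vs, w)) = \<phi> (pmult p (us @ vs, w))" for us i vs w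
    using clifford_invariantD(1)[OF assms(1), of "fst p @ map (snd p) us" "snd p i" "map (snd p) vs" "snd p \<circ> w"]
    by (simp add: pmult_def)
  have 2: "\<phi> (pmult p (us @ j # i # vs, w)) = - \<phi> (pmult p (us @ i # j # vs, w))"
    if "snd p i \<noteq> snd p j" for us i j vs w
    using clifford_invariantD(2)[OF assms(1) that, of "fst p @ map (snd p) us" "map (snd p) vs" "snd p \<circ> w"]
    by (simp add: pmult_def)
  show ?thesis
  proof (rule clifford_invariantI)
    fix us vs and i :: nat and w
    show "\<phi> (pmult p (us @ i # i # vs, w)) = \<phi> (pmult p (us @ vs, w))" by (rule 1)
  next
    fix us vs and i j :: nat and w assume "i \<noteq> j"
    then show "\<phi> (pmult p (us @ j # i # vs, w)) = - \<phi> (pmult p (us @ i # j # vs, w))" by (intro 2 neq)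
  qed
qed

lemma clifford_invariant_right: "clifford_invariant \<phi> \<Longrightarrow> clifford_invariant (\<lambda>q. \<phi> (pmult q p))"
proof (rule clifford_invariantI, goal_cases)
  case (1 us i vs w)
  then show ?case using clifford_invariantD(1)[of \<phi> us i "vs @ map w (fst p)"] by (simp add: pmult_def)
next
  case (2 us i j vs w)
  then show ?case using clifford_invariantD(2)[of \<phi> i j us "vs @ map w (fst p)"] by (simp add: pmult_def)
qed

definition word_eval :: "(nat list \<times> (nat \<Rightarrow> nat) \<Rightarrow> 'r::comm_ring_1) \<Rightarrow> (sergeev_letter word \<Rightarrow>\<^sub>0 'r) \<Rightarrow> 'r" where
  "word_eval \<phi> = id_scalar.lin_ext (\<lambda>w. \<phi> (nform (letters w)))"

lemma letters_plus: "letters (u + v) = letters u @ letters v"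
  by (simp add: plus_word_def)

lemma letters_zero: "letters 0 = []"
  by (simp add: zero_word_def)

text \<open>Each expansion fixes a word in one factor and leaves the other factor intact; congruence
  in the two arguments of the product uses one of them each.\<close>

lemma word_eval_mult:
  "word_eval \<phi> (f * g) = id_scalar.lin_ext (\<lambda>u. word_eval (\<lambda>q. \<phi> (pmult (nform (letters u)) q)) g) f"
  "word_eval \<phi> (f * g) = id_scalar.lin_ext (\<lambda>v. word_eval (\<lambda>q. \<phi> (pmult q (nform (letters v)))) f) g"
  unfolding word_eval_def
   apply (simp only: id_scalar.lin_ext_mult_left letters_plus nform_append)
  apply (simp only: id_scalar.lin_ext_mult_right letters_plus nform_append)
  done

lemma word_eval_linear:
  "word_eval \<phi> (f + g) = word_eval \<phi> f + word_eval \<phi> g"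
  "word_eval \<phi> (f - g) = word_eval \<phi> f - word_eval \<phi> g"
  "word_eval \<phi> (- f) = - word_eval \<phi> f"
  "word_eval \<phi> (Poly_Mapping.single u r) = r * \<phi> (nform (letters u))"
  unfolding word_eval_def
  by (simp_all add: id_scalar.lin_ext_add id_scalar.lin_ext_diff id_scalar.lin_ext_uminus)

text \<open>Identification by functionals replaces a normal form for Clifford monomials: two
  polynomials are equal unless an invariant functional separates them. Every invariant functional,
  in particular each trace, therefore lives on the quotient.\<close>

definition model_eq :: "(sergeev_letter word \<Rightarrow>\<^sub>0 'r::comm_ring_1) \<Rightarrow> (sergeev_letter word \<Rightarrow>\<^sub>0 'r) \<Rightarrow> bool" where
  "model_eq f g \<longleftrightarrow> (\<forall>\<phi>. clifford_invariant \<phi> \<longrightarrow> word_eval \<phi> f = word_eval \<phi> g)"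

text \<open>Multiplying by a fixed word on either side turns an invariant functional into an
  invariant one, so the common kernel of all of them is a two-sided ideal.\<close>

lemma model_eq_mult:
  assumes "model_eq f f'" "model_eq g g'"
  shows "model_eq (f * g) (f' * g')"
  unfolding model_eq_def
proof (intro allI impI)
  fix \<phi> :: "nat list \<times> (nat \<Rightarrow> nat) \<Rightarrow> 'a" assume \<phi>: "clifford_invariant \<phi>"
  have "word_eval (\<lambda>q. \<phi> (pmult (nform (letters u)) q)) g = word_eval (\<lambda>q. \<phi> (pmult (nform (letters u)) q)) g'" for u
    using assms(2) clifford_invariant_left[OF \<phi> inj_nform] unfolding model_eq_def by blast
  then have "word_eval \<phi> (f * g) = word_eval \<phi> (f * g')" unfolding word_eval_mult(1) by simp
  also have "word_eval (\<lambda>q. \<phi> (pmult q (nform (letters u)))) f = word_eval (\<lambda>q. \<phi> (pmult q (nform (letters u)))) f'" for u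
    using assms(1) clifford_invariant_right[OF \<phi>] unfolding model_eq_def by blast
  then have "word_eval \<phi> (f * g') = word_eval \<phi> (f' * g')" unfolding word_eval_mult(2) by simp
  finally show "word_eval \<phi> (f * g) = word_eval \<phi> (f' * g')" .
qed

\<comment> \<open>The model as a ring and as an algebra over the scalars\<close>
quotient_type (overloaded) 'r sergeev_model = "sergeev_letter word \<Rightarrow>\<^sub>0 'r::comm_ring_1" / model_eq
  by (intro equivpI reflpI sympI transpI) (simp_all add: model_eq_def)

text \<open>This functional has the value 1 on the empty word and so separates 0 from 1 in the
  model.\<close>

lemma clifford_sort_sign_invariant:
  "clifford_invariant (\<lambda>(L, w). of_int (pair_sign (\<lambda>i j. if i \<le> j then 1 else - 1) L) :: 'r::comm_ring_1)"
proof -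
  let ?\<sigma> = "\<lambda>i j :: nat. if i \<le> j then 1 else - 1 :: int"
  have a: "pair_sign ?\<sigma> (us @ i # i # vs) = pair_sign ?\<sigma> (us @ vs)" for us i vs
    by (rule pair_sign_square) auto
  have b: "pair_sign ?\<sigma> (us @ j # i # vs) = - pair_sign ?\<sigma> (us @ i # j # vs)" if "i \<noteq> j" for us i j vs
    using that by (intro pair_sign_swap) auto
  show ?thesis
  proof (rule clifford_invariantI, goal_cases)
    case (1 us i vs w)
    show ?case unfolding prod.case a ..
  next
    case (2 us i j vs w)
    show ?case unfolding prod.case b[OF 2] by simp
  qed
qed

instantiation sergeev_model :: (comm_ring_1) ring_1
begin

lift_definition zero_sergeev_model :: "'a sergeev_model" is 0 .
lift_definition one_sergeev_model :: "'a sergeev_model" is 1 .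
lift_definition plus_sergeev_model :: "'a sergeev_model \<Rightarrow> 'a sergeev_model \<Rightarrow> 'a sergeev_model" is "(+)"
  by (simp add: model_eq_def word_eval_linear)
lift_definition minus_sergeev_model :: "'a sergeev_model \<Rightarrow> 'a sergeev_model \<Rightarrow> 'a sergeev_model" is "(-)"
  by (simp add: model_eq_def word_eval_linear)
lift_definition uminus_sergeev_model :: "'a sergeev_model \<Rightarrow> 'a sergeev_model" is uminus
  by (simp add: model_eq_def word_eval_linear)
lift_definition times_sergeev_model :: "'a sergeev_model \<Rightarrow> 'a sergeev_model \<Rightarrow> 'a sergeev_model" is "(*)"
  by (rule model_eq_mult)

instance
proof
  fix x y z :: "'a sergeev_model"
  show "x * y * z = x * (y * z)" by transfer (simp add: model_eq_def mult.assoc)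
  show "1 * x = x" "x * 1 = x" by (transfer; simp add: model_eq_def)+
  show "x + y + z = x + (y + z)" "x + y = y + x" "0 + x = x" "- x + x = 0" "x - y = x + - y"
    by (transfer; simp add: model_eq_def algebra_simps)+
  show "(x + y) * z = x * z + y * z" "x * (y + z) = x * y + x * z"
    by (transfer; simp add: model_eq_def algebra_simps)+
  show "(0 :: 'a sergeev_model) \<noteq> 1"
  proof (transfer)
    have "word_eval (\<lambda>(L, w). of_int (pair_sign (\<lambda>i j. if i \<le> j then 1 else - 1) L) :: 'a) 0 = 0"
      by (simp add: word_eval_def)
    moreover have "word_eval (\<lambda>(L, w). of_int (pair_sign (\<lambda>i j. if i \<le> j then 1 else - 1) L) :: 'a) (Poly_Mapping.single 0 1) = 1"
      unfolding word_eval_linear by (simp add: letters_zero)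
    ultimately show "\<not> model_eq 0 (1 :: sergeev_letter word \<Rightarrow>\<^sub>0 'a)"
      using clifford_sort_sign_invariant unfolding model_eq_def single_one[symmetric] by (metis zero_neq_one)
  qed
qed

end

lift_definition model_scalar :: "'r::comm_ring_1 \<Rightarrow> 'r sergeev_model" is "\<lambda>r. Poly_Mapping.single 0 r" .

lift_definition model_word :: "sergeev_letter list \<Rightarrow> 'r::comm_ring_1 sergeev_model" is "\<lambda>u. Poly_Mapping.single (Word u) 1" .

text \<open>Lifting demands compatibility for every \<open>\<phi>\<close>, hence the default 0 when
  \<open>\<phi>\<close> is not Clifford invariant.\<close>

lift_definition model_eval :: "(nat list \<times> (nat \<Rightarrow> nat) \<Rightarrow> 'r::comm_ring_1) \<Rightarrow> 'r sergeev_model \<Rightarrow> 'r" is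
  "\<lambda>\<phi> f. if clifford_invariant \<phi> then word_eval \<phi> f else 0"
  by (simp add: model_eq_def)

interpretation model: scalar_hom "model_scalar :: 'r::comm_ring_1 \<Rightarrow> 'r sergeev_model"
proof
  fix a b :: 'r and x :: "'r sergeev_model"
  show "model_scalar (a + b) = model_scalar a + model_scalar b" by transfer (simp add: model_eq_def single_add)
  show "model_scalar (a * b) = model_scalar a * model_scalar b" by transfer (simp add: model_eq_def mult_single)
  show "model_scalar (1 :: 'r) = 1" by transfer (simp add: model_eq_def)
  show "model_scalar a * x = x * model_scalar a"
  proof transfer
    fix a and x :: "sergeev_letter word \<Rightarrow>\<^sub>0 'r"
    have "Poly_Mapping.single 0 a * x = x * Poly_Mapping.single 0 a"
      by (induction x rule: poly_mapping_induct) (simp_all add: mult_single distrib_left distrib_right mult.commute)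
    then show "model_eq (Poly_Mapping.single 0 a * x) (x * Poly_Mapping.single 0 a)" by (simp add: model_eq_def)
  qed
qed

lemma model_eval_linear:
  "model_eval \<phi> (x + y) = model_eval \<phi> x + model_eval \<phi> y"
  "model_eval \<phi> (- x) = - model_eval \<phi> x"
  "model_eval \<phi> 0 = 0"
  "model_eval \<phi> (model_scalar r * x) = r * model_eval \<phi> x"
proof -
  show "model_eval \<phi> (x + y) = model_eval \<phi> x + model_eval \<phi> y" by transfer (simp add: word_eval_linear)
  show "model_eval \<phi> (- x) = - model_eval \<phi> x" by transfer (simp add: word_eval_linear)
  show "model_eval \<phi> 0 = 0" by transfer (simp add: word_eval_def)
  show "model_eval \<phi> (model_scalar r * x) = r * model_eval \<phi> x"
    by transfer (simp add: word_eval_def id_scalar.lin_ext_single_mult)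
qed

lemma model_eval_word: "clifford_invariant \<phi> \<Longrightarrow> model_eval \<phi> (model_word u) = \<phi> (nform u)"
  by transfer (simp add: word_eval_linear)

lemma model_word_append: "model_word (u @ v) = model_word u * model_word v"
  by transfer (simp add: mult_single plus_word_def model_eq_def)

lemma model_word_Nil: "model_word [] = 1"
  by transfer (simp add: model_eq_def zero_word_def[symmetric])

lemma model_word_cong: "nform u = nform v \<Longrightarrow> model_word u = model_word v"
  by transfer (simp add: word_eval_linear model_eq_def)

lemma model_word_anti:
  "(\<And>\<phi> :: _ \<Rightarrow> 'r::comm_ring_1. clifford_invariant \<phi> \<Longrightarrow> \<phi> (nform u) = - \<phi> (nform v)) \<Longrightarrow>
    model_word u = - (model_word v :: 'r sergeev_model)"
  by transfer (simp add: word_eval_linear model_eq_def)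

text \<open>All relations but the two purely Clifford ones hold already between the pairs computed
  by \<open>nform\<close>; those two are built into \<open>clifford_invariant\<close>. The indices
  are unbounded, so one model serves all \<open>n\<close>.\<close>

interpretation model: infinite_sergeev
  "\<lambda>i. model_word [Sg i] :: 'r::comm_ring_1 sergeev_model" "\<lambda>i. model_word [Cg i] :: 'r sergeev_model"
proof
  fix i j :: nat
  note simps = model_word_append[symmetric] model_word_Nil[symmetric]
  show "model_word [Sg i] * model_word [Sg i] = (1 :: 'r sergeev_model)"
    unfolding simps by (rule model_word_cong) (auto simp: fun_eq_iff)
  show "model_word [Sg i] * model_word [Sg j] = (model_word [Sg j] * model_word [Sg i] :: 'r sergeev_model)"
    if "i + 1 < j \<or> j + 1 < i"
    unfolding simps using that by (intro model_word_cong) (auto simp: fun_eq_iff transpose_def)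
  show "model_word [Sg i] * model_word [Sg (i + 1)] * model_word [Sg i] =
      (model_word [Sg (i + 1)] * model_word [Sg i] * model_word [Sg (i + 1)] :: 'r sergeev_model)"
    unfolding simps by (intro model_word_cong) (auto simp: fun_eq_iff transpose_def)
  show "model_word [Cg i] * model_word [Cg i] = (1 :: 'r sergeev_model)"
  proof -
    have "model_word [Cg i, Cg i] = (model_word [] :: 'r sergeev_model)"
    proof transfer
      fix i
      have "\<phi> ([i, i], id) = \<phi> ([], id)" if "clifford_invariant \<phi>" for \<phi> :: "nat list \<times> (nat \<Rightarrow> nat) \<Rightarrow> 'r"
        using clifford_invariantD(1)[OF that, of "[]" i "[]" id] by simp
      then show "model_eq (Poly_Mapping.single (Word [Cg i, Cg i]) (1 :: 'r)) (Poly_Mapping.single (Word []) 1)"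
        unfolding model_eq_def word_eval_linear by simp
    qed
    then show ?thesis unfolding simps by simp
  qed
  show "model_word [Cg i] * model_word [Cg j] = - (model_word [Cg j] * model_word [Cg i] :: 'r sergeev_model)"
    if "i \<noteq> j"
    unfolding simps
  proof (rule model_word_anti)
    fix \<phi> :: "nat list \<times> (nat \<Rightarrow> nat) \<Rightarrow> 'r" assume \<phi>: "clifford_invariant \<phi>"
    have "\<phi> ([] @ i # j # [], id) = - \<phi> ([] @ j # i # [], id)"
      using that by (intro clifford_invariantD(2)[OF \<phi>]) simp
    then show "\<phi> (nform ([Cg i] @ [Cg j])) = - \<phi> (nform ([Cg j] @ [Cg i]))" by simp
  qed
  show "model_word [Sg i] * model_word [Cg i] = (model_word [Cg (i + 1)] * model_word [Sg i] :: 'r sergeev_model)"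
    unfolding simps by (intro model_word_cong) auto
  show "model_word [Sg i] * model_word [Cg (i + 1)] = (model_word [Cg i] * model_word [Sg i] :: 'r sergeev_model)"
    unfolding simps by (intro model_word_cong) auto
  show "model_word [Sg i] * model_word [Cg j] = (model_word [Cg j] * model_word [Sg i] :: 'r sergeev_model)"
    if "j \<noteq> i" "j \<noteq> i + 1"
    unfolding simps using that by (intro model_word_cong) (auto simp: transpose_def)
qed

section \<open>The homomorphism from the free algebra to the model\<close>

fun model_letter :: "sergeev_letter \<Rightarrow> 'r::comm_ring_1 sergeev_model" where
  "model_letter (Sg i) = model_word [Sg i]"
| "model_letter (Xg i) = model.murphy i"
| "model_letter (Cg i) = model_word [Cg i]"

definition model_hom :: "(sergeev_letter word \<Rightarrow>\<^sub>0 'r) \<Rightarrow> 'r::comm_ring_1 sergeev_model" where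
  "model_hom = model.lin_ext (\<lambda>w. prod_list (map model_letter (letters w)))"

lemma model_hom_mult: "model_hom (f * g) = model_hom f * model_hom g"
  unfolding model_hom_def by (rule model.lin_ext_hom) (simp add: letters_plus)

lemma model_hom_linear:
  "model_hom (f + g) = model_hom f + model_hom g" "model_hom (f - g) = model_hom f - model_hom g"
  "model_hom (- f) = - model_hom f" "model_hom 0 = 0"
  by (simp_all add: model_hom_def model.lin_ext_add model.lin_ext_diff model.lin_ext_uminus)

lemma model_hom_single:
  "model_hom (Poly_Mapping.single w r) = model_scalar r * prod_list (map model_letter (letters w))"
  by (simp add: model_hom_def)

lemma model_hom_1: "model_hom 1 = 1"
  unfolding single_one[symmetric] model_hom_single by (simp add: letters_zero model.S_1)

lemma model_hom_gen: "model_hom (gen a) = model_letter a"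
  by (simp add: gen_def model_hom_single model.S_1)

lemma model_hom_scale: "model_hom (Poly_Mapping.map ((*) r) f) = model_scalar r * model_hom f"
  by (simp add: mult_map_scale_conv_mult model_hom_mult model_hom_single letters_zero)

lemma model_hom_relations:
  "(l, r) \<in> sergeev_relations n \<Longrightarrow> model_hom l = model_hom r"
proof (induction rule: sergeev_relations.induct)
  case (sx_comm i j)
  then consider "j < i" | "i + 1 < j" by linarith
  then show ?case
    by cases (use sx_comm model.s_murphy_high[of j i] model.s_murphy_low[of i j] in
        \<open>auto simp: model_hom_mult model_hom_gen model.commutes_def\<close>)
next
  case (xc_comm i j)
  then show ?case using model.murphy_c[of j i] by (simp add: model_hom_mult model_hom_gen model.commutes_def)
next
  case (ss_comm i j)
  then show ?case using model.s_comm[OF ss_comm(3)] by (simp only: model_hom_mult model_hom_gen model_letter.simps)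
next
  case (cc_anticomm i j)
  then show ?case using model.c_anti[OF cc_anticomm(3)] by (simp only: model_hom_linear model_hom_mult model_hom_gen model_letter.simps)
next
  case (sc_comm i j)
  then show ?case using model.s_c_comm[OF sc_comm(3,4)] by (simp only: model_hom_mult model_hom_gen model_letter.simps)
qed (simp_all only: model_hom_mult model_hom_gen model_hom_1 model_hom_linear model_letter.simps model.s_s
      model.braid model.c_c model.s_c model.s_c' model.s_murphy model.murphy_commute
      model.murphy_c_anti atLeastLessThan_iff)

section \<open>Supersymmetry of the traces on \<open>n\<close> strands\<close>

definition clifford_letters :: "nat \<Rightarrow> sergeev_letter set" where
  "clifford_letters n = Sg ` {1..<n} \<union> Cg ` {1..n}"

definition odd_word :: "sergeev_letter list \<Rightarrow> bool" where
  "odd_word u \<longleftrightarrow> odd (length (fst (nform u)))"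

lemma odd_word_append: "odd_word (u @ v) \<longleftrightarrow> odd_word u \<noteq> odd_word v"
  by (auto simp: odd_word_def nform_append pmult_def)

lemma nform_clifford_letters:
  "set u \<subseteq> clifford_letters n \<Longrightarrow> set (fst (nform u)) \<subseteq> {1..n} \<and> snd (nform u) permutes {1..n}"
proof (induction u rule: nform.induct)
  case (2 i u)
  then have i: "i \<in> {1..n}" "Suc i \<in> {1..n}" and
    IH: "set (fst (nform u)) \<subseteq> {1..n}" "snd (nform u) permutes {1..n}" by (auto simp: clifford_letters_def)
  have t: "transpose i (Suc i) permutes {1..n}" using i by (rule permutes_swap_id)
  have "set (fst (nform (Sg i # u))) \<subseteq> {1..n}"
  proof
    fix x assume "x \<in> set (fst (nform (Sg i # u)))"
    then obtain y where "x = transpose i (Suc i) y" "y \<in> {1..n}" using IH(1) by auto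
    then show "x \<in> {1..n}" using permutes_in_image[OF t] by simp
  qed
  moreover have "snd (nform (Sg i # u)) permutes {1..n}"
    using permutes_compose[OF IH(2) t] by (simp only: nform.simps snd_conv)
  ultimately show ?case ..
qed (auto simp: clifford_letters_def permutes_id)

text \<open>For \<open>Sg\<close> this is conjugation invariance, and for \<open>Cg\<close> next to
  a list of odd length it is the rotation rule. Next to a list of even length both sides vanish by
  parity, since \<open>\<Lambda>\<close> has even cardinality.\<close>

lemma cycle_trace_letter:
  assumes \<Lambda>: "even (card \<Lambda>)" and u: "set u \<subseteq> clifford_letters n" and a: "a \<in> clifford_letters n"
  shows "cycle_trace n \<Lambda> (nform (a # u)) = (if odd_word [a] \<and> odd_word u then - 1 else 1) * cycle_trace n \<Lambda> (nform (u @ [a]))"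
proof -
  obtain L w where Lw: "nform u = (L, w)" by (cases "nform u")
  have L: "set L \<subseteq> {1..n}" and w: "w permutes {1..n}" using nform_clifford_letters[OF u] Lw by auto
  show ?thesis
  proof (cases a)
    case (Sg i)
    then have i: "i \<in> {1..n}" "Suc i \<in> {1..n}" using a by (auto simp: clifford_letters_def)
    have "cycle_trace n \<Lambda> (map (transpose i (Suc i)) L, transpose i (Suc i) \<circ> w) = cycle_trace n \<Lambda> (L, w \<circ> transpose i (Suc i))"
      using permutes_swap_id[OF i] L by (intro cycle_trace_transpose) simp_all
    moreover have "nform (u @ [a]) = (L, w \<circ> transpose i (Suc i))" using Sg Lw by (simp add: nform_append pmult_def)
    moreover have "nform (a # u) = (map (transpose i (Suc i)) L, transpose i (Suc i) \<circ> w)" using Sg Lw by simp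
    ultimately show ?thesis using Sg by (simp only:) (simp add: odd_word_def)
  next
    case (Cg i)
    then have i: "i \<in> {1..n}" using a by (auto simp: clifford_letters_def)
    have n1: "nform (a # u) = (i # L, w)" and n2: "nform (u @ [a]) = (L @ [w i], w)"
      using Cg Lw by (simp_all add: nform_append pmult_def)
    have wi: "w i \<in> {1..n}" using permutes_in_image[OF w] i by blast
    show ?thesis
    proof (cases "odd (length L)")
      case True
      then show ?thesis using cycle_trace_rotate[OF i L True, of \<Lambda> w] Cg Lw unfolding n1 n2 by (simp add: odd_word_def)
    next
      case False
      have "cycle_trace n \<Lambda> (i # L, w) = 0" using \<Lambda> False L i by (intro cycle_trace_odd) auto
      moreover have "cycle_trace n \<Lambda> (L @ [w i], w) = 0" using \<Lambda> False L wi by (intro cycle_trace_odd) auto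
      ultimately show ?thesis unfolding n1 n2 by simp
    qed
  qed (use a in \<open>auto simp: clifford_letters_def\<close>)
qed

lemma cycle_trace_append:
  assumes \<Lambda>: "even (card \<Lambda>)"
  shows "set u \<subseteq> clifford_letters n \<Longrightarrow> set v \<subseteq> clifford_letters n \<Longrightarrow>
    cycle_trace n \<Lambda> (nform (u @ v)) = (if odd_word u \<and> odd_word v then - 1 else 1) * cycle_trace n \<Lambda> (nform (v @ u))"
proof (induction u arbitrary: v)
  case Nil
  then show ?case by (simp add: odd_word_def)
next
  case (Cons a u)
  have "cycle_trace n \<Lambda> (nform (a # (u @ v))) =
    (if odd_word [a] \<and> odd_word (u @ v) then - 1 else 1) * cycle_trace n \<Lambda> (nform ((u @ v) @ [a]))"
    using Cons.prems by (intro cycle_trace_letter[OF \<Lambda>]) auto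
  moreover have "cycle_trace n \<Lambda> (nform (u @ (v @ [a]))) =
    (if odd_word u \<and> odd_word (v @ [a]) then - 1 else 1) * cycle_trace n \<Lambda> (nform ((v @ [a]) @ u))"
    using Cons.prems by (intro Cons.IH) auto
  moreover have "odd_word (a # u) \<longleftrightarrow> odd_word [a] \<noteq> odd_word u" using odd_word_append[of "[a]" u] by simp
  ultimately show ?case
    by (cases "odd_word [a]"; cases "odd_word u"; cases "odd_word v") (simp_all add: odd_word_append)
qed

text \<open>The model contains words on arbitrarily many strands, while the exchange rule for a
  trace is available for words over \<open>n\<close> strands. The Boolean records the parity on
  which the sign depends.\<close>

inductive model_span :: "nat \<Rightarrow> bool \<Rightarrow> 'r::comm_ring_1 sergeev_model \<Rightarrow> bool" for n where
  word: "set u \<subseteq> clifford_letters n \<Longrightarrow> model_span n (odd_word u) (model_word u)"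
| zero: "model_span n p 0"
| add: "model_span n p x \<Longrightarrow> model_span n p y \<Longrightarrow> model_span n p (x + y)"
| scale: "model_span n p x \<Longrightarrow> model_span n p (model_scalar r * x)"

lemma model_span_mult:
  assumes "model_span n p x" "model_span n q y"
  shows "model_span n (p \<noteq> q) (x * y)"
  using assms
proof (induction arbitrary: q y rule: model_span.induct)
  case (word u)
  from word(2,1) show ?case
  proof (induction rule: model_span.induct)
    case (word v)
    then show ?case using model_span.word[of "u @ v" n] by (simp add: model_word_append odd_word_append)
  next
    case (scale q y r)
    then show ?case unfolding model.S_left by (intro model_span.scale) blast
  qed (auto simp: distrib_left intro: model_span.intros)
qed (auto simp: distrib_right mult.assoc intro: model_span.intros)

lemma model_span_murphy: "i \<le> n \<Longrightarrow> model_span n False (model.murphy i)"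
proof (induction i rule: model.murphy.induct)
  case (3 i)
  have s: "model_span n False (model_word [Sg (Suc i)] :: 'a sergeev_model)"
    using model_span.word[of "[Sg (Suc i)]" n] 3 by (simp add: clifford_letters_def odd_word_def)
  have c: "model_span n False (model_word [Cg (Suc i)] * model_word [Cg (Suc (Suc i))] :: 'a sergeev_model)"
    using model_span.word[of "[Cg (Suc i), Cg (Suc (Suc i))]" n] 3
    by (simp add: clifford_letters_def odd_word_def model_word_append[symmetric])
  have x: "model_span n False (model.murphy (Suc i) :: 'a sergeev_model)" using 3 by simp
  have "model_span n False (model_word [Sg (Suc i)] * model.murphy (Suc i) * model_word [Sg (Suc i)] :: 'a sergeev_model)"
    using model_span_mult[OF model_span_mult[OF s x] s] by simp
  moreover have "model_span n False (model_word [Cg (Suc i)] * model_word [Cg (Suc (Suc i))] * model_word [Sg (Suc i)] :: 'a sergeev_model)"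
    using model_span_mult[OF c s] by simp
  ultimately show ?case unfolding model.murphy.simps using s by (intro model_span.add)
qed (auto intro: model_span.zero)

lemma model_span_letter:
  assumes "a \<in> sergeev_letters n"
  shows "model_span n (sergeev_parity a = 1) (model_letter a)"
proof (cases a)
  case (Sg i)
  then show ?thesis
    using model_span.word[of "[Sg i]" n] assms by (auto simp: clifford_letters_def sergeev_letters_def odd_word_def)
next
  case (Xg i)
  then show ?thesis using model_span_murphy[of i n] assms by (auto simp: sergeev_letters_def)
next
  case (Cg i)
  then show ?thesis
    using model_span.word[of "[Cg i]" n] assms by (auto simp: clifford_letters_def sergeev_letters_def odd_word_def)
qed

lemma model_span_word:
  "set u \<subseteq> sergeev_letters n \<Longrightarrow>
    model_span n (word_parity sergeev_parity (Word u) = 1) (prod_list (map model_letter u))"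
proof (induction u)
  case Nil
  then show ?case using model_span.word[of "[]" n] by (simp add: word_parity_def odd_word_def model_word_Nil)
next
  case (Cons a u)
  have "(word_parity sergeev_parity (Word (a # u)) = 1) =
    ((sergeev_parity a = 1) \<noteq> (word_parity sergeev_parity (Word u) = 1))"
    by (cases "sergeev_parity a"; cases "word_parity sergeev_parity (Word u)") (simp_all add: word_parity_def)
  then show ?case using model_span_mult[OF model_span_letter Cons.IH, of a] Cons.prems by simp
qed

lemma model_span_hom:
  assumes "f \<in> grade (free_superalgebra (sergeev_letters n) sergeev_parity) p"
  shows "model_span n (p = 1) (model_hom f)"
proof -
  have "model_span n (p = 1) (\<Sum>w\<in>A. model_scalar (Poly_Mapping.lookup f w) * prod_list (map model_letter (letters w)))"
    if "finite A" "A \<subseteq> Poly_Mapping.keys f" for A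
    using that
  proof (induction A)
    case (insert w A)
    then have w: "set (letters w) \<subseteq> sergeev_letters n" "word_parity sergeev_parity w = p"
      using assms by (auto simp: free_superalgebra_def)
    have "model_span n (p = 1) (prod_list (map model_letter (letters w)))"
      using model_span_word[OF w(1)] w(2) by simp
    then show ?case using insert by (auto intro: model_span.intros)
  qed (auto intro: model_span.zero)
  then show ?thesis unfolding model_hom_def model.lin_ext_def by simp
qed

definition ring_trace :: "nat \<Rightarrow> nat set \<Rightarrow> nat list \<times> (nat \<Rightarrow> nat) \<Rightarrow> 'r::comm_ring_1" where
  "ring_trace n \<Lambda> p = of_int (cycle_trace n \<Lambda> p)"

lemma clifford_invariant_ring_trace: "clifford_invariant (ring_trace n \<Lambda>)"
proof (rule clifford_invariantI, goal_cases)
  case (1 us i vs w)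
  show ?case unfolding ring_trace_def cycle_trace_square ..
next
  case (2 us i j vs w)
  show ?case unfolding ring_trace_def cycle_trace_swap[OF 2] by simp
qed

lemma model_eval_commute:
  assumes \<Lambda>: "even (card \<Lambda>)" and "model_span n p x" "model_span n q y"
  shows "model_eval (ring_trace n \<Lambda>) (x * y) = (if p \<and> q then - 1 else 1) * model_eval (ring_trace n \<Lambda>) (y * x)"
  using assms(2,3)
proof (induction arbitrary: q y rule: model_span.induct)
  case (word u)
  from word(2,1) show ?case
  proof (induction rule: model_span.induct)
    case (word v)
    then show ?case
      unfolding model_word_append[symmetric] model_eval_word[OF clifford_invariant_ring_trace]
      unfolding ring_trace_def
      by (simp add: cycle_trace_append[OF \<Lambda>, of u n v])
  next
    case (scale q y r)
    then show ?case by (simp add: mult.assoc model.S_left model_eval_linear)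
  qed (simp_all add: distrib_left distrib_right model_eval_linear)
next
  case (scale p x r)
  then show ?case by (simp add: mult.assoc model.S_left model_eval_linear)
qed (simp_all add: distrib_left distrib_right model_eval_linear)

definition free_trace :: "nat \<Rightarrow> nat set \<Rightarrow> (sergeev_letter word \<Rightarrow>\<^sub>0 'r::comm_ring_1) \<Rightarrow> 'r" where
  "free_trace n \<Lambda> f = model_eval (ring_trace n \<Lambda>) (model_hom f)"

lemma free_trace_linear:
  "free_trace n \<Lambda> (f + g) = free_trace n \<Lambda> f + free_trace n \<Lambda> g"
  "free_trace n \<Lambda> (Poly_Mapping.map ((*) r) f) = r * free_trace n \<Lambda> f"
  by (simp_all add: free_trace_def model_hom_linear model_hom_scale model_eval_linear)

lemma free_trace_commute:
  assumes "even (card \<Lambda>)" "f \<in> grade (free_superalgebra (sergeev_letters n) sergeev_parity) i"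
    "g \<in> grade (free_superalgebra (sergeev_letters n) sergeev_parity) j"
  shows "free_trace n \<Lambda> (f * g) = parity_sign i j * free_trace n \<Lambda> (g * f)"
  using model_eval_commute[OF assms(1) model_span_hom[OF assms(2)] model_span_hom[OF assms(3)]]
  by (simp add: free_trace_def model_hom_mult parity_sign_def)

section \<open>Values on the block representatives\<close>

primrec block_word :: "nat \<Rightarrow> nat list \<Rightarrow> sergeev_letter list" where
  "block_word m [] = []"
| "block_word m (k # ks) = Cg m # map Sg [m..<m + (k - 1)] @ block_word (m + k) ks"

primrec starts :: "nat \<Rightarrow> nat list \<Rightarrow> nat list" where
  "starts m [] = []"
| "starts m (k # ks) = m # starts (m + k) ks"

text \<open>The permutation of \<open>chain m k\<close>. The cycle has length \<open>k + 1\<close>,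
  so \<open>k = 0\<close> gives the identity.\<close>

definition cycle_perm :: "nat \<Rightarrow> nat \<Rightarrow> nat \<Rightarrow> nat" where
  "cycle_perm m k j = (if m \<le> j \<and> j < m + k then Suc j else if j = m + k then m else j)"

lemma nform_chain: "nform (map Sg [m..<m + k]) = ([], cycle_perm m k)"
proof (induction k arbitrary: m)
  case 0
  show ?case by (auto simp: cycle_perm_def fun_eq_iff)
next
  case (Suc k)
  have "[m..<m + Suc k] = m # [Suc m..<Suc m + k]" by (simp add: upt_rec[of m])
  then have "nform (map Sg [m..<m + Suc k]) = ([], transpose m (Suc m) \<circ> cycle_perm (Suc m) k)"
    using Suc.IH[of "Suc m"] by simp
  moreover have "transpose m (Suc m) \<circ> cycle_perm (Suc m) k = cycle_perm m (Suc k)"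
    by (auto simp: cycle_perm_def fun_eq_iff transpose_def)
  ultimately show ?case by simp
qed

lemma snd_nform_block_word:
  "snd (nform (block_word m (k # ks))) = cycle_perm m (k - 1) \<circ> snd (nform (block_word (m + k) ks))"
  by (simp add: nform_append nform_chain pmult_def)

lemma starts_ge: "b \<in> set (starts m ks) \<Longrightarrow> m \<le> b"
  by (induction ks arbitrary: m) (auto dest: add_leD1)

lemma fst_nform_block_word: "\<forall>k\<in>set ks. 0 < k \<Longrightarrow> fst (nform (block_word m ks)) = starts m ks"
proof (induction ks arbitrary: m)
  case (Cons k ks)
  have "map (cycle_perm m (k - 1)) (starts (m + k) ks) = starts (m + k) ks"
  proof (intro map_idI)
    fix b assume "b \<in> set (starts (m + k) ks)"
    then have "m + k \<le> b" by (rule starts_ge)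
    then show "cycle_perm m (k - 1) b = b" using Cons.prems by (auto simp: cycle_perm_def)
  qed
  moreover have "fst (nform (block_word (m + k) ks)) = starts (m + k) ks" using Cons by simp
  ultimately show ?case
    by (simp only: block_word.simps starts.simps nform.simps nform_append nform_chain pmult_def fst_conv snd_conv append_Nil)
qed simp

lemma orbit_cong_closed:
  assumes "i \<in> A" "\<And>j. j \<in> A \<Longrightarrow> f j = g j" "\<And>j. j \<in> A \<Longrightarrow> f j \<in> A"
  shows "orbit f i = orbit g i"
proof -
  have "x \<in> orbit g i \<and> x \<in> A" if "x \<in> orbit f i" for x
    using that
  proof induction
    case base
    show ?case using assms(2)[OF assms(1)] assms(3)[OF assms(1)] orbit.base[of g i] by simp
  next
    case (step y)
    then show ?case using assms(2)[of y] assms(3)[of y] orbit.step[of y g i] by simp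
  qed
  moreover have "x \<in> orbit f i \<and> x \<in> A" if "x \<in> orbit g i" for x
    using that
  proof induction
    case base
    show ?case using assms(2)[OF assms(1)] assms(3)[OF assms(1)] orbit.base[of f i] by simp
  next
    case (step y)
    then show ?case using assms(2)[of y] assms(3)[of y] orbit.step[of y f i] by simp
  qed
  ultimately show ?thesis by blast
qed

lemma orbit_cycle_perm: "orbit (cycle_perm m k) m = {m..<m + Suc k}"
proof -
  have pow: "j \<le> k \<Longrightarrow> (cycle_perm m k ^^ j) m = m + j" for j
    by (induction j) (auto simp: cycle_perm_def)
  then have "(cycle_perm m k ^^ Suc k) m = m" by (simp add: cycle_perm_def)
  then have "orbit (cycle_perm m k) m = {(cycle_perm m k ^^ j) m | j. j < Suc k}"
    by (intro orbit_altdef_bounded) auto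
  also have "\<dots> = {m + j | j. j < Suc k}" by (rule Collect_cong) (metis pow less_Suc_eq_le)
  also have "\<dots> = {m..<m + Suc k}" by (auto simp: le_iff_add)
  finally show ?thesis .
qed

text \<open>The first two conjuncts carry the induction, for they keep the later blocks away from
  the first cycle. The third one identifies the cycle through each start as an interval whose length
  is the corresponding part.\<close>

lemma block_word_orbits:
  assumes "\<forall>k\<in>set ks. 0 < k"
  defines "W m \<equiv> snd (nform (block_word m ks))"
  shows "(\<forall>j. \<not> (m \<le> j \<and> j < m + sum_list ks) \<longrightarrow> W m j = j) \<and>
    (\<forall>j. m \<le> j \<and> j < m + sum_list ks \<longrightarrow> m \<le> W m j \<and> W m j < m + sum_list ks) \<and>
    list_all2 (\<lambda>b k. orbit (W m) b = {b..<b + k}) (starts m ks) ks"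
  using assms(1) unfolding W_def
proof (induction ks arbitrary: m)
  case (Cons k ks)
  define V where "V = snd (nform (block_word (m + k) ks))"
  define U where "U = snd (nform (block_word m (k # ks)))"
  have k: "0 < k" using Cons.prems by simp
  have U: "U j = cycle_perm m (k - 1) (V j)" for j unfolding U_def V_def snd_nform_block_word by simp
  have V1: "V j = j" if "\<not> (m + k \<le> j \<and> j < m + k + sum_list ks)" for j
    using Cons that unfolding V_def by auto
  have V2: "m + k \<le> V j \<and> V j < m + k + sum_list ks" if "m + k \<le> j" "j < m + k + sum_list ks" for j
    using Cons that unfolding V_def by auto
  have V3: "list_all2 (\<lambda>b l. orbit V b = {b..<b + l}) (starts (m + k) ks) ks"
    using Cons unfolding V_def by auto
  have UV: "U j = V j" if "m + k \<le> j" for j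
  proof -
    have "m + k \<le> V j" using that V1[of j] V2[of j] by (cases "j < m + k + sum_list ks") auto
    then show ?thesis unfolding U using k by (auto simp: cycle_perm_def)
  qed
  have Uc: "U j = cycle_perm m (k - 1) j" if "j < m + k" for j
    unfolding U using V1[of j] that by simp
  have "\<forall>j. \<not> (m \<le> j \<and> j < m + sum_list (k # ks)) \<longrightarrow> U j = j"
  proof (intro allI impI)
    fix j assume j: "\<not> (m \<le> j \<and> j < m + sum_list (k # ks))"
    show "U j = j"
    proof (cases "j < m + k")
      case True
      then show ?thesis using Uc[OF True] j by (simp add: cycle_perm_def)
    next
      case False
      then show ?thesis using UV[of j] V1[of j] j by simp
    qed
  qed
  moreover have "\<forall>j. m \<le> j \<and> j < m + sum_list (k # ks) \<longrightarrow> m \<le> U j \<and> U j < m + sum_list (k # ks)"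
  proof (intro allI impI)
    fix j assume j: "m \<le> j \<and> j < m + sum_list (k # ks)"
    show "m \<le> U j \<and> U j < m + sum_list (k # ks)"
    proof (cases "j < m + k")
      case True
      then show ?thesis using Uc[OF True] j k by (auto simp: cycle_perm_def)
    next
      case False
      then show ?thesis using UV[of j] V2[of j] j by simp
    qed
  qed
  moreover have "orbit U m = {m..<m + k}"
  proof -
    have "orbit U m = orbit (cycle_perm m (k - 1)) m"
      using k by (intro orbit_cong_closed[of m "{m..<m + k}"]) (auto simp: Uc cycle_perm_def)
    then show ?thesis using k by (simp add: orbit_cycle_perm)
  qed
  moreover have "list_all2 (\<lambda>b l. orbit U b = {b..<b + l}) (starts (m + k) ks) ks"
  proof -
    have "orbit U b = orbit V b" if "m + k \<le> b" for b
      using that UV V1 V2 by (intro orbit_cong_closed[of b "{m + k..}"]) (auto, metis not_less)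
    then show ?thesis using V3 starts_ge by (elim list.rel_mono_strong) auto
  qed
  ultimately show ?case unfolding U_def by simp
qed simp

lemma starts_cover:
  "m \<le> i \<Longrightarrow> i < m + sum_list ks \<Longrightarrow> \<exists>p<length ks. starts m ks ! p \<le> i \<and> i < starts m ks ! p + ks ! p"
proof (induction ks arbitrary: m)
  case (Cons k ks)
  show ?case
  proof (cases "i < m + k")
    case True
    then show ?thesis using Cons.prems by (intro exI[of _ 0]) simp
  next
    case False
    then obtain p where "p < length ks" "starts (m + k) ks ! p \<le> i" "i < starts (m + k) ks ! p + ks ! p"
      using Cons.IH[of "m + k"] Cons.prems by auto
    then show ?thesis by (intro exI[of _ "Suc p"]) simp
  qed
qed simp

lemma length_starts [simp]: "length (starts m ks) = length ks"
  by (induction ks arbitrary: m) auto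

lemma starts_le: "p < length ks \<Longrightarrow> m \<le> starts m ks ! p \<and> starts m ks ! p + ks ! p \<le> m + sum_list ks"
proof (induction ks arbitrary: m p)
  case (Cons k ks)
  show ?case
  proof (cases p)
    case (Suc p')
    then show ?thesis using Cons.IH[of p' "m + k"] Cons.prems by simp
  qed simp
qed simp

lemma set_block_word:
  "1 \<le> m \<Longrightarrow> m + sum_list ks \<le> Suc n \<Longrightarrow> \<forall>k\<in>set ks. 0 < k \<Longrightarrow> set (block_word m ks) \<subseteq> clifford_letters n"
proof (induction ks arbitrary: m)
  case (Cons k ks)
  have "set (block_word (m + k) ks) \<subseteq> clifford_letters n" using Cons by (intro Cons.IH) auto
  then show ?case using Cons.prems by (auto simp: clifford_letters_def)
qed simp

lemma pair_sign_sorted: "sorted_wrt (\<lambda>x y. \<sigma> x y = 1) L \<Longrightarrow> pair_sign \<sigma> L = 1"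
proof (induction L)
  case (Cons x L)
  have "prod_list (map (\<sigma> x) K) = 1" if "set K \<subseteq> set L" for K
    using that Cons.prems by (induction K) auto
  then show ?case using Cons by simp
qed simp

text \<open>The cycles are consecutive intervals, and each contains exactly one Clifford index, its
  start. As the parts decrease, the starts are already listed with larger cycles first, so every
  orientation gives the sign 1.\<close>

lemma cycle_trace_block_word:
  assumes pos: "\<forall>k\<in>set ks. 0 < k" and sum: "sum_list ks = n" and sorted: "sorted_wrt (>) ks"
  shows "cycle_trace n \<Lambda> (nform (block_word 1 ks)) = (if set ks = \<Lambda> then 1 else 0)"
proof -
  define w where "w = snd (nform (block_word 1 ks))"
  define L where "L = starts 1 ks"
  have nf: "nform (block_word 1 ks) = (L, w)"
    using fst_nform_block_word[OF pos, of 1] by (simp add: w_def L_def prod_eq_iff)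
  have w: "w permutes {1..n}"
    unfolding w_def using nform_clifford_letters[OF set_block_word[of 1 ks n]] pos sum by simp
  then have p: "permutation w" by (rule permutes_permutation)
  have orb: "orbit w (L ! q) = {L ! q..<L ! q + ks ! q}" if "q < length ks" for q
    using block_word_orbits[OF pos, of 1] that unfolding w_def L_def by (auto simp: list_all2_conv_all_nth)
  have crd: "card (orbit w (L ! q)) = ks ! q" if "q < length ks" for q using orb[OF that] by simp
  have Ln: "L ! q \<in> {1..n}" if "q < length ks" for q
  proof -
    have "0 < ks ! q" using pos that by simp
    then show ?thesis using starts_le[OF that, of 1] sum unfolding L_def by auto
  qed
  have inj: "q = r" if "q < length ks" "r < length ks" "ks ! q = ks ! r" for q r
  proof -
    have "ks ! q > ks ! r" if "q < r" "r < length ks" for q r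
      using sorted that by (simp add: sorted_wrt_iff_nth_less)
    from this[of q r] this[of r q] that show ?thesis by (cases q r rule: linorder_cases) auto
  qed
  have cover: "\<exists>q<length ks. orbit w i = orbit w (L ! q)" if "i \<in> {1..n}" for i
  proof -
    have i: "1 \<le> i" "i < 1 + sum_list ks" using that sum by auto
    obtain q where q: "q < length ks" "L ! q \<le> i" "i < L ! q + ks ! q"
      unfolding L_def using starts_cover[OF i] by blast
    then have "i \<in> orbit w (L ! q)" using orb by simp
    with q show ?thesis using orbit_eq[OF p] by blast
  qed
  have dist: "distinct_cycles n w"
    unfolding distinct_cycles_def
  proof (intro ballI impI)
    fix i j assume ij: "i \<in> {1..n}" "j \<in> {1..n}" "card (orbit w i) = card (orbit w j)"
    obtain q r where "q < length ks" "orbit w i = orbit w (L ! q)" "r < length ks" "orbit w j = orbit w (L ! r)"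
      using cover[OF ij(1)] cover[OF ij(2)] by blast
    with ij(3) show "orbit w i = orbit w j" using crd[of q] crd[of r] inj[of q r] by simp
  qed
  have "(\<lambda>i. card (orbit w i)) ` {1..n} \<subseteq> set ks"
  proof
    fix x assume "x \<in> (\<lambda>i. card (orbit w i)) ` {1..n}"
    then obtain i where i: "i \<in> {1..n}" "x = card (orbit w i)" by auto
    then obtain q where "q < length ks" "orbit w i = orbit w (L ! q)" using cover by blast
    then show "x \<in> set ks" using i crd[of q] by simp
  qed
  moreover have "set ks \<subseteq> (\<lambda>i. card (orbit w i)) ` {1..n}"
  proof
    fix x assume "x \<in> set ks"
    then obtain q where q: "q < length ks" "x = ks ! q" by (auto simp: in_set_conv_nth)
    then show "x \<in> (\<lambda>i. card (orbit w i)) ` {1..n}" using Ln[of q] crd[of q] by (intro image_eqI[of _ _ "L ! q"]) auto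
  qed
  ultimately have img: "(\<lambda>i. card (orbit w i)) ` {1..n} = set ks" by (rule equalityI)
  show ?thesis
  proof (cases "set ks = \<Lambda>")
    case True
    have "odd_content n w L"
      unfolding odd_content_def
    proof
      fix i assume "i \<in> {1..n}"
      then obtain q where q: "q < length ks" "orbit w i = orbit w (L ! q)" using cover by blast
      have "r = q" if r: "r < length ks" "L ! r \<in> orbit w (L ! q)" for r
        using orbit_eq[OF p r(2)] crd[of r] crd[of q] r(1) q(1) inj[of r q] by simp
      then have "{r. r < length L \<and> L ! r \<in> orbit w i} = {q}"
        using q permutation_self_in_orbit[OF p, of "L ! q"] by (auto simp: L_def)
      then show "odd (length (filter (\<lambda>l. l \<in> orbit w i) L))" by (simp add: length_filter_conv_card)
    qed
    moreover have "set L \<subseteq> {1..n}" using Ln by (auto simp: in_set_conv_nth L_def)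
    moreover obtain \<sigma> where \<sigma>: "orientation w \<sigma>" using orientation_exists[OF p] by blast
    ultimately have "cycle_trace n \<Lambda> (L, w) = pair_sign \<sigma> L"
      using w dist img True by (intro cycle_trace_eq) auto
    also have "\<sigma> (L ! q) (L ! r) = 1" if "q < r" "r < length ks" for q r
      using that sorted crd[of q] crd[of r]
      by (intro orientationD(4)[OF \<sigma>]) (simp add: sorted_wrt_iff_nth_less)
    then have "pair_sign \<sigma> L = 1"
      by (intro pair_sign_sorted) (simp add: sorted_wrt_iff_nth_less L_def)
    finally show ?thesis using True nf by simp
  next
    case False
    then show ?thesis using img nf by (simp add: cycle_trace_def)
  qed
qed

lemma free_trace_block_word:
  assumes pos: "\<forall>k\<in>set ks. 0 < k" and sum: "sum_list ks = n" and sorted: "sorted_wrt (>) ks"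
  shows "free_trace n \<Lambda> (Poly_Mapping.single (Word (block_word 1 ks)) 1) = (if set ks = \<Lambda> then 1 else 0)"
proof -
  have "prod_list (map model_letter u) = (model_word u :: 'a sergeev_model)" if "set u \<subseteq> clifford_letters n" for u
    using that
  proof (induction u)
    case (Cons a u)
    then have "model_letter a = (model_word [a] :: 'a sergeev_model)" by (auto simp: clifford_letters_def)
    moreover have "model_word (a # u) = (model_word [a] * model_word u :: 'a sergeev_model)"
      using model_word_append[of "[a]" u] by simp
    ultimately show ?case using Cons by simp
  qed (simp add: model_word_Nil)
  moreover have "set (block_word 1 ks) \<subseteq> clifford_letters n" using assms by (intro set_block_word) auto
  ultimately show ?thesis
    using cycle_trace_block_word[OF assms]
    by (simp add: free_trace_def model_hom_single model.S_1 model_eval_word[OF clifford_invariant_ring_trace] ring_trace_def)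
qed

section \<open>Quotients of modules and of superalgebras\<close>

lemma ring_of_type_algebra_simps [simp]:
  "x \<in> carrier ring_of_type_algebra" "monoid.mult ring_of_type_algebra a b = a * b" "add ring_of_type_algebra a b = a + b"
  "monoid.one ring_of_type_algebra = 1" "ring.zero ring_of_type_algebra = 0"
  for x a b :: "'r::comm_ring_1"
  by (simp_all add: ring_of_type_algebra_def)

lemma cring_ring_of_type_algebra: "cring (ring_of_type_algebra :: 'r::comm_ring_1 ring)"
  by (rule cring_from_type_algebra)

text \<open>Superalgebra records extend module records, and the module laws pass to the extension
  because they involve these fields only.\<close>

lemma module_cong:
  assumes "module R M" "carrier M' = carrier M" "add M' = add M" "ring.zero M' = ring.zero M" "module.smult M' = module.smult M"
  shows "module R M'"
proof -
  interpret M: module R M by fact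
  show ?thesis
  proof (rule moduleI[OF module.axioms(1)[OF assms(1)]])
    show "abelian_group M'"
    proof (rule abelian_groupI)
      fix x assume "x \<in> carrier M'"
      then show "\<exists>y\<in>carrier M'. y \<oplus>\<^bsub>M'\<^esub> x = \<zero>\<^bsub>M'\<^esub>"
        using M.l_neg[of x] assms by (intro bexI[of _ "\<ominus>\<^bsub>M\<^esub> x"]) auto
    qed (auto simp: assms M.a_ac)
  qed (auto simp: assms M.smult_l_distr M.smult_r_distr M.smult_assoc1)
qed

locale type_module = abelian_group M for M :: "('r::comm_ring_1, 'b, 'm) module_scheme" (structure) +
  assumes is_module: "module ring_of_type_algebra M"

lemma type_moduleI: "module ring_of_type_algebra M \<Longrightarrow> type_module M"
  by (simp add: type_module_def type_module_axioms_def module_def)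

context type_module
begin

lemma tm_smult_closed [simp, intro]: "x \<in> carrier M \<Longrightarrow> (r :: 'r) \<odot> x \<in> carrier M"
  by (rule module.smult_closed[OF is_module]) simp_all

lemma tm_smult_l_distr: "x \<in> carrier M \<Longrightarrow> (r + r' :: 'r) \<odot> x = r \<odot> x \<oplus> r' \<odot> x"
  using module.smult_l_distr[OF is_module, of r r' x] by simp

lemma tm_smult_r_distr: "x \<in> carrier M \<Longrightarrow> y \<in> carrier M \<Longrightarrow> (r :: 'r) \<odot> (x \<oplus> y) = r \<odot> x \<oplus> r \<odot> y"
  using module.smult_r_distr[OF is_module, of r x y] by simp

lemma tm_smult_assoc: "x \<in> carrier M \<Longrightarrow> (r * r' :: 'r) \<odot> x = r \<odot> (r' \<odot> x)"
  using module.smult_assoc1[OF is_module, of r r' x] by simp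

lemma tm_smult_one: "x \<in> carrier M \<Longrightarrow> (1 :: 'r) \<odot> x = x"
  using module.smult_one[OF is_module, of x] by simp

lemma tm_smult_zero: "x \<in> carrier M \<Longrightarrow> (0 :: 'r) \<odot> x = \<zero>"
  using module.smult_l_null[OF is_module, of x] by simp

lemma tm_smult_minus_one: "x \<in> carrier M \<Longrightarrow> (- 1 :: 'r) \<odot> x = \<ominus> x"
  using tm_smult_l_distr[of x "- 1" 1] by (intro minus_equality[symmetric]) (simp_all add: tm_smult_zero tm_smult_one)

lemma additive_subgroup_smult:
  assumes "N \<subseteq> carrier M" "\<zero> \<in> N" "\<And>x y. x \<in> N \<Longrightarrow> y \<in> N \<Longrightarrow> x \<oplus> y \<in> N"
    and "\<And>r x. x \<in> N \<Longrightarrow> (r :: 'r) \<odot> x \<in> N"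
  shows "additive_subgroup N M"
proof (intro additive_subgroup.intro add.subgroupI)
  fix x assume "x \<in> N"
  then show "\<ominus> x \<in> N" using assms(1,4) tm_smult_minus_one[of x] by (metis subsetD)
qed (use assms in auto)

lemma lin_comb_superset:
  assumes "finite B" "Poly_Mapping.keys f \<subseteq> B" "B \<subseteq> carrier M"
  shows "lin_comb M f = (\<Oplus>b\<in>B. Poly_Mapping.lookup f b \<odot> b)"
  unfolding lin_comb_def using assms
  by (intro add.finprod_mono_neutral_cong_left) (auto simp: in_keys_iff tm_smult_zero subset_iff)

lemma tm_smult_finsum:
  assumes "finite B" "g \<in> B \<rightarrow> carrier M"
  shows "(r :: 'r) \<odot> (\<Oplus>b\<in>B. g b) = (\<Oplus>b\<in>B. r \<odot> g b)"
  using assms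
proof (induction B)
  case empty
  then show ?case using module.smult_r_null[OF is_module, of r] by simp
next
  case (insert x B)
  then have "g \<in> B \<rightarrow> carrier M" "g x \<in> carrier M" "(\<lambda>b. r \<odot> g b) \<in> B \<rightarrow> carrier M" by auto
  with insert show ?case by (simp add: tm_smult_r_distr finsum_closed)
qed

lemma lin_span_closed:
  assumes "V \<subseteq> carrier M"
  shows "lin_span M V \<subseteq> carrier M" "\<zero> \<in> lin_span M V" "V \<subseteq> lin_span M V"
    "x \<in> lin_span M V \<Longrightarrow> y \<in> lin_span M V \<Longrightarrow> x \<oplus> y \<in> lin_span M V"
    "x \<in> lin_span M V \<Longrightarrow> r \<odot> x \<in> lin_span M V"
proof -
  show "lin_span M V \<subseteq> carrier M"
    using assms by (auto simp: lin_span_def lin_comb_def intro!: finsum_closed)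
  have "lin_comb M 0 = \<zero>" by (simp add: lin_comb_def)
  then show "\<zero> \<in> lin_span M V" unfolding lin_span_def by (metis (mono_tags, lifting) empty_subsetI keys_zero mem_Collect_eq)
  show "V \<subseteq> lin_span M V"
  proof
    fix v assume v: "v \<in> V"
    have "lin_comb M (Poly_Mapping.single v 1) = (\<Oplus>b\<in>{v}. Poly_Mapping.lookup (Poly_Mapping.single v (1 :: 'r)) b \<odot> b)"
      using assms v by (intro lin_comb_superset) auto
    also have "\<dots> = v" using assms v by (simp add: finsum_singleton tm_smult_one subset_iff)
    finally show "v \<in> lin_span M V" unfolding lin_span_def using v
      by (intro CollectI exI[of _ "Poly_Mapping.single v 1"]) auto
  qed
  show "x \<oplus> y \<in> lin_span M V" if "x \<in> lin_span M V" "y \<in> lin_span M V"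
  proof -
    obtain f g where f: "x = lin_comb M f" "Poly_Mapping.keys f \<subseteq> V" and g: "y = lin_comb M g" "Poly_Mapping.keys g \<subseteq> V"
      using \<open>x \<in> _\<close> \<open>y \<in> _\<close> by (auto simp: lin_span_def)
    let ?B = "Poly_Mapping.keys f \<union> Poly_Mapping.keys g"
    have B: "?B \<subseteq> carrier M" using f g assms by auto
    have k: "Poly_Mapping.keys (f + g) \<subseteq> ?B" by (rule keys_add)
    have "lin_comb M (f + g) = (\<Oplus>b\<in>?B. Poly_Mapping.lookup f b \<odot> b \<oplus> Poly_Mapping.lookup g b \<odot> b)"
      using B k by (subst lin_comb_superset[of ?B]) (auto simp: lookup_add tm_smult_l_distr intro!: finsum_cong')
    also have "\<dots> = lin_comb M f \<oplus> lin_comb M g"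
      using B by (subst finsum_addf) (auto simp: lin_comb_superset[of ?B])
    finally show ?thesis unfolding lin_span_def using f g k by (intro CollectI exI[of _ "f + g"]) auto
  qed
  show "r \<odot> x \<in> lin_span M V" if "x \<in> lin_span M V"
  proof -
    obtain f where f: "x = lin_comb M f" "Poly_Mapping.keys f \<subseteq> V" using \<open>x \<in> _\<close> by (auto simp: lin_span_def)
    let ?B = "Poly_Mapping.keys f" and ?g = "Poly_Mapping.map ((*) r) f"
    have lk: "Poly_Mapping.lookup ?g b = r * Poly_Mapping.lookup f b" for b
      by (auto simp: Poly_Mapping.map.rep_eq when_def)
    have B: "?B \<subseteq> carrier M" using f assms by auto
    have k: "Poly_Mapping.keys ?g \<subseteq> ?B" by (auto simp: in_keys_iff lk)
    have "lin_comb M ?g = (\<Oplus>b\<in>?B. r \<odot> (Poly_Mapping.lookup f b \<odot> b))"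
      using B k by (subst lin_comb_superset[of ?B]) (auto simp: lk tm_smult_assoc intro!: finsum_cong')
    also have "\<dots> = r \<odot> lin_comb M f"
      unfolding lin_comb_def using B by (intro tm_smult_finsum[symmetric]) auto
    finally show ?thesis unfolding lin_span_def using f k by (intro CollectI exI[of _ ?g]) auto
  qed
qed

end

locale type_submodule = type_module M for M :: "('r::comm_ring_1, 'b, 'm) module_scheme" (structure) +
  fixes N :: "'b set"
  assumes N_sub: "N \<subseteq> carrier M" and N_0: "\<zero> \<in> N"
    and N_plus: "x \<in> N \<Longrightarrow> y \<in> N \<Longrightarrow> x \<oplus> y \<in> N" and N_smult: "x \<in> N \<Longrightarrow> (r :: 'r) \<odot> x \<in> N"
begin

sublocale sub: abelian_subgroup N M
  by (intro abelian_subgroupI3 additive_subgroup_smult N_sub N_0 N_plus N_smult abelian_group_axioms)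

abbreviation cos where "cos x \<equiv> N +> x"

lemma cos_eq_iff:
  assumes "x \<in> carrier M" "y \<in> carrier M"
  shows "cos x = cos y \<longleftrightarrow> x \<ominus> y \<in> N"
proof
  assume "cos x = cos y"
  then have "x \<in> cos y" using sub.a_rcos_self[OF assms(1)] by simp
  then show "x \<ominus> y \<in> N" using sub.a_rcos_module[OF assms(2,1)] by (simp add: a_minus_def)
next
  assume "x \<ominus> y \<in> N"
  then have "x \<in> cos y" using sub.a_rcos_module[OF assms(2,1)] by (simp add: a_minus_def)
  then show "cos x = cos y" using sub.a_repr_independence'[OF _ assms(2)] by simp
qed

lemma cos_zero: "cos \<zero> = N"
  by (rule sub.a_rcos_const) (rule N_0)

lemma cos_eq_N_iff: "x \<in> carrier M \<Longrightarrow> cos x = N \<longleftrightarrow> x \<in> N"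
proof -
  assume x: "x \<in> carrier M"
  have "\<ominus> \<zero> = \<zero>" by (rule minus_equality) simp_all
  then have "x \<ominus> \<zero> = x" unfolding a_minus_def using x by (metis r_zero)
  then show ?thesis using cos_eq_iff[OF x zero_closed] by (simp only: cos_zero)
qed

lemma quotient_simps:
  "carrier (quotient_module M N) = cos ` carrier M" "ring.zero (quotient_module M N) = N"
  "monoid.mult (quotient_module M N) = rcoset_mult M N" "monoid.one (quotient_module M N) = cos \<one>"
  by (auto simp: quotient_module_def ring.defs module.defs FactRing_def A_RCOSETS_def')

lemma quotient_add:
  "x \<in> carrier M \<Longrightarrow> y \<in> carrier M \<Longrightarrow> cos x \<oplus>\<^bsub>quotient_module M N\<^esub> cos y = cos (x \<oplus> y)"
  by (simp add: quotient_module_def ring.defs module.defs FactRing_def sub.a_rcos_sum)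

text \<open>The action on a coset is defined as a union over its representatives. All members of the
  union are the same coset, and there is at least one.\<close>

lemma quotient_smult:
  assumes x: "x \<in> carrier M"
  shows "r \<odot>\<^bsub>quotient_module M N\<^esub> cos x = cos (r \<odot> x)"
proof -
  have "cos (r \<odot> y) = cos (r \<odot> x)" if "y \<in> cos x" for y
  proof -
    have y: "y \<in> carrier M" using that x sub.a_elemrcos_carrier by blast
    obtain j where j: "j \<in> N" "y = j \<oplus> x" using \<open>y \<in> cos x\<close> by (auto simp: a_r_coset_def')
    have "j \<in> carrier M" using j N_sub by blast
    then have "r \<odot> y = r \<odot> j \<oplus> r \<odot> x" using x j by (simp add: tm_smult_r_distr)
    then have "r \<odot> y \<ominus> r \<odot> x = r \<odot> j"
      using x y \<open>j \<in> carrier M\<close> by (simp add: a_minus_def a_assoc r_neg)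
    then show ?thesis using x y j N_smult by (simp add: cos_eq_iff)
  qed
  moreover have "cos x \<noteq> {}" using sub.a_rcos_self[OF x] by blast
  ultimately have "(\<Union>y\<in>cos x. cos (r \<odot> y)) = cos (r \<odot> x)" by (intro SUP_eq_const)
  then show ?thesis by (simp add: quotient_module_def ring.defs module.defs)
qed

lemma quotient_is_module: "module ring_of_type_algebra (quotient_module M N)"
proof (rule moduleI[OF cring_ring_of_type_algebra])
  show "abelian_group (quotient_module M N)"
  proof (rule abelian_groupI)
    fix x assume "x \<in> carrier (quotient_module M N)"
    then obtain a where a: "a \<in> carrier M" "x = cos a" by (auto simp: quotient_simps)
    have "cos (\<ominus> a) \<oplus>\<^bsub>quotient_module M N\<^esub> x = \<zero>\<^bsub>quotient_module M N\<^esub>"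
      using a by (simp add: quotient_add quotient_simps l_neg cos_zero)
    then show "\<exists>y\<in>carrier (quotient_module M N). y \<oplus>\<^bsub>quotient_module M N\<^esub> x = \<zero>\<^bsub>quotient_module M N\<^esub>"
      using a by (auto simp: quotient_simps)
    show "\<zero>\<^bsub>quotient_module M N\<^esub> \<oplus>\<^bsub>quotient_module M N\<^esub> x = x"
      using a quotient_add[of \<zero> a] by (simp add: quotient_simps cos_zero)
  next
    show "\<zero>\<^bsub>quotient_module M N\<^esub> \<in> carrier (quotient_module M N)"
      unfolding quotient_simps using cos_zero by (metis imageI zero_closed)
  qed (auto simp: quotient_simps quotient_add a_ac)
qed (auto simp: quotient_simps quotient_add quotient_smult tm_smult_l_distr tm_smult_r_distr tm_smult_assoc tm_smult_one)

lemma cos_finsum: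
  assumes "finite A" "g \<in> A \<rightarrow> carrier M"
  shows "(\<Oplus>\<^bsub>quotient_module M N\<^esub>i\<in>A. cos (g i)) = cos (\<Oplus>i\<in>A. g i)"
proof -
  interpret Q: type_module "quotient_module M N" by (rule type_moduleI) (rule quotient_is_module)
  show ?thesis
    using assms
  proof (induction A)
    case empty
    then show ?case by (simp add: quotient_simps cos_zero)
  next
    case (insert i A)
    then have "(\<lambda>i. cos (g i)) \<in> A \<rightarrow> carrier (quotient_module M N)" "cos (g i) \<in> carrier (quotient_module M N)"
      by (auto simp: quotient_simps)
    with insert show ?case by (simp add: quotient_add finsum_closed)
  qed
qed

text \<open>Functionals that vanish on \<open>N\<close> and are dual to the \<open>y j\<close> read
  off the coefficients of any combination. Hence the classes of the \<open>y j\<close> are pairwise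
  different and independent, and with spanning they form a basis.\<close>

lemma free_quotient:
  fixes y :: "'i \<Rightarrow> 'b" and \<phi> :: "'i \<Rightarrow> 'b \<Rightarrow> 'r"
  assumes fin: "finite \<Lambda>" and y: "y \<in> \<Lambda> \<rightarrow> carrier M" and one_neq: "(1 :: 'r) \<noteq> 0"
    and \<phi>_add: "\<And>i x x'. i \<in> \<Lambda> \<Longrightarrow> x \<in> carrier M \<Longrightarrow> x' \<in> carrier M \<Longrightarrow> \<phi> i (x \<oplus> x') = \<phi> i x + \<phi> i x'"
    and \<phi>_smult: "\<And>i r x. i \<in> \<Lambda> \<Longrightarrow> x \<in> carrier M \<Longrightarrow> \<phi> i (r \<odot> x) = r * \<phi> i x"
    and \<phi>_N: "\<And>i x. i \<in> \<Lambda> \<Longrightarrow> x \<in> N \<Longrightarrow> \<phi> i x = 0"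
    and \<phi>_y: "\<And>i j. i \<in> \<Lambda> \<Longrightarrow> j \<in> \<Lambda> \<Longrightarrow> \<phi> i (y j) = (if i = j then 1 else 0)"
    and span: "\<And>x. x \<in> carrier M \<Longrightarrow> \<exists>k. x \<ominus> (\<Oplus>i\<in>\<Lambda>. k i \<odot> y i) \<in> N"
  shows "free_module_of_rank (quotient_module M N) (card \<Lambda>)"
proof -
  let ?Q = "quotient_module M N"
  interpret Q: type_module ?Q by (rule type_moduleI) (rule quotient_is_module)
  define b where "b i = cos (y i)" for i
  have yc: "y i \<in> carrier M" if "i \<in> \<Lambda>" for i using y that by auto
  have \<phi>0: "\<phi> i \<zero> = 0" if "i \<in> \<Lambda>" for i using \<phi>_N[OF that N_0] .
  have \<phi>_sum: "\<phi> i (\<Oplus>j\<in>A. k j \<odot> y j) = (\<Sum>j\<in>A. k j * \<phi> i (y j))" if "i \<in> \<Lambda>" "A \<subseteq> \<Lambda>" for i A k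
    using finite_subset[OF that(2) fin] that(2)
  proof (induction A)
    case (insert j A)
    then have "(\<lambda>j. k j \<odot> y j) \<in> A \<rightarrow> carrier M" "k j \<odot> y j \<in> carrier M" using yc by auto
    with insert show ?case using that(1) yc by (simp add: \<phi>_add \<phi>_smult finsum_closed)
  qed (simp add: \<phi>0 that(1))
  have \<phi>_sum': "\<phi> i (\<Oplus>j\<in>\<Lambda>. k j \<odot> y j) = k i" if "i \<in> \<Lambda>" for i k
    using that fin by (simp add: \<phi>_sum \<phi>_y if_distrib[of "\<lambda>x. _ * x"] cong: if_cong)
  have inj: "inj_on b \<Lambda>"
  proof
    fix i j assume ij: "i \<in> \<Lambda>" "j \<in> \<Lambda>" "b i = b j"
    then have "y i \<ominus> y j \<in> N" using cos_eq_iff[of "y i" "y j"] yc by (simp add: b_def)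
    then have "\<phi> i (y i \<oplus> (- 1) \<odot> y j) = 0" using \<phi>_N ij yc by (simp add: a_minus_def tm_smult_minus_one)
    then have "\<phi> i (y i) = \<phi> i (y j)" using ij yc by (simp add: \<phi>_add \<phi>_smult)
    then show "i = j" using ij one_neq by (simp add: \<phi>_y split: if_splits)
  qed
  have bc: "b i \<in> carrier ?Q" if "i \<in> \<Lambda>" for i using yc[OF that] by (auto simp: b_def quotient_simps)
  have comb: "lin_comb ?Q f = cos (\<Oplus>i\<in>\<Lambda>. Poly_Mapping.lookup f (b i) \<odot> y i)" if "Poly_Mapping.keys f \<subseteq> b ` \<Lambda>" for f
  proof -
    have "lin_comb ?Q f = (\<Oplus>\<^bsub>?Q\<^esub>x\<in>b ` \<Lambda>. Poly_Mapping.lookup f x \<odot>\<^bsub>?Q\<^esub> x)"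
      using that bc fin by (intro Q.lin_comb_superset) auto
    also have "\<dots> = (\<Oplus>\<^bsub>?Q\<^esub>i\<in>\<Lambda>. Poly_Mapping.lookup f (b i) \<odot>\<^bsub>?Q\<^esub> b i)"
      using bc by (intro Q.finsum_reindex inj) auto
    also have "\<dots> = (\<Oplus>\<^bsub>?Q\<^esub>i\<in>\<Lambda>. cos (Poly_Mapping.lookup f (b i) \<odot> y i))"
      using yc by (intro Q.finsum_cong') (auto simp: b_def quotient_smult quotient_simps)
    also have "\<dots> = cos (\<Oplus>i\<in>\<Lambda>. Poly_Mapping.lookup f (b i) \<odot> y i)"
      using yc by (intro cos_finsum fin) auto
    finally show ?thesis .
  qed
  have sum_closed: "(\<Oplus>i\<in>\<Lambda>. k i \<odot> y i) \<in> carrier M" for k using yc by (intro finsum_closed) auto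
  have "lin_independent ?Q (b ` \<Lambda>)"
    unfolding lin_independent_def
  proof (intro allI impI)
    fix f :: "'b set \<Rightarrow>\<^sub>0 'r" assume f: "Poly_Mapping.keys f \<subseteq> b ` \<Lambda>" "lin_comb ?Q f = \<zero>\<^bsub>?Q\<^esub>"
    then have "(\<Oplus>i\<in>\<Lambda>. Poly_Mapping.lookup f (b i) \<odot> y i) \<in> N"
      using comb[OF f(1)] cos_eq_N_iff[OF sum_closed] by (simp add: quotient_simps)
    then have "Poly_Mapping.lookup f (b i) = 0" if "i \<in> \<Lambda>" for i
      using \<phi>_N[OF that] \<phi>_sum'[OF that, of "\<lambda>i. Poly_Mapping.lookup f (b i)"] by simp
    then have "Poly_Mapping.lookup f x = 0" for x
      using f(1) by (cases "x \<in> Poly_Mapping.keys f") (auto simp: in_keys_iff)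
    then show "f = 0" by (intro poly_mapping_eqI) simp
  qed
  moreover have "lin_span ?Q (b ` \<Lambda>) = carrier ?Q"
  proof
    show "lin_span ?Q (b ` \<Lambda>) \<subseteq> carrier ?Q" using bc by (intro Q.lin_span_closed) auto
    show "carrier ?Q \<subseteq> lin_span ?Q (b ` \<Lambda>)"
    proof
      fix q assume "q \<in> carrier ?Q"
      then obtain x where x: "x \<in> carrier M" "q = cos x" by (auto simp: quotient_simps)
      obtain k where "x \<ominus> (\<Oplus>i\<in>\<Lambda>. k i \<odot> y i) \<in> N" using span[OF x(1)] by blast
      then have q: "q = cos (\<Oplus>i\<in>\<Lambda>. k i \<odot> y i)" using x sum_closed by (simp add: cos_eq_iff)
      \<comment> \<open>Coefficients in the quotient are indexed by classes. Since \<open>b\<close>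
        is injective, different indices never add up in one coefficient.\<close>
      define f where "f = (\<Sum>i\<in>\<Lambda>. Poly_Mapping.single (b i) (k i))"
      have "Poly_Mapping.lookup f (b i) = k i" if i: "i \<in> \<Lambda>" for i
      proof -
        have "(if b j = b i then k j else 0) = (if j = i then k i else 0)" if "j \<in> \<Lambda>" for j
          using that i inj by (auto dest: inj_onD)
        then have "Poly_Mapping.lookup f (b i) = (\<Sum>j\<in>\<Lambda>. if j = i then k i else 0)"
          unfolding f_def lookup_sum lookup_single when_def by (intro sum.cong) auto
        then show ?thesis using i fin by simp
      qed
      then have "(\<Oplus>i\<in>\<Lambda>. Poly_Mapping.lookup f (b i) \<odot> y i) = (\<Oplus>i\<in>\<Lambda>. k i \<odot> y i)"
        using yc by (intro finsum_cong') auto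
      moreover have keys: "Poly_Mapping.keys f \<subseteq> b ` \<Lambda>"
      proof
        fix x assume "x \<in> Poly_Mapping.keys f"
        then have "(\<Sum>i\<in>\<Lambda>. Poly_Mapping.lookup (Poly_Mapping.single (b i) (k i)) x) \<noteq> 0"
          unfolding f_def in_keys_iff lookup_sum .
        then obtain i where "i \<in> \<Lambda>" "Poly_Mapping.lookup (Poly_Mapping.single (b i) (k i)) x \<noteq> 0"
          by (meson sum.not_neutral_contains_not_neutral)
        then show "x \<in> b ` \<Lambda>" by (auto simp: lookup_single when_def split: if_splits)
      qed
      ultimately show "q \<in> lin_span ?Q (b ` \<Lambda>)"
        unfolding lin_span_def using q comb[OF keys] by (intro CollectI exI[of _ f]) simp
    qed
  qed
  ultimately have "module_basis ?Q (b ` \<Lambda>)" using bc by (auto simp: module_basis_def)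
  then show ?thesis
    unfolding free_module_of_rank_def using quotient_is_module fin card_image[OF inj] by blast
qed

end

section \<open>Superalgebras and their quotients by ideals\<close>

locale super_algebra = ring A + type_module A
  for A :: "('r::comm_ring_1, 'b, 'm) superalgebra_scheme" (structure) +
  assumes smult_mult: "x \<in> carrier A \<Longrightarrow> y \<in> carrier A \<Longrightarrow> (r \<odot> x) \<otimes> y = r \<odot> (x \<otimes> y)"
    and mult_smult: "x \<in> carrier A \<Longrightarrow> y \<in> carrier A \<Longrightarrow> x \<otimes> (r \<odot> y) = r \<odot> (x \<otimes> y)"
    and grade_sub: "grade A i \<subseteq> carrier A" and grade_zero: "\<zero> \<in> grade A i"
    and grade_add: "x \<in> grade A i \<Longrightarrow> y \<in> grade A i \<Longrightarrow> x \<oplus> y \<in> grade A i"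
    and grade_smult: "x \<in> grade A i \<Longrightarrow> r \<odot> x \<in> grade A i"
begin

text \<open>Scalar multiplication by \<open>r\<close> is multiplication by the element
  \<open>r \<odot> \<one>\<close>, which an ideal absorbs.\<close>

lemma ideal_type_submodule:
  assumes "ideal I A"
  shows "type_submodule A I"
proof -
  interpret I: ideal I A by fact
  show ?thesis
  proof
    fix x and r :: 'r assume x: "x \<in> I"
    have "r \<odot> x = (r \<odot> \<one>) \<otimes> x" using x I.a_Hcarr by (simp add: smult_mult)
    then show "r \<odot> x \<in> I" using x I.I_l_closed[of x "r \<odot> \<one>"] by simp
  qed (use I.a_subset in auto)
qed

lemma quotient_superalgebra_simps:
  "carrier (quotient_superalgebra A I) = carrier (quotient_module A I)"
  "add (quotient_superalgebra A I) = add (quotient_module A I)"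
  "ring.zero (quotient_superalgebra A I) = ring.zero (quotient_module A I)"
  "monoid.mult (quotient_superalgebra A I) = monoid.mult (quotient_module A I)"
  "monoid.one (quotient_superalgebra A I) = monoid.one (quotient_module A I)"
  "module.smult (quotient_superalgebra A I) = module.smult (quotient_module A I)"
  "grade (quotient_superalgebra A I) i = (\<lambda>x. I +> x) ` grade A i"
  by (simp_all add: quotient_superalgebra_def module.defs superalgebra.defs)

lemma quotient_mult:
  "ideal I A \<Longrightarrow> x \<in> carrier A \<Longrightarrow> y \<in> carrier A \<Longrightarrow>
    (I +> x) \<otimes>\<^bsub>quotient_superalgebra A I\<^esub> (I +> y) = I +> (x \<otimes> y)"
  by (simp add: quotient_superalgebra_simps quotient_module_def ring.defs module.defs FactRing_def ideal.rcoset_mult_add)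

lemma quotient_super_algebra:
  assumes I: "ideal I A"
  shows "super_algebra (quotient_superalgebra A I)"
proof -
  interpret I: ideal I A by fact
  interpret S: type_submodule A I by (rule ideal_type_submodule[OF I])
  let ?Q = "quotient_superalgebra A I"
  have mod: "module ring_of_type_algebra ?Q"
    using S.quotient_is_module by (rule module_cong) (simp_all add: quotient_superalgebra_simps)
  interpret Q: type_module ?Q by (rule type_moduleI) (rule mod)
  have carrier: "carrier ?Q = (\<lambda>x. I +> x) ` carrier A" by (simp add: quotient_superalgebra_simps S.quotient_simps)
  have add: "(I +> x) \<oplus>\<^bsub>?Q\<^esub> (I +> y) = I +> (x \<oplus> y)" if "x \<in> carrier A" "y \<in> carrier A" for x y
    using that by (simp add: quotient_superalgebra_simps S.quotient_add)
  have one: "\<one>\<^bsub>?Q\<^esub> = I +> \<one>" by (simp add: quotient_superalgebra_simps S.quotient_simps)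
  have smult: "r \<odot>\<^bsub>?Q\<^esub> (I +> x) = I +> (r \<odot> x)" if "x \<in> carrier A" for r x
    using that by (simp add: quotient_superalgebra_simps S.quotient_smult)
  note mult = quotient_mult[OF I]
  have "ring ?Q"
  proof (rule ringI)
    show "abelian_group ?Q" by (rule Q.abelian_group_axioms)
    show "Group.monoid ?Q" by (rule monoidI) (auto simp: carrier mult one m_assoc)
  qed (auto simp: carrier add mult l_distr r_distr)
  then show ?thesis
  proof (intro super_algebra.intro type_moduleI mod super_algebra_axioms.intro)
    fix i show "\<zero>\<^bsub>?Q\<^esub> \<in> grade ?Q i"
      unfolding quotient_superalgebra_simps S.quotient_simps using S.cos_zero grade_zero by (metis imageI)
  qed (use grade_sub grade_add grade_smult in
      \<open>auto simp: quotient_superalgebra_simps(7) carrier mult smult smult_mult mult_smult add subset_iff image_iff\<close>)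
qed

end

section \<open>The cyclotomic algebra as a quotient of the free algebra\<close>

abbreviation "free_sergeev n \<equiv> free_superalgebra (sergeev_letters n) sergeev_parity"

lemma free_superalgebra_simps:
  "carrier (free_superalgebra G p) = {f. \<forall>w\<in>Poly_Mapping.keys f. set (letters w) \<subseteq> G}"
  "monoid.mult (free_superalgebra G p) = (*)" "monoid.one (free_superalgebra G p) = 1"
  "ring.zero (free_superalgebra G p) = 0" "add (free_superalgebra G p) = (+)"
  "module.smult (free_superalgebra G p) = (\<lambda>r. Poly_Mapping.map ((*) r))"
  "grade (free_superalgebra G p) i = {f. \<forall>w\<in>Poly_Mapping.keys f. set (letters w) \<subseteq> G \<and> word_parity p w = i}"
  by (simp_all add: free_superalgebra_def)

lemma keys_scale: "Poly_Mapping.keys (Poly_Mapping.map ((*) r) f) \<subseteq> Poly_Mapping.keys f" for r :: "'r::comm_ring_1"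
  by (auto simp: in_keys_iff Poly_Mapping.map.rep_eq when_def)

text \<open>Scalars act as multiplication by the constants \<open>Poly_Mapping.single 0 r\<close>,
  which are central, so the algebra laws reduce to the ring laws of noncommutative
  polynomials.\<close>

lemma free_super_algebra: "super_algebra (free_superalgebra G p :: ('r::comm_ring_1, _) superalgebra)"
proof -
  let ?F = "free_superalgebra G p :: ('r, _) superalgebra"
  note simps = free_superalgebra_simps
  have add: "f + g \<in> carrier ?F" if "f \<in> carrier ?F" "g \<in> carrier ?F" for f g
    using that Poly_Mapping.keys_add[of f g] by (auto simp: simps)
  have scale: "Poly_Mapping.map ((*) r) f \<in> carrier ?F" if "f \<in> carrier ?F" for f r
    using that keys_scale[of r f] by (auto simp: simps)
  have scale_eq: "Poly_Mapping.map ((*) r) f = Poly_Mapping.single 0 r * f" for f :: "_ word \<Rightarrow>\<^sub>0 'r" and r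
    by (rule mult_map_scale_conv_mult)
  have central: "f * (Poly_Mapping.single 0 r * g) = Poly_Mapping.single 0 r * (f * g)" for f g :: "_ word \<Rightarrow>\<^sub>0 'r" and r
    by (induction f rule: poly_mapping_induct)
       (simp_all add: distrib_left distrib_right mult.assoc[symmetric] mult_single mult.commute[of _ r])
  have mult: "f * g \<in> carrier ?F" if "f \<in> carrier ?F" "g \<in> carrier ?F" for f g
  proof -
    have "set (letters w) \<subseteq> G" if "w \<in> Poly_Mapping.keys (f * g)" for w
    proof -
      obtain u v where uv: "w = u + v" "u \<in> Poly_Mapping.keys f" "v \<in> Poly_Mapping.keys g"
        using \<open>w \<in> _\<close> keys_mult[of f g] by auto
      then show ?thesis using \<open>f \<in> _\<close> \<open>g \<in> _\<close> by (auto simp: simps letters_plus)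
    qed
    then show ?thesis by (simp add: simps)
  qed
  have ab: "abelian_group ?F"
  proof (rule abelian_groupI)
    fix f assume "f \<in> carrier ?F"
    then have "- f \<in> carrier ?F" by (auto simp: simps in_keys_iff)
    then show "\<exists>g\<in>carrier ?F. g \<oplus>\<^bsub>?F\<^esub> f = \<zero>\<^bsub>?F\<^esub>" by (intro bexI[of _ "- f"]) (simp_all add: simps)
  qed (auto simp: simps(4,5) add add.assoc add.commute intro: add, simp add: simps(1))
  have mod: "module ring_of_type_algebra ?F"
    by (rule moduleI[OF cring_ring_of_type_algebra ab])
      (auto simp: simps(5,6) scale[unfolded scale_eq] scale_eq distrib_left distrib_right single_add mult_single mult.assoc[symmetric])
  have "ring ?F"
  proof (rule ringI[OF ab])
    show "Group.monoid ?F"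
      by (rule monoidI) (auto simp: simps(2,3) mult mult.assoc, auto simp: simps(1) zero_word_def)
  qed (auto simp: simps(2,5) distrib_left distrib_right)
  then show ?thesis
  proof (intro super_algebra.intro type_moduleI mod super_algebra_axioms.intro)
    fix f g i assume "f \<in> grade ?F i" "g \<in> grade ?F i"
    then show "f \<oplus>\<^bsub>?F\<^esub> g \<in> grade ?F i" using Poly_Mapping.keys_add[of f g] by (auto simp: simps)
  next
    fix f i and r :: 'r assume "f \<in> grade ?F i"
    then show "r \<odot>\<^bsub>?F\<^esub> f \<in> grade ?F i" using keys_scale[of r f] by (auto simp: simps)
  qed (auto simp: simps scale_eq central mult.assoc)
qed

lemma free_minus:
  assumes "f \<in> carrier (free_superalgebra G p :: ('r::comm_ring_1, _) superalgebra)" "g \<in> carrier (free_superalgebra G p :: ('r, _) superalgebra)"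
  shows "f \<ominus>\<^bsub>(free_superalgebra G p :: ('r, _) superalgebra)\<^esub> g = f - g"
proof -
  interpret F: super_algebra "free_superalgebra G p :: ('r, _) superalgebra" by (rule free_super_algebra)
  have "- g \<in> carrier (free_superalgebra G p :: ('r, _) superalgebra)"
    using assms(2) by (auto simp: free_superalgebra_simps in_keys_iff)
  then have "\<ominus>\<^bsub>(free_superalgebra G p :: ('r, _) superalgebra)\<^esub> g = - g"
    using assms(2) by (intro F.minus_equality) (auto simp: free_superalgebra_simps(4,5))
  then show ?thesis unfolding a_minus_def by (simp add: free_superalgebra_simps)
qed

lemma gen_carrier: "a \<in> G \<Longrightarrow> gen a \<in> carrier (free_superalgebra G p)"
  by (simp add: gen_def free_superalgebra_simps)

lemma free_closed:
  fixes f g :: "_ word \<Rightarrow>\<^sub>0 'r::comm_ring_1"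
  assumes "f \<in> carrier (free_superalgebra G p)" "g \<in> carrier (free_superalgebra G p)"
  shows "f * g \<in> carrier (free_superalgebra G p)" "f + g \<in> carrier (free_superalgebra G p)"
    "f - g \<in> carrier (free_superalgebra G p)" "- f \<in> carrier (free_superalgebra G p)"
proof -
  interpret F: super_algebra "free_superalgebra G p :: ('r, _) superalgebra" by (rule free_super_algebra)
  show "f * g \<in> carrier (free_superalgebra G p)" using F.m_closed[OF assms] by (simp add: free_superalgebra_simps(2))
  show "f + g \<in> carrier (free_superalgebra G p)" using F.a_closed[OF assms] by (simp add: free_superalgebra_simps(5))
  show "f - g \<in> carrier (free_superalgebra G p)" using F.minus_closed[OF assms] by (simp add: free_minus[OF assms])
  show "- f \<in> carrier (free_superalgebra G p)" using assms(1) by (auto simp: free_superalgebra_simps in_keys_iff)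
qed

lemma free_one: "(1 :: _ word \<Rightarrow>\<^sub>0 'r::comm_ring_1) \<in> carrier (free_superalgebra G p)"
  by (auto simp: free_superalgebra_simps zero_word_def)

lemma sergeev_relations_carrier:
  "(l, r) \<in> sergeev_relations n \<Longrightarrow> l \<in> carrier (free_sergeev n) \<and> r \<in> carrier (free_sergeev n)"
  by (induction rule: sergeev_relations.induct)
    (auto intro!: free_closed free_one gen_carrier simp: sergeev_letters_def)

abbreviation "rel_ideal n \<equiv> relation_ideal (sergeev_letters n) sergeev_parity (sergeev_relations n)"

definition cyc :: "nat \<Rightarrow> ('r::comm_ring_1, (sergeev_letter word \<Rightarrow>\<^sub>0 'r) set set) superalgebra" where
  "cyc n = cyclotomic_sergeev n (Polynomial.monom 1 1)"

lemma rel_ideal_ideal: "ideal (rel_ideal n) (free_sergeev n :: ('r::comm_ring_1, _) superalgebra)"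
proof -
  interpret F: super_algebra "free_sergeev n :: ('r, _) superalgebra" by (rule free_super_algebra)
  show ?thesis unfolding relation_ideal_def
    using sergeev_relations_carrier by (intro F.genideal_ideal) (blast intro: free_closed)
qed

lemma affine_super_algebra: "super_algebra (affine_sergeev n :: ('r::comm_ring_1, _) superalgebra)"
  unfolding affine_sergeev_def presented_superalgebra_def
  by (rule super_algebra.quotient_super_algebra[OF free_super_algebra rel_ideal_ideal])

definition aff :: "nat \<Rightarrow> (sergeev_letter word \<Rightarrow>\<^sub>0 'r::comm_ring_1) \<Rightarrow> (sergeev_letter word \<Rightarrow>\<^sub>0 'r) set" where
  "aff n f = rel_ideal n +>\<^bsub>free_sergeev n\<^esub> f"

definition cyc_ideal :: "nat \<Rightarrow> (sergeev_letter word \<Rightarrow>\<^sub>0 'r::comm_ring_1) set set" where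
  "cyc_ideal n = Idl\<^bsub>affine_sergeev n\<^esub> {aff n (xgen 1)}"

definition proj :: "nat \<Rightarrow> (sergeev_letter word \<Rightarrow>\<^sub>0 'r::comm_ring_1) \<Rightarrow> (sergeev_letter word \<Rightarrow>\<^sub>0 'r) set set" where
  "proj n f = cyc_ideal n +>\<^bsub>affine_sergeev n\<^esub> aff n f"

context
  fixes n :: nat and A :: "('r::comm_ring_1, sergeev_letter word \<Rightarrow>\<^sub>0 'r) superalgebra" (structure)
  defines "A \<equiv> free_sergeev n"
begin

interpretation F: super_algebra A unfolding A_def by (rule free_super_algebra)
interpretation Aff: super_algebra "affine_sergeev n :: ('r, _) superalgebra" by (rule affine_super_algebra)
interpretation J: type_submodule A "rel_ideal n"
  unfolding A_def by (rule super_algebra.ideal_type_submodule[OF free_super_algebra rel_ideal_ideal])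

lemma rel_ideal_A: "ideal (rel_ideal n) A"
  unfolding A_def by (rule rel_ideal_ideal)

lemma affine_alt: "(affine_sergeev n :: ('r, _) superalgebra) = quotient_superalgebra A (rel_ideal n)"
  by (simp add: affine_sergeev_def presented_superalgebra_def A_def)

lemma F_ops: "monoid.mult A = (*)" "monoid.one A = 1" "ring.zero A = 0" "add A = (+)"
  "module.smult A = (\<lambda>r. Poly_Mapping.map ((*) r))"
  by (simp_all add: A_def free_superalgebra_simps)

lemma aff_hom:
  "carrier (affine_sergeev n :: ('r, _) superalgebra) = aff n ` carrier A"
  "\<And>f g. f \<in> carrier A \<Longrightarrow> g \<in> carrier A \<Longrightarrow> aff n f \<oplus>\<^bsub>affine_sergeev n\<^esub> aff n g = aff n (f + g)"
  "\<And>f g. f \<in> carrier A \<Longrightarrow> g \<in> carrier A \<Longrightarrow> aff n f \<otimes>\<^bsub>affine_sergeev n\<^esub> aff n g = aff n (f * g)"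
  "\<And>r f. f \<in> carrier A \<Longrightarrow> r \<odot>\<^bsub>affine_sergeev n\<^esub> aff n f = aff n (Poly_Mapping.map ((*) r) f)"
  "\<one>\<^bsub>(affine_sergeev n :: ('r, _) superalgebra)\<^esub> = aff n 1"
  "\<zero>\<^bsub>(affine_sergeev n :: ('r, _) superalgebra)\<^esub> = aff n 0"
  "grade (affine_sergeev n :: ('r, _) superalgebra) i = aff n ` grade A i"
proof -
  have aff: "aff n f = rel_ideal n +>\<^bsub>A\<^esub> f" for f :: "_ \<Rightarrow>\<^sub>0 'r" by (simp add: aff_def A_def)
  show "carrier (affine_sergeev n :: ('r, _) superalgebra) = aff n ` carrier A"
    by (simp add: affine_alt F.quotient_superalgebra_simps J.quotient_simps aff)
  show "aff n f \<oplus>\<^bsub>affine_sergeev n\<^esub> aff n g = aff n (f + g)" if "f \<in> carrier A" "g \<in> carrier A" for f g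
    using J.quotient_add[OF that] unfolding affine_alt F.quotient_superalgebra_simps aff F_ops .
  show "aff n f \<otimes>\<^bsub>affine_sergeev n\<^esub> aff n g = aff n (f * g)" if "f \<in> carrier A" "g \<in> carrier A" for f g
    using F.quotient_mult[OF rel_ideal_A that] unfolding affine_alt aff F_ops .
  show "r \<odot>\<^bsub>affine_sergeev n\<^esub> aff n f = aff n (Poly_Mapping.map ((*) r) f)" if "f \<in> carrier A" for r f
    using J.quotient_smult[OF that, of r] unfolding affine_alt F.quotient_superalgebra_simps aff F_ops .
  show "\<one>\<^bsub>(affine_sergeev n :: ('r, _) superalgebra)\<^esub> = aff n 1"
    unfolding affine_alt F.quotient_superalgebra_simps J.quotient_simps aff F_ops ..
  show "\<zero>\<^bsub>(affine_sergeev n :: ('r, _) superalgebra)\<^esub> = aff n 0"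
    using J.cos_zero unfolding affine_alt F.quotient_superalgebra_simps J.quotient_simps aff F_ops by (rule sym)
  show "grade (affine_sergeev n :: ('r, _) superalgebra) i = aff n ` grade A i"
    unfolding affine_alt F.quotient_superalgebra_simps aff ..
qed

context
  assumes n: "1 \<le> n"
begin

lemma xgen_carrier: "xgen 1 \<in> carrier A"
  using n by (auto simp: A_def sergeev_letters_def intro: gen_carrier)

lemma aff_xgen: "aff n (xgen 1) \<in> carrier (affine_sergeev n :: ('r, _) superalgebra)"
  unfolding aff_hom(1) by (rule imageI) (rule xgen_carrier)

lemma cyc_ideal_ideal: "ideal (cyc_ideal n) (affine_sergeev n :: ('r, _) superalgebra)"
  unfolding cyc_ideal_def by (rule Aff.genideal_ideal) (use aff_xgen in blast)

text \<open>The polynomial \<open>Polynomial.monom 1 1\<close> evaluates at an element to that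
  element, so the ideal is generated by the class of \<open>xgen 1\<close>.\<close>

lemma cyc_alt: "(cyc n :: ('r, _) superalgebra) = quotient_superalgebra (affine_sergeev n) (cyc_ideal n)"
proof -
  let ?Q = "affine_sergeev n :: ('r, _) superalgebra"
  have x: "affine_x n 1 = aff n (xgen 1 :: _ \<Rightarrow>\<^sub>0 'r)"
    by (simp add: affine_x_def presented_gen_def aff_def)
  note xc = aff_xgen
  have eq: "eval_poly_at ?Q (Polynomial.monom 1 1) (aff n (xgen 1)) = aff n (xgen 1)"
  proof -
    have "{..degree (Polynomial.monom (1 :: 'r) 1)} = {0, 1}" by (auto simp: degree_monom_eq)
    then have "eval_poly_at ?Q (Polynomial.monom 1 1) (aff n (xgen 1)) =
      (\<Oplus>\<^bsub>?Q\<^esub>k\<in>{0, 1 :: nat}. (if k = 1 then 1 else 0 :: 'r) \<odot>\<^bsub>?Q\<^esub> (aff n (xgen 1) [^]\<^bsub>?Q\<^esub> k))"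
      unfolding eval_poly_at_def by (simp add: eq_commute)
    also have "\<dots> = aff n (xgen 1)"
      using xc by (simp add: Aff.tm_smult_zero Aff.tm_smult_one Aff.nat_pow_eone)
    finally show ?thesis .
  qed
  show ?thesis unfolding cyc_def cyclotomic_sergeev_def cyc_ideal_def x eq ..
qed

interpretation I: type_submodule "affine_sergeev n :: ('r, _) superalgebra" "cyc_ideal n"
  by (rule Aff.ideal_type_submodule) (rule cyc_ideal_ideal)

lemma cyc_super_algebra: "super_algebra (cyc n :: ('r, _) superalgebra)"
  unfolding cyc_alt by (rule Aff.quotient_super_algebra) (rule cyc_ideal_ideal)

lemma proj_hom:
  "carrier (cyc n :: ('r, _) superalgebra) = proj n ` carrier A"
  "\<And>f g. f \<in> carrier A \<Longrightarrow> g \<in> carrier A \<Longrightarrow> proj n f \<oplus>\<^bsub>cyc n\<^esub> proj n g = proj n (f + g)"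
  "\<And>f g. f \<in> carrier A \<Longrightarrow> g \<in> carrier A \<Longrightarrow> proj n f \<otimes>\<^bsub>cyc n\<^esub> proj n g = proj n (f * g)"
  "\<And>r f. f \<in> carrier A \<Longrightarrow> r \<odot>\<^bsub>cyc n\<^esub> proj n f = proj n (Poly_Mapping.map ((*) r) f)"
  "\<one>\<^bsub>(cyc n :: ('r, _) superalgebra)\<^esub> = proj n 1"
  "\<zero>\<^bsub>(cyc n :: ('r, _) superalgebra)\<^esub> = proj n 0"
  "grade (cyc n :: ('r, _) superalgebra) i = proj n ` grade A i"
proof -
  note c = aff_hom(1)
  show "carrier (cyc n :: ('r, _) superalgebra) = proj n ` carrier A"
    unfolding cyc_alt by (simp add: Aff.quotient_superalgebra_simps I.quotient_simps c proj_def image_image)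
  show "proj n f \<oplus>\<^bsub>cyc n\<^esub> proj n g = proj n (f + g)" if "f \<in> carrier A" "g \<in> carrier A" for f g
    using that unfolding cyc_alt Aff.quotient_superalgebra_simps proj_def
    by (simp add: I.quotient_add c aff_hom(2))
  show "proj n f \<otimes>\<^bsub>cyc n\<^esub> proj n g = proj n (f * g)" if "f \<in> carrier A" "g \<in> carrier A" for f g
    using that unfolding cyc_alt proj_def by (simp add: Aff.quotient_mult[OF cyc_ideal_ideal] c aff_hom(3))
  show "r \<odot>\<^bsub>cyc n\<^esub> proj n f = proj n (Poly_Mapping.map ((*) r) f)" if "f \<in> carrier A" for r f
    using that unfolding cyc_alt Aff.quotient_superalgebra_simps proj_def
    by (simp add: I.quotient_smult c aff_hom(4))
  show "\<one>\<^bsub>(cyc n :: ('r, _) superalgebra)\<^esub> = proj n 1"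
    unfolding cyc_alt Aff.quotient_superalgebra_simps I.quotient_simps proj_def aff_hom(5) ..
  show "\<zero>\<^bsub>(cyc n :: ('r, _) superalgebra)\<^esub> = proj n 0"
    unfolding cyc_alt Aff.quotient_superalgebra_simps I.quotient_simps proj_def aff_hom(6)[symmetric] I.cos_zero ..
  show "grade (cyc n :: ('r, _) superalgebra) i = proj n ` grade A i"
    unfolding cyc_alt Aff.quotient_superalgebra_simps aff_hom(7) by (auto simp: proj_def)
qed

lemma proj_relation:
  assumes "(l, r) \<in> sergeev_relations n"
  shows "proj n l = (proj n r :: (_ \<Rightarrow>\<^sub>0 'r) set set)"
proof -
  have lr: "l \<in> carrier A" "r \<in> carrier A" using sergeev_relations_carrier[OF assms] by (auto simp: A_def)
  have "l - r \<in> rel_ideal n"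
    unfolding relation_ideal_def A_def[symmetric]
    using assms sergeev_relations_carrier[of _ _ n] by (intro subsetD[OF F.genideal_self]) (auto simp: A_def intro!: free_closed)
  then have "aff n l = aff n r"
    using J.cos_eq_iff[OF lr] lr by (simp add: aff_def free_minus A_def)
  then show ?thesis by (simp add: proj_def)
qed

lemma proj_xgen: "proj n (xgen 1) = (proj n 0 :: (_ \<Rightarrow>\<^sub>0 'r) set set)"
proof -
  note x = aff_xgen
  then have "aff n (xgen 1) \<in> (cyc_ideal n :: (_ \<Rightarrow>\<^sub>0 'r) set set)" unfolding cyc_ideal_def by (rule Aff.genideal_self')
  then show ?thesis using I.cos_eq_N_iff[OF x] I.cos_zero by (simp add: proj_def aff_hom(6))
qed

text \<open>The homomorphism to the model factors through the cyclotomic algebra. Its kernel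
  \<open>K\<close> contains the differences of the relations, and also \<open>xgen 1\<close>,
  because the first Jucys-Murphy element is 0. Hence the image of \<open>K\<close> in the affine
  algebra is an ideal that contains \<open>cyc_ideal\<close>. This is why the traces are well
  defined on \<open>cyc n\<close>.\<close>

lemma proj_kernel:
  assumes f: "f \<in> carrier A" "proj n f = proj n 0"
  shows "model_hom f = 0"
proof -
  define K where "K = {f \<in> carrier A. model_hom f = 0}"
  have KI: "f \<in> K" if "f \<in> carrier A" "model_hom f = 0" for f using that by (simp add: K_def)
  have KD: "f \<in> carrier A" "model_hom f = 0" if "f \<in> K" for f using that by (simp_all add: K_def)
  have KA: "K \<subseteq> carrier A" by (auto simp: K_def)
  have K_zero: "0 \<in> K" by (rule KI[OF F.zero_closed[unfolded F_ops] model_hom_linear(4)])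
  have K_add: "f + g \<in> K" if "f \<in> K" "g \<in> K" for f g
    by (rule KI[OF F.a_closed[OF KD(1)[OF that(1)] KD(1)[OF that(2)], unfolded F_ops]])
      (simp add: model_hom_linear KD(2)[OF that(1)] KD(2)[OF that(2)])
  have K_scale: "Poly_Mapping.map ((*) r) f \<in> K" if "f \<in> K" for r f
    by (rule KI[OF F.tm_smult_closed[OF KD(1)[OF that], unfolded F_ops]]) (simp add: model_hom_scale KD(2)[OF that])
  have K_mult: "f * g \<in> K" "g * f \<in> K" if "f \<in> K" "g \<in> carrier A" for f g
    by (rule KI[OF F.m_closed[OF KD(1)[OF that(1)] that(2), unfolded F_ops]], simp add: model_hom_mult KD(2)[OF that(1)])
      (rule KI[OF F.m_closed[OF that(2) KD(1)[OF that(1)], unfolded F_ops]], simp add: model_hom_mult KD(2)[OF that(1)])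
  have "additive_subgroup K A"
    by (rule F.additive_subgroup_smult) (simp_all add: F_ops KA K_zero K_add K_scale)
  then have K: "ideal K A"
    by (intro idealI[OF F.ring_axioms] additive_subgroup.a_subgroup) (simp_all add: F_ops K_mult)
  have "rel_ideal n \<subseteq> K"
    unfolding relation_ideal_def A_def[symmetric]
  proof (rule F.genideal_minimal[OF K], clarify)
    fix l r :: "_ \<Rightarrow>\<^sub>0 'r" assume lr: "(l, r) \<in> sergeev_relations n"
    show "l - r \<in> K"
      using sergeev_relations_carrier[OF lr] model_hom_relations[OF lr]
      by (intro KI) (simp_all add: A_def free_closed(3) model_hom_linear)
  qed
  define L where "L = aff n ` K"
  have "additive_subgroup L (affine_sergeev n :: ('r, _) superalgebra)"
  proof (rule Aff.additive_subgroup_smult)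
    show "\<zero>\<^bsub>affine_sergeev n\<^esub> \<in> L"
      unfolding aff_hom(6) L_def using K_zero by (rule imageI)
    fix x assume "x \<in> L"
    then obtain k where k: "k \<in> K" "x = aff n k" by (auto simp: L_def)
    then have kA: "k \<in> carrier A" using KA by auto
    show "r \<odot>\<^bsub>affine_sergeev n\<^esub> x \<in> L" for r
      unfolding k(2) aff_hom(4)[OF kA] L_def using k by (intro imageI K_scale)
    fix y assume "y \<in> L"
    then obtain l where l: "l \<in> K" "y = aff n l" by (auto simp: L_def)
    then have lA: "l \<in> carrier A" using KA by auto
    show "x \<oplus>\<^bsub>affine_sergeev n\<^esub> y \<in> L"
      unfolding k(2) l(2) aff_hom(2)[OF kA lA] L_def using k l by (intro imageI K_add)
  qed (use KA in \<open>auto simp: L_def aff_hom(1)\<close>)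
  then have L: "ideal L (affine_sergeev n :: ('r, _) superalgebra)"
  proof (intro idealI[OF Aff.ring_axioms] additive_subgroup.a_subgroup)
    fix x y assume "x \<in> L" "y \<in> carrier (affine_sergeev n :: ('r, _) superalgebra)"
    then obtain k g where k: "k \<in> K" "x = aff n k" and g: "g \<in> carrier A" "y = aff n g" by (auto simp: L_def aff_hom(1))
    then have kA: "k \<in> carrier A" using KA by auto
    show "y \<otimes>\<^bsub>affine_sergeev n\<^esub> x \<in> L"
      unfolding k(2) g(2) aff_hom(3)[OF g(1) kA] L_def using k g by (intro imageI K_mult)
    show "x \<otimes>\<^bsub>affine_sergeev n\<^esub> y \<in> L"
      unfolding k(2) g(2) aff_hom(3)[OF kA g(1)] L_def using k g by (intro imageI K_mult)
  qed
  have "cyc_ideal n \<subseteq> L"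
    unfolding cyc_ideal_def
  proof (rule Aff.genideal_minimal[OF L])
    have "model_hom (xgen 1) = (0 :: 'r sergeev_model)" by (simp add: model_hom_gen)
    then show "{aff n (xgen 1)} \<subseteq> L" using KI[OF xgen_carrier] by (simp add: L_def)
  qed
  moreover have "aff n f \<in> cyc_ideal n"
  proof -
    have "aff n f \<in> carrier (affine_sergeev n :: ('r, _) superalgebra)" using f(1) by (simp add: aff_hom(1))
    then show ?thesis using f(2) I.cos_eq_N_iff[of "aff n f"] I.cos_zero by (simp add: proj_def aff_hom(6))
  qed
  ultimately obtain k where k: "k \<in> K" "aff n f = aff n k" by (auto simp: L_def)
  \<comment> \<open>Equality in the affine algebra leaves an error in the relation ideal, and this
    ideal lies in \<open>K\<close> as well.\<close>
  then have "f - k \<in> rel_ideal n"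
    using J.cos_eq_iff[of f k] f KA by (auto simp: aff_def free_minus A_def)
  then have "f - k \<in> K" using \<open>rel_ideal n \<subseteq> K\<close> by blast
  then show ?thesis using k by (simp add: K_def model_hom_linear)
qed

end

end

section \<open>The cyclotomic quotients as one ring type\<close>

text \<open>A type cannot depend on \<open>n\<close>. The product over all \<open>n\<close> is a ring type that contains each
  quotient as an ideal with its own unit.\<close>

typedef (overloaded) 'r cyc_family =
  "{f :: nat \<Rightarrow> (sergeev_letter word \<Rightarrow>\<^sub>0 'r::comm_ring_1) set set. \<forall>k. f k \<in> carrier (cyc (Suc k))}"
proof -
  have "\<zero>\<^bsub>(cyc (Suc k) :: ('r, _) superalgebra)\<^esub> \<in> carrier (cyc (Suc k))" for k
  proof -
    interpret super_algebra "cyc (Suc k) :: ('r, _) superalgebra" by (rule cyc_super_algebra) simp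
    show ?thesis by simp
  qed
  then show ?thesis by (intro exI[of _ "\<lambda>k. \<zero>\<^bsub>cyc (Suc k)\<^esub>"]) simp
qed

setup_lifting type_definition_cyc_family

lemma cyc_Suc: "super_algebra (cyc (Suc k) :: ('r::comm_ring_1, _) superalgebra)"
  by (rule cyc_super_algebra) simp

lemma cyc_ring: "ring (cyc (Suc k) :: ('r::comm_ring_1, _) superalgebra)"
  by (rule super_algebra.axioms(1)) (rule cyc_Suc)

lemma cyc_abelian: "abelian_group (cyc (Suc k) :: ('r::comm_ring_1, _) superalgebra)"
  by (rule ring.is_abelian_group) (rule cyc_ring)

lemma cyc_distr:
  fixes x y z :: "(sergeev_letter word \<Rightarrow>\<^sub>0 'r::comm_ring_1) set set"
  assumes "x \<in> carrier (cyc (Suc k))" "y \<in> carrier (cyc (Suc k))" "z \<in> carrier (cyc (Suc k))"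
  shows "(x \<oplus>\<^bsub>cyc (Suc k)\<^esub> y) \<otimes>\<^bsub>cyc (Suc k)\<^esub> z = x \<otimes>\<^bsub>cyc (Suc k)\<^esub> z \<oplus>\<^bsub>cyc (Suc k)\<^esub> y \<otimes>\<^bsub>cyc (Suc k)\<^esub> z"
    and "x \<otimes>\<^bsub>cyc (Suc k)\<^esub> (y \<oplus>\<^bsub>cyc (Suc k)\<^esub> z) = x \<otimes>\<^bsub>cyc (Suc k)\<^esub> y \<oplus>\<^bsub>cyc (Suc k)\<^esub> x \<otimes>\<^bsub>cyc (Suc k)\<^esub> z"
    and "\<zero>\<^bsub>cyc (Suc k)\<^esub> \<otimes>\<^bsub>cyc (Suc k)\<^esub> x = \<zero>\<^bsub>cyc (Suc k)\<^esub>"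
proof -
  interpret ring "cyc (Suc k) :: ('r, _) superalgebra" by (rule cyc_ring)
  show "(x \<oplus>\<^bsub>cyc (Suc k)\<^esub> y) \<otimes>\<^bsub>cyc (Suc k)\<^esub> z = x \<otimes>\<^bsub>cyc (Suc k)\<^esub> z \<oplus>\<^bsub>cyc (Suc k)\<^esub> y \<otimes>\<^bsub>cyc (Suc k)\<^esub> z"
    by (rule l_distr) (rule assms)+
  show "x \<otimes>\<^bsub>cyc (Suc k)\<^esub> (y \<oplus>\<^bsub>cyc (Suc k)\<^esub> z) = x \<otimes>\<^bsub>cyc (Suc k)\<^esub> y \<oplus>\<^bsub>cyc (Suc k)\<^esub> x \<otimes>\<^bsub>cyc (Suc k)\<^esub> z"
    by (rule r_distr) (rule assms)+
  show "\<zero>\<^bsub>cyc (Suc k)\<^esub> \<otimes>\<^bsub>cyc (Suc k)\<^esub> x = \<zero>\<^bsub>cyc (Suc k)\<^esub>"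
    by (rule l_null) (rule assms)
qed

instantiation cyc_family :: (comm_ring_1) ring
begin

lift_definition zero_cyc_family :: "'a cyc_family" is "\<lambda>k. \<zero>\<^bsub>cyc (Suc k)\<^esub>"
  by (rule abelian_monoid.zero_closed[OF abelian_group.axioms(1)[OF cyc_abelian]])
lift_definition plus_cyc_family :: "'a cyc_family \<Rightarrow> 'a cyc_family \<Rightarrow> 'a cyc_family" is "\<lambda>f g k. f k \<oplus>\<^bsub>cyc (Suc k)\<^esub> g k"
  by (intro abelian_monoid.a_closed[OF abelian_group.axioms(1)[OF cyc_abelian]]) auto
lift_definition uminus_cyc_family :: "'a cyc_family \<Rightarrow> 'a cyc_family" is "\<lambda>f k. \<ominus>\<^bsub>cyc (Suc k)\<^esub> f k"
  by (intro abelian_group.a_inv_closed[OF cyc_abelian]) auto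
lift_definition minus_cyc_family :: "'a cyc_family \<Rightarrow> 'a cyc_family \<Rightarrow> 'a cyc_family" is "\<lambda>f g k. f k \<ominus>\<^bsub>cyc (Suc k)\<^esub> g k"
  by (intro abelian_group.minus_closed[OF cyc_abelian]) auto
lift_definition times_cyc_family :: "'a cyc_family \<Rightarrow> 'a cyc_family \<Rightarrow> 'a cyc_family" is "\<lambda>f g k. f k \<otimes>\<^bsub>cyc (Suc k)\<^esub> g k"
  by (intro monoid.m_closed[OF ring.is_monoid[OF cyc_ring]]) auto

instance
proof
  fix x y z :: "'a cyc_family"
  note ab = abelian_group.axioms(1)[OF cyc_abelian]
  show "x * y * z = x * (y * z)"
    by transfer (rule ext, rule monoid.m_assoc[OF ring.is_monoid[OF cyc_ring]]; simp)
  show "x + y + z = x + (y + z)" by transfer (rule ext, rule abelian_monoid.a_assoc[OF ab]; simp)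
  show "x + y = y + x" by transfer (rule ext, rule abelian_monoid.a_comm[OF ab]; simp)
  show "0 + x = x" by transfer (rule ext, rule abelian_monoid.l_zero[OF ab]; simp)
  show "- x + x = 0" by transfer (rule ext, rule abelian_group.l_neg[OF cyc_abelian]; simp)
  show "x - y = x + - y" by transfer (simp add: a_minus_def)
  show "(x + y) * z = x * z + y * z" by transfer (rule ext, rule cyc_distr(1); simp)
  show "x * (y + z) = x * y + x * z" by transfer (rule ext, rule cyc_distr(2); simp)
qed

end

text \<open>The factor with index \<open>k\<close> is the algebra for \<open>Suc k\<close>, so the
  family starts at 1. Elements outside the carrier go to zero, which keeps the map total.\<close>

lift_definition cyc_embed :: "nat \<Rightarrow> (sergeev_letter word \<Rightarrow>\<^sub>0 'r::comm_ring_1) set set \<Rightarrow> 'r cyc_family" is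
  "\<lambda>n a k. if Suc k = n \<and> a \<in> carrier (cyc n) then a else \<zero>\<^bsub>cyc (Suc k)\<^esub>"
  by (auto intro: abelian_monoid.zero_closed[OF abelian_group.axioms(1)[OF cyc_abelian]])

context
  fixes n :: nat and A :: "('r::comm_ring_1, (sergeev_letter word \<Rightarrow>\<^sub>0 'r) set set) superalgebra" (structure)
  assumes n: "1 \<le> n"
  defines "A \<equiv> cyc n"
begin

interpretation super_algebra A unfolding A_def by (rule cyc_super_algebra) (rule n)

lemma cyc_embed_eq:
  "cyc_embed n a = x \<longleftrightarrow> (\<forall>k. (if Suc k = n \<and> a \<in> carrier A then a else \<zero>\<^bsub>cyc (Suc k)\<^esub>) = Rep_cyc_family x k)"
  by (simp add: A_def Rep_cyc_family_inject[symmetric] cyc_embed.rep_eq fun_eq_iff)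

text \<open>The embedding respects sums and products, while the unit of \<open>cyc n\<close> becomes
  an idempotent of the product ring; this is the \<open>e\<close> of
  \<open>sergeev_words\<close>.\<close>

lemma cyc_embed_hom:
  assumes "a \<in> carrier A" "b \<in> carrier A"
  shows "cyc_embed n (a \<oplus> b) = cyc_embed n a + cyc_embed n b"
    and "cyc_embed n (a \<otimes> b) = cyc_embed n a * cyc_embed n b"
    and "cyc_embed n (\<ominus> a) = - cyc_embed n a"
    and "cyc_embed n (a \<ominus> b) = cyc_embed n a - cyc_embed n b"
proof -
  note ab = abelian_group.axioms(1)[OF cyc_abelian]
  \<comment> \<open>In every other factor both sides are built from zeros; these facts evaluate
    them.\<close>
  have z: "\<zero>\<^bsub>cyc (Suc k)\<^esub> \<in> carrier (cyc (Suc k) :: ('r, _) superalgebra)" for k by (rule abelian_monoid.zero_closed[OF ab])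
  have zz: "\<zero>\<^bsub>cyc (Suc k)\<^esub> \<oplus>\<^bsub>cyc (Suc k)\<^esub> \<zero>\<^bsub>cyc (Suc k)\<^esub> = (\<zero>\<^bsub>cyc (Suc k)\<^esub> :: (_ \<Rightarrow>\<^sub>0 'r) set set)" for k
    by (rule abelian_monoid.l_zero[OF ab z])
  have nz: "\<ominus>\<^bsub>cyc (Suc k)\<^esub> \<zero>\<^bsub>cyc (Suc k)\<^esub> = (\<zero>\<^bsub>cyc (Suc k)\<^esub> :: (_ \<Rightarrow>\<^sub>0 'r) set set)" for k
    by (rule abelian_group.minus_equality[OF cyc_abelian zz z z])
  have mz: "\<zero>\<^bsub>cyc (Suc k)\<^esub> \<otimes>\<^bsub>cyc (Suc k)\<^esub> \<zero>\<^bsub>cyc (Suc k)\<^esub> = (\<zero>\<^bsub>cyc (Suc k)\<^esub> :: (_ \<Rightarrow>\<^sub>0 'r) set set)" for k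
    by (rule cyc_distr(3)[OF z z z])
  show p: "cyc_embed n (a \<oplus> b) = cyc_embed n a + cyc_embed n b"
    using assms by (auto simp: cyc_embed_eq plus_cyc_family.rep_eq cyc_embed.rep_eq A_def[symmetric] zz)
  show "cyc_embed n (a \<otimes> b) = cyc_embed n a * cyc_embed n b"
    using assms by (auto simp: cyc_embed_eq times_cyc_family.rep_eq cyc_embed.rep_eq A_def[symmetric] mz)
  show "cyc_embed n (\<ominus> a) = - cyc_embed n a"
    using assms by (auto simp: cyc_embed_eq uminus_cyc_family.rep_eq cyc_embed.rep_eq A_def[symmetric] nz)
  show "cyc_embed n (a \<ominus> b) = cyc_embed n a - cyc_embed n b"
    using assms by (auto simp: cyc_embed_eq minus_cyc_family.rep_eq cyc_embed.rep_eq A_def[symmetric] zz nz a_minus_def)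
qed

lemma cyc_embed_zero: "cyc_embed n \<zero> = 0"
  by (auto simp: cyc_embed_eq zero_cyc_family.rep_eq A_def)

lemma cyc_embed_inject:
  assumes "a \<in> carrier A" "b \<in> carrier A" "cyc_embed n a = cyc_embed n b"
  shows "a = b"
proof -
  obtain k where k: "n = Suc k" using n by (cases n) auto
  have "Rep_cyc_family (cyc_embed n x) k = x" if "x \<in> carrier A" for x
    using that unfolding cyc_embed.rep_eq A_def by (simp only: k simp_thms if_True)
  then have "Rep_cyc_family (cyc_embed n a) k = a" "Rep_cyc_family (cyc_embed n b) k = b"
    using assms(1,2) by blast+
  then show ?thesis unfolding assms(3) by (rule trans[OF sym])
qed

end

section \<open>Even supercocenters\<close>

context type_module
begin

lemma lin_span_minimal:
  assumes "V \<subseteq> K" "K \<subseteq> carrier M" "\<zero> \<in> K" "\<And>x y. x \<in> K \<Longrightarrow> y \<in> K \<Longrightarrow> x \<oplus> y \<in> K"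
    and "\<And>r x. x \<in> K \<Longrightarrow> (r :: 'r) \<odot> x \<in> K"
  shows "lin_span M V \<subseteq> K"
proof
  fix x assume "x \<in> lin_span M V"
  then obtain f where f: "x = lin_comb M f" "Poly_Mapping.keys f \<subseteq> V" by (auto simp: lin_span_def)
  have "(\<Oplus>b\<in>B. Poly_Mapping.lookup f b \<odot> b) \<in> K" if "finite B" "B \<subseteq> V" for B
    using that
  proof (induction B)
    case (insert b B)
    then have "(\<lambda>b. Poly_Mapping.lookup f b \<odot> b) \<in> B \<rightarrow> carrier M" "b \<in> K" "b \<in> carrier M" using assms(1,2) by auto
    with insert show ?case using assms(4,5) by (subst finsum_insert) auto
  qed (simp add: assms(3))
  then show "x \<in> K" using f by (simp add: lin_comb_def)
qed

end

section \<open>Elements spanned by a finite family modulo a submodule\<close>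

context type_submodule
begin

definition spanned :: "'i set \<Rightarrow> ('i \<Rightarrow> 'b) \<Rightarrow> 'b \<Rightarrow> bool" where
  "spanned \<Lambda> y x \<longleftrightarrow> x \<in> carrier M \<and> (\<exists>k. x \<ominus> (\<Oplus>i\<in>\<Lambda>. (k i :: 'r) \<odot> y i) \<in> N)"

context
  fixes \<Lambda> :: "'i set" and y :: "'i \<Rightarrow> 'b"
  assumes fin: "finite \<Lambda>" and y: "y \<in> \<Lambda> \<rightarrow> carrier M"
begin

lemma y_mem: "i \<in> \<Lambda> \<Longrightarrow> y i \<in> carrier M"
  using y by auto

lemma comb_closed: "(\<Oplus>i\<in>\<Lambda>. (k i :: 'r) \<odot> y i) \<in> carrier M"
  using y by (intro finsum_closed) auto

lemma spanned_N: "x \<in> N \<Longrightarrow> spanned \<Lambda> y x"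
proof -
  assume x: "x \<in> N"
  then have xM: "x \<in> carrier M" using N_sub by auto
  have "(\<Oplus>i\<in>\<Lambda>. (0 :: 'r) \<odot> y i) = \<zero>"
    using y by (intro add.finprod_one_eqI) (auto simp: tm_smult_zero y_mem)
  then have "x \<ominus> (\<Oplus>i\<in>\<Lambda>. (0 :: 'r) \<odot> y i) = x" using xM by (simp add: a_minus_def)
  then show ?thesis unfolding spanned_def using x xM by (intro conjI exI[of _ "\<lambda>_. 0"]) simp_all
qed

lemma spanned_gen:
  assumes "j \<in> \<Lambda>"
  shows "spanned \<Lambda> y (y j)"
proof -
  have yj: "y j \<in> carrier M" using y assms by auto
  have "(\<Oplus>i\<in>\<Lambda>. (if j = i then 1 else 0 :: 'r) \<odot> y i) = (\<Oplus>i\<in>\<Lambda>. if j = i then y i else \<zero>)"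
    using y by (intro finsum_cong') (auto simp: tm_smult_zero tm_smult_one y_mem)
  also have "\<dots> = y j" using assms fin y by (rule add.finprod_singleton)
  finally have "y j \<ominus> (\<Oplus>i\<in>\<Lambda>. (if j = i then 1 else 0 :: 'r) \<odot> y i) = \<zero>"
    using yj by (simp add: a_minus_def r_neg)
  then show ?thesis unfolding spanned_def using yj N_0 by (intro conjI exI[of _ "\<lambda>i. if j = i then 1 else 0"]) simp_all
qed

lemma spanned_add:
  assumes "spanned \<Lambda> y x" "spanned \<Lambda> y x'"
  shows "spanned \<Lambda> y (x \<oplus> x')"
proof -
  obtain k k' :: "'i \<Rightarrow> 'r" where k: "x \<ominus> (\<Oplus>i\<in>\<Lambda>. k i \<odot> y i) \<in> N" "x' \<ominus> (\<Oplus>i\<in>\<Lambda>. k' i \<odot> y i) \<in> N"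
    and x: "x \<in> carrier M" "x' \<in> carrier M" using assms by (auto simp: spanned_def)
  have "(\<Oplus>i\<in>\<Lambda>. (k i + k' i) \<odot> y i) = (\<Oplus>i\<in>\<Lambda>. k i \<odot> y i \<oplus> k' i \<odot> y i)"
    using y by (intro finsum_cong') (auto simp: tm_smult_l_distr y_mem)
  also have "\<dots> = (\<Oplus>i\<in>\<Lambda>. k i \<odot> y i) \<oplus> (\<Oplus>i\<in>\<Lambda>. k' i \<odot> y i)" using y by (intro finsum_addf) auto
  finally have "x \<oplus> x' \<ominus> (\<Oplus>i\<in>\<Lambda>. (k i + k' i) \<odot> y i) =
      (x \<ominus> (\<Oplus>i\<in>\<Lambda>. k i \<odot> y i)) \<oplus> (x' \<ominus> (\<Oplus>i\<in>\<Lambda>. k' i \<odot> y i))"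
    using x comb_closed[of k] comb_closed[of k'] by (simp add: a_minus_def minus_add a_ac)
  then show ?thesis unfolding spanned_def using x N_plus[OF k] by (intro conjI exI[of _ "\<lambda>i. k i + k' i"]) simp_all
qed

lemma spanned_smult:
  assumes "spanned \<Lambda> y x"
  shows "spanned \<Lambda> y ((r :: 'r) \<odot> x)"
proof -
  obtain k :: "'i \<Rightarrow> 'r" where k: "x \<ominus> (\<Oplus>i\<in>\<Lambda>. k i \<odot> y i) \<in> N" and x: "x \<in> carrier M"
    using assms by (auto simp: spanned_def)
  let ?S = "\<Oplus>i\<in>\<Lambda>. k i \<odot> y i"
  have "(\<Oplus>i\<in>\<Lambda>. (r * k i) \<odot> y i) = (\<Oplus>i\<in>\<Lambda>. r \<odot> (k i \<odot> y i))"
    using y by (intro finsum_cong') (auto simp: tm_smult_assoc y_mem)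
  also have "\<dots> = r \<odot> ?S" using y fin by (intro tm_smult_finsum[symmetric]) auto
  finally have "r \<odot> x \<ominus> (\<Oplus>i\<in>\<Lambda>. (r * k i) \<odot> y i) = r \<odot> x \<ominus> r \<odot> ?S" by simp
  also have "\<dots> = r \<odot> (x \<ominus> ?S)"
  proof -
    have "\<ominus> (r \<odot> ?S) = r \<odot> (\<ominus> ?S)"
      using comb_closed[of k] tm_smult_assoc[of ?S r "- 1"] tm_smult_assoc[of ?S "- 1" r]
      by (simp add: tm_smult_minus_one)
    then show ?thesis using x comb_closed[of k] by (simp add: a_minus_def tm_smult_r_distr)
  qed
  finally show ?thesis unfolding spanned_def using x N_smult[OF k, of r]
    by (intro conjI exI[of _ "\<lambda>i. r * k i"]) simp_all
qed

end

end

section \<open>Homogeneous components and the supercommutator span\<close>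

context super_algebra
begin

lemma even_part_module: "type_module (A\<lparr>carrier := grade A i\<rparr>)"
proof (intro type_moduleI moduleI[OF cring_ring_of_type_algebra])
  have g: "x \<in> carrier A" if "x \<in> grade A i" for x using grade_sub that by auto
  show "abelian_group (A\<lparr>carrier := grade A i\<rparr>)"
  proof (rule abelian_groupI)
    fix x assume "x \<in> carrier (A\<lparr>carrier := grade A i\<rparr>)"
    then have x: "x \<in> grade A i" by simp
    have "(- 1) \<odot> x \<oplus> x = \<zero>" using g[OF x] by (simp add: tm_smult_minus_one l_neg)
    then show "\<exists>y\<in>carrier (A\<lparr>carrier := grade A i\<rparr>). y \<oplus>\<^bsub>A\<lparr>carrier := grade A i\<rparr>\<^esub> x = \<zero>\<^bsub>A\<lparr>carrier := grade A i\<rparr>\<^esub>"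
      using grade_smult[OF x, of "- 1"] by (intro bexI[of _ "(- 1) \<odot> x"]) simp_all
  qed (auto simp: grade_add grade_zero g a_ac)
qed (use grade_sub in \<open>auto simp: grade_smult tm_smult_l_distr tm_smult_r_distr tm_smult_assoc tm_smult_one subset_iff\<close>)

lemma supercommutators_carrier: "supercommutators A \<subseteq> carrier A"
  using grade_sub by (auto simp: supercommutators_def subset_iff)

lemma supercommutator_span_closed:
  "supercommutator_span A \<subseteq> carrier A" "\<zero> \<in> supercommutator_span A" "supercommutators A \<subseteq> supercommutator_span A"
  "x \<in> supercommutator_span A \<Longrightarrow> y \<in> supercommutator_span A \<Longrightarrow> x \<oplus> y \<in> supercommutator_span A"
  "x \<in> supercommutator_span A \<Longrightarrow> r \<odot> x \<in> supercommutator_span A"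
  using lin_span_closed[OF supercommutators_carrier] unfolding supercommutator_span_def by blast+

lemma supercommutator_submodule:
  "type_submodule (A\<lparr>carrier := grade A i\<rparr>) (supercommutator_span A \<inter> grade A i)"
proof -
  interpret M: type_module "A\<lparr>carrier := grade A i\<rparr>" by (rule even_part_module)
  show ?thesis
    by unfold_locales (auto simp: supercommutator_span_closed grade_add grade_zero grade_smult)
qed

end

section \<open>The even supercocenter of the cyclotomic algebra\<close>

lemma free_grade_mult:
  assumes "f \<in> grade (free_superalgebra G p) i" "g \<in> grade (free_superalgebra G p) j"
  shows "f * g \<in> grade (free_superalgebra G p :: ('r::comm_ring_1, _) superalgebra) (i + j)"
proof -
  have "set (letters w) \<subseteq> G \<and> word_parity p w = i + j" if "w \<in> Poly_Mapping.keys (f * g)" for w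
  proof -
    obtain u v where "w = u + v" "u \<in> Poly_Mapping.keys f" "v \<in> Poly_Mapping.keys g"
      using \<open>w \<in> _\<close> keys_mult[of f g] by auto
    then show ?thesis using assms by (auto simp: free_superalgebra_simps letters_plus word_parity_def)
  qed
  then show ?thesis by (simp add: free_superalgebra_simps)
qed

lemma free_grade_gen: "a \<in> G \<Longrightarrow> gen a \<in> grade (free_superalgebra G p) (p a)"
  by (simp add: gen_def free_superalgebra_simps word_parity_def)

lemma free_grade_one: "1 \<in> grade (free_superalgebra G p) 0"
  by (auto simp: free_superalgebra_simps zero_word_def word_parity_def)

lemma free_grade_uminus: "f \<in> grade (free_superalgebra G p) i \<Longrightarrow> - f \<in> grade (free_superalgebra G p) i"
  by (auto simp: free_superalgebra_simps in_keys_iff)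

lemma free_grade_carrier: "f \<in> grade (free_superalgebra G p) i \<Longrightarrow> f \<in> carrier (free_superalgebra G p)"
  by (auto simp: free_superalgebra_simps)

lemma single_Word_Cons: "Poly_Mapping.single (Word (a # u)) 1 = gen a * (Poly_Mapping.single (Word u) 1 :: _ \<Rightarrow>\<^sub>0 'r::comm_ring_1)"
  by (simp add: gen_def mult_single plus_word_def)

lemma single_Word_Nil: "Poly_Mapping.single (Word []) 1 = (1 :: _ \<Rightarrow>\<^sub>0 'r::comm_ring_1)"
  by (simp add: single_one[symmetric] zero_word_def del: single_one)

lemma word_carrier: "set u \<subseteq> G \<Longrightarrow> Poly_Mapping.single (Word u) r \<in> carrier (free_superalgebra G p)"
  by (auto simp: free_superalgebra_simps)

definition cyc_rep :: "nat \<Rightarrow> (sergeev_letter word \<Rightarrow>\<^sub>0 'r::comm_ring_1) \<Rightarrow> 'r cyc_family" where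
  "cyc_rep n f = cyc_embed n (proj n f)"

lemma sorted_wrt_greater_distinct: "sorted_wrt (>) ks \<Longrightarrow> distinct (ks :: 'a::linorder list)"
  by (induction ks) auto

lemma sorted_wrt_greater_unique:
  assumes "sorted_wrt (>) ks" "sorted_wrt (>) ls" "set ks = set (ls :: 'a::linorder list)"
  shows "ks = ls"
  using assms strict_sorted_equal[of "rev ks" "rev ls"] by (simp add: sorted_wrt_rev)

text \<open>A strict partition is determined by its set of parts, a subset of
  \<open>{..n}\<close>.\<close>

lemma finite_even_strict_partitions: "finite (even_strict_partitions n)"
proof (rule inj_on_finite)
  show "inj_on set (even_strict_partitions n)"
    by (rule inj_onI) (auto simp: even_strict_partitions_def strict_partitions_def intro: sorted_wrt_greater_unique)
  show "set ` even_strict_partitions n \<subseteq> Pow {..n}"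
    using member_le_sum_list by (fastforce simp: even_strict_partitions_def strict_partitions_def)
qed simp

lemma word_parity_block_word: "word_parity sergeev_parity (Word (block_word m ks)) = of_bool (odd (length ks))"
proof (induction ks arbitrary: m)
  case (Cons k ks)
  have "(\<Sum>u\<leftarrow>map Sg xs. sergeev_parity u) = 0" for xs by (induction xs) simp_all
  then show ?case using Cons.IH[of "m + k"] by (cases "odd (length ks)") (simp_all add: word_parity_def)
qed (simp add: word_parity_def)

section \<open>Words of the cyclotomic algebra in the ring type\<close>

context
  fixes n :: nat and F :: "('r::comm_ring_1, sergeev_letter word \<Rightarrow>\<^sub>0 'r) superalgebra"
    and A :: "('r, (sergeev_letter word \<Rightarrow>\<^sub>0 'r) set set) superalgebra" (structure)
  assumes n: "1 \<le> n"
  defines "F \<equiv> free_sergeev n" and "A \<equiv> cyc n"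
begin

interpretation super_algebra A unfolding A_def by (rule cyc_super_algebra) (rule n)

lemma A_hom:
  "carrier A = proj n ` carrier F"
  "\<And>f g. f \<in> carrier F \<Longrightarrow> g \<in> carrier F \<Longrightarrow> proj n f \<oplus> proj n g = proj n (f + g)"
  "\<And>f g. f \<in> carrier F \<Longrightarrow> g \<in> carrier F \<Longrightarrow> proj n f \<otimes> proj n g = proj n (f * g)"
  "\<And>r f. f \<in> carrier F \<Longrightarrow> r \<odot> proj n f = proj n (Poly_Mapping.map ((*) r) f)"
  "\<one> = proj n 1" "\<zero> = proj n 0" "grade A i = proj n ` grade F i"
  unfolding A_def F_def by (rule proj_hom[OF n]; assumption?)+

lemma F_closed:
  assumes "f \<in> carrier F" "g \<in> carrier F"
  shows "f * g \<in> carrier F" "f + g \<in> carrier F" "f - g \<in> carrier F" "- f \<in> carrier F"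
  using assms unfolding F_def by (rule free_closed)+

lemma embed_hom:
  assumes "a \<in> carrier A" "b \<in> carrier A"
  shows "cyc_embed n (a \<oplus> b) = cyc_embed n a + cyc_embed n b"
    and "cyc_embed n (a \<otimes> b) = cyc_embed n a * cyc_embed n b"
    and "cyc_embed n (\<ominus> a) = - cyc_embed n a"
    and "cyc_embed n (a \<ominus> b) = cyc_embed n a - cyc_embed n b"
  using assms unfolding A_def by (rule cyc_embed_hom[OF n])+

lemma embed_zero: "cyc_embed n \<zero> = (0 :: 'r cyc_family)"
  unfolding A_def using n by (rule cyc_embed_zero)

lemma embed_inject: "a \<in> carrier A \<Longrightarrow> b \<in> carrier A \<Longrightarrow> cyc_embed n a = cyc_embed n b \<Longrightarrow> a = b"
  unfolding A_def by (rule cyc_embed_inject[OF n])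

lemma proj_carrier: "f \<in> carrier F \<Longrightarrow> proj n f \<in> carrier A"
  by (simp add: A_hom)

lemma rep_add: "f \<in> carrier F \<Longrightarrow> g \<in> carrier F \<Longrightarrow> cyc_rep n (f + g) = cyc_rep n f + cyc_rep n g"
  unfolding cyc_rep_def by (simp add: A_hom(2)[symmetric] embed_hom proj_carrier)

lemma rep_mult: "f \<in> carrier F \<Longrightarrow> g \<in> carrier F \<Longrightarrow> cyc_rep n (f * g) = cyc_rep n f * cyc_rep n g"
  unfolding cyc_rep_def by (simp add: A_hom(3)[symmetric] embed_hom proj_carrier)

lemma rep_zero: "cyc_rep n 0 = (0 :: 'r cyc_family)"
  unfolding cyc_rep_def A_hom(6)[symmetric] by (rule embed_zero)

lemma rep_diff: "f \<in> carrier F \<Longrightarrow> g \<in> carrier F \<Longrightarrow> cyc_rep n (f - g) = cyc_rep n f - cyc_rep n g"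
  using rep_add[of "f - g" g] by (simp add: F_closed(3))

lemma rep_uminus: "f \<in> carrier F \<Longrightarrow> cyc_rep n (- f) = - cyc_rep n f"
  using rep_diff[of 0 f] by (simp add: F_closed rep_zero F_def free_superalgebra_simps)

lemma rep_relation: "(l, r) \<in> sergeev_relations n \<Longrightarrow> cyc_rep n l = (cyc_rep n r :: 'r cyc_family)"
  unfolding cyc_rep_def by (rule arg_cong, rule proj_relation[OF n])

lemma gen_in: "1 \<in> carrier F" "i \<in> {1..<n} \<Longrightarrow> sgen i \<in> carrier F" "i \<in> {1..n} \<Longrightarrow> cgen i \<in> carrier F"
  "i \<in> {1..n} \<Longrightarrow> xgen i \<in> carrier F"
  unfolding F_def by (auto intro!: free_one gen_carrier simp: sergeev_letters_def)

interpretation W: sergeev_words n "cyc_rep n 1 :: 'r cyc_family" "\<lambda>i. cyc_rep n (sgen i)" "\<lambda>i. cyc_rep n (cgen i)"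
proof
  fix i j :: nat
  note [simp] = rep_mult[symmetric] rep_uminus[symmetric] F_closed gen_in
  let ?s = "\<lambda>i. cyc_rep n (sgen i) :: 'r cyc_family" and ?c = "\<lambda>i. cyc_rep n (cgen i) :: 'r cyc_family"
    and ?e = "cyc_rep n 1 :: 'r cyc_family"
  show "?e * ?e = ?e" by simp
  show "?s i * ?c j = ?c j * ?s i" if "i \<in> {1..<n}" "j \<in> {1..n}" "j \<noteq> i" "j \<noteq> i + 1"
    using that by (simp add: rep_relation[OF sergeev_relations.sc_comm])
  {
    assume i: "i \<in> {1..n}"
    show "?e * ?c i = ?c i" "?c i * ?e = ?c i" using i by simp_all
    show "?c i * ?c i = ?e" using i by (simp add: rep_relation[OF sergeev_relations.cc_sq])
    assume j: "j \<in> {1..n}" "i \<noteq> j"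
    have "cyc_rep n (cgen i * cgen j) = (cyc_rep n (- (cgen j * cgen i)) :: 'r cyc_family)"
      by (rule rep_relation) (rule sergeev_relations.cc_anticomm[OF i j])
    then show "?c i * ?c j = - (?c j * ?c i)" using i j by simp
  }
  {
    assume i: "i \<in> {1..<n}"
    then have i': "i \<in> {1..n}" "i + 1 \<in> {1..n}" by auto
    show "?e * ?s i = ?s i" "?s i * ?e = ?s i" using i by simp_all
    show "?s i * ?s i = ?e" using i by (simp add: rep_relation[OF sergeev_relations.ss_sq])
    show "?s i * ?c i = ?c (i + 1) * ?s i"
      using rep_relation[OF sergeev_relations.sc[OF i]] rep_mult[OF gen_in(2)[OF i] gen_in(3)[OF i'(1)]]
        rep_mult[OF gen_in(3)[OF i'(2)] gen_in(2)[OF i]] by (simp del: rep_mult[symmetric])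
    show "?s i * ?c (i + 1) = ?c i * ?s i"
      using rep_relation[OF sergeev_relations.sc'[OF i]] rep_mult[OF gen_in(2)[OF i] gen_in(3)[OF i'(2)]]
        rep_mult[OF gen_in(3)[OF i'(1)] gen_in(2)[OF i]] by (simp del: rep_mult[symmetric])
    assume "j \<in> {1..<n}" "i + 1 < j \<or> j + 1 < i"
    note j = this
    have "cyc_rep n (sgen i * sgen j) = (cyc_rep n (sgen j * sgen i) :: 'r cyc_family)"
      by (rule rep_relation) (rule sergeev_relations.ss_comm[OF i j])
    then show "?s i * ?s j = ?s j * ?s i" using i j by simp
  }
  assume i: "i \<in> {1..<n}" "i + 1 \<in> {1..<n}"
  have "cyc_rep n (sgen i * sgen (i + 1) * sgen i) = (cyc_rep n (sgen (i + 1) * sgen i * sgen (i + 1)) :: 'r cyc_family)"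
    by (rule rep_relation) (rule sergeev_relations.ss_braid[OF i])
  then show "?s i * ?s (i + 1) * ?s i = ?s (i + 1) * ?s i * ?s (i + 1)" using i by simp
qed

text \<open>Supercommutators are defined for homogeneous elements of the algebra, so each word in
  the ring type needs a homogeneous polynomial above it, of the right parity.\<close>

lemma mon_rep:
  "W.mon 1 n p x \<Longrightarrow> \<exists>f\<in>grade F (of_bool p). x = cyc_rep n f"
proof (induction rule: W.mon.induct)
  case mon_e
  show ?case by (intro bexI[of _ 1]) (auto simp: F_def free_grade_one)
next
  case (mon_neg p x)
  then obtain f where f: "f \<in> grade F (of_bool p)" "x = cyc_rep n f" by blast
  then have "- f \<in> grade F (of_bool p)" "f \<in> carrier F" unfolding F_def
    by (auto intro: free_grade_uminus free_grade_carrier)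
  then show ?case using f rep_uminus by metis
next
  case (mon_s p x i)
  then obtain f where f: "f \<in> grade F (of_bool p)" "x = cyc_rep n f" by blast
  have i: "Sg i \<in> sergeev_letters n" using mon_s by (auto simp: sergeev_letters_def)
  have "f * sgen i \<in> grade F (of_bool p)"
    using free_grade_mult[OF f(1)[unfolded F_def] free_grade_gen[OF i]] by (simp add: F_def)
  moreover have "cyc_rep n (f * sgen i) = x * cyc_rep n (sgen i)"
    using f i unfolding F_def f(2) by (intro rep_mult) (auto simp: F_def intro: free_grade_carrier gen_carrier)
  ultimately show ?case by metis
next
  case (mon_c p x i)
  then obtain f where f: "f \<in> grade F (of_bool p)" "x = cyc_rep n f" by blast
  have i: "Cg i \<in> sergeev_letters n" using mon_c by (auto simp: sergeev_letters_def)
  have "f * cgen i \<in> grade F (of_bool (\<not> p))"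
    using free_grade_mult[OF f(1)[unfolded F_def] free_grade_gen[OF i]] by (cases p) (simp_all add: F_def)
  moreover have "cyc_rep n (f * cgen i) = x * cyc_rep n (cgen i)"
    using f i unfolding F_def f(2) by (intro rep_mult) (auto simp: F_def intro: free_grade_carrier gen_carrier)
  ultimately show ?case by metis
qed

text \<open>\<open>x\<^sub>1\<close> vanishes and \<open>x\<^bsub>i+1\<^esub> = s\<^sub>i x\<^sub>i s\<^sub>i + s\<^sub>i + c\<^sub>i c\<^bsub>i+1\<^esub> s\<^sub>i\<close>, so that every word is a sum of
  signed words without the letters \<open>x\<^sub>i\<close>.\<close>

inductive amon :: "bool \<Rightarrow> 'r cyc_family \<Rightarrow> bool" where
  zero: "amon p 0"
| add: "W.mon 1 n p x \<Longrightarrow> amon p y \<Longrightarrow> amon p (x + y)"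

lemma amon_mon: "W.mon 1 n p x \<Longrightarrow> amon p x"
  using amon.add[OF _ amon.zero] by fastforce

lemma amon_add: "amon p x \<Longrightarrow> amon p y \<Longrightarrow> amon p (x + y)"
  by (induction rule: amon.induct) (auto simp: add.assoc intro: amon.intros)

lemma amon_mon_mult: "amon q y \<Longrightarrow> W.mon 1 n p x \<Longrightarrow> amon (p \<noteq> q) (x * y)"
proof (induction rule: amon.induct)
  case (add q x' y)
  then show ?case using W.mon_mult[of 1 n q x' p x] by (simp add: distrib_left amon.add)
qed (simp add: amon.zero)

lemma amon_mult: "amon p x \<Longrightarrow> amon q y \<Longrightarrow> amon (p \<noteq> q) (x * y)"
proof (induction rule: amon.induct)
  case (add p x x')
  then show ?case using amon_mon_mult[of q y p x] by (simp add: distrib_right amon_add)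
qed (auto intro: amon.zero)

lemma amon_xgen: "i \<in> {1..n} \<Longrightarrow> amon False (cyc_rep n (xgen i))"
proof (induction i)
  case (Suc i)
  show ?case
  proof (cases "i = 0")
    case True
    have "cyc_rep n (xgen 1) = (0 :: 'r cyc_family)"
      unfolding cyc_rep_def proj_xgen[OF n] by (rule rep_zero[unfolded cyc_rep_def])
    then show ?thesis using True amon.zero by simp
  next
    case False
    then have i: "i \<in> {1..<n}" "i \<in> {1..n}" "Suc i \<in> {1..n}" using Suc.prems by auto
    let ?s = "cyc_rep n (sgen i) :: 'r cyc_family" and ?x = "cyc_rep n (xgen i) :: 'r cyc_family"
      and ?x' = "cyc_rep n (xgen (Suc i)) :: 'r cyc_family" and ?e = "cyc_rep n 1 :: 'r cyc_family"
      and ?c = "cyc_rep n (cgen i) :: 'r cyc_family" and ?c' = "cyc_rep n (cgen (Suc i)) :: 'r cyc_family"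
    note gi = gen_in(1) gen_in(2)[OF i(1)] gen_in(3)[OF i(2)] gen_in(3)[OF i(3)] gen_in(4)[OF i(2)] gen_in(4)[OF i(3)]
    have "?s * ?x = ?x' * ?s - (?e + ?c * ?c')"
      using rep_relation[OF sergeev_relations.sx[OF i(1)]] gi
      by (simp add: rep_mult rep_diff rep_add F_closed)
    then have "?x' * ?s = ?s * ?x + ?e + ?c * ?c'" by (simp add: algebra_simps)
    then have "?x' * (?s * ?s) = (?s * ?x + ?e + ?c * ?c') * ?s" by (simp add: mult.assoc[symmetric])
    moreover have "?x' * ?e = ?x'" using gi by (simp add: rep_mult[symmetric])
    ultimately have eq: "?x' = ?s * ?x * ?s + ?e * ?s + ?c * ?c' * ?s"
      using W.s_s[OF i(1)] by (simp add: distrib_right)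
    have s: "amon False ?s" and c: "amon True ?c" and c': "amon True ?c'" and e: "amon False ?e"
      using i n by (auto intro!: amon_mon W.mon_single_s W.mon_single_c W.mon_e)
    have x: "amon False ?x" using Suc.IH i by simp
    show ?thesis
      unfolding eq using amon_mult[OF amon_mult[OF s x] s] amon_mult[OF e s] amon_mult[OF amon_mult[OF c c'] s]
      by (intro amon_add) simp_all
  qed
qed simp

lemma amon_word:
  "set u \<subseteq> sergeev_letters n \<Longrightarrow> amon (word_parity sergeev_parity (Word u) = 1) (cyc_rep n (Poly_Mapping.single (Word u) 1))"
proof (induction u)
  case Nil
  then show ?case by (simp add: single_Word_Nil word_parity_def amon_mon W.mon_e)
next
  case (Cons a u)
  have a: "amon (sergeev_parity a = 1) (cyc_rep n (gen a))"
  proof (cases a)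
    case (Sg i)
    then show ?thesis using Cons.prems by (auto simp: sergeev_letters_def intro!: amon_mon W.mon_single_s)
  next
    case (Xg i)
    then show ?thesis using Cons.prems amon_xgen[of i] by (auto simp: sergeev_letters_def)
  next
    case (Cg i)
    then show ?thesis using Cons.prems by (auto simp: sergeev_letters_def intro!: amon_mon W.mon_single_c)
  qed
  have "cyc_rep n (Poly_Mapping.single (Word (a # u)) 1) = cyc_rep n (gen a) * (cyc_rep n (Poly_Mapping.single (Word u) 1) :: 'r cyc_family)"
    unfolding single_Word_Cons using Cons.prems by (intro rep_mult) (auto simp: F_def intro!: gen_carrier word_carrier)
  moreover have "word_parity sergeev_parity (Word (a # u)) = sergeev_parity a + word_parity sergeev_parity (Word u)"
    by (simp add: word_parity_def)
  moreover have "(x + y = 1) = ((x = 1) \<noteq> (y = 1))" for x y :: bit by (cases x; cases y) simp_all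
  ultimately show ?case using amon_mult[OF a Cons.IH] Cons.prems by simp
qed

lemma rep_chain:
  "1 \<le> m \<Longrightarrow> m + k \<le> n \<Longrightarrow> cyc_rep n (Poly_Mapping.single (Word (map Sg [m..<m + k])) 1) = W.chain m k"
proof (induction k arbitrary: m)
  case (Suc k)
  let ?S = "\<lambda>u. Poly_Mapping.single (Word u) 1 :: _ \<Rightarrow>\<^sub>0 'r"
  have "[m..<m + Suc k] = m # [Suc m..<Suc m + k]" by (simp add: upt_conv_Cons del: upt_Suc)
  then have "?S (map Sg [m..<m + Suc k]) = sgen m * ?S (map Sg [Suc m..<Suc m + k])"
    by (simp only: list.map single_Word_Cons)
  moreover have "sgen m \<in> carrier F" using Suc.prems by (intro gen_in) auto
  moreover have "?S (map Sg [Suc m..<Suc m + k]) \<in> carrier F"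
    unfolding F_def using Suc.prems by (intro word_carrier) (auto simp: sergeev_letters_def)
  ultimately show ?case using Suc.IH[of "Suc m"] Suc.prems by (simp add: rep_mult del: upt_Suc)
qed (simp add: single_Word_Nil)

lemma rep_blocks:
  "1 \<le> m \<Longrightarrow> m + sum_list ks \<le> Suc n \<Longrightarrow> \<forall>k\<in>set ks. 0 < k \<Longrightarrow>
    cyc_rep n (Poly_Mapping.single (Word (block_word m ks)) 1) = W.blocks m ks"
proof (induction ks arbitrary: m)
  case (Cons k ks)
  let ?S = "\<lambda>u. Poly_Mapping.single (Word u) 1 :: _ \<Rightarrow>\<^sub>0 'r"
  have sub: "set (block_word (m + k) ks) \<subseteq> sergeev_letters n"
    using set_block_word[of "m + k" ks n] Cons.prems by (auto simp: clifford_letters_def sergeev_letters_def)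
  have sub': "set (map Sg [m..<m + (k - 1)]) \<subseteq> sergeev_letters n" using Cons.prems by (auto simp: sergeev_letters_def)
  have "?S (block_word m (k # ks)) = cgen m * (?S (map Sg [m..<m + (k - 1)]) * ?S (block_word (m + k) ks))"
    by (simp add: single_Word_Cons mult_single plus_word_def)
  moreover have "cgen m \<in> carrier F" using Cons.prems by (intro gen_in) auto
  moreover have "?S (map Sg [m..<m + (k - 1)]) \<in> carrier F" "?S (block_word (m + k) ks) \<in> carrier F"
    unfolding F_def by (rule word_carrier[OF sub'], rule word_carrier[OF sub])
  ultimately show ?case
    using Cons.prems Cons.IH[of "m + k"] rep_chain[of m "k - 1"]
    by (simp add: rep_mult F_closed mult.assoc)
qed (simp add: single_Word_Nil)

section \<open>Spanning by block classes and the dual traces\<close>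

context
  assumes half: "(2 :: 'r) dvd 1"
begin

text \<open>The copy of the supercommutator span inside the ring type; it plays the part of the
  additive subgroup \<open>N\<close> in \<open>sergeev_trace\<close>.\<close>

definition "cocenter_ideal = cyc_embed n ` supercommutator_span A"

lemma proj_supercommutator:
  assumes "f \<in> grade F i" "g \<in> grade F i"
  shows "proj n (f * g) \<ominus> parity_sign i i \<odot> proj n (g * f) \<in> supercommutator_span A"
proof -
  have "f \<in> carrier F" "g \<in> carrier F" using assms by (auto simp: F_def intro: free_grade_carrier)
  then have "proj n (f * g) \<ominus> parity_sign i i \<odot> proj n (g * f) \<in> supercommutators A"
    unfolding supercommutators_def using assms
    by (intro CollectI exI[of _ "proj n f"] exI[of _ "proj n g"] exI[of _ i]) (auto simp: A_hom(3,7))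
  then show ?thesis using supercommutator_span_closed(3) by blast
qed

interpretation W: sergeev_trace n "cyc_rep n 1 :: 'r cyc_family" "\<lambda>i. cyc_rep n (sgen i)" "\<lambda>i. cyc_rep n (cgen i)" cocenter_ideal
proof
  note cl = supercommutator_span_closed
  show "0 \<in> cocenter_ideal"
    unfolding cocenter_ideal_def embed_zero[symmetric] using cl(2) by (rule imageI)
  show "x - y \<in> cocenter_ideal" if "x \<in> cocenter_ideal" "y \<in> cocenter_ideal" for x y
  proof -
    obtain a b where ab: "a \<in> supercommutator_span A" "b \<in> supercommutator_span A" "x = cyc_embed n a" "y = cyc_embed n b"
      using \<open>x \<in> _\<close> \<open>y \<in> _\<close> by (auto simp: cocenter_ideal_def)
    then have c: "a \<in> carrier A" "b \<in> carrier A" using cl(1) by auto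
    have "a \<ominus> b \<in> supercommutator_span A"
      using cl(4)[OF ab(1) cl(5)[OF ab(2), of "- 1"]] c by (simp add: a_minus_def tm_smult_minus_one)
    then show ?thesis unfolding ab cocenter_ideal_def embed_hom(4)[OF c, symmetric] by (rule imageI)
  qed
  show "x * y - sgn_comm p p (y * x) \<in> cocenter_ideal" if m: "W.mon 1 n p x" "W.mon 1 n p y" for p x y
  proof -
    obtain f g where f: "f \<in> grade F (of_bool p)" "x = cyc_rep n f" and g: "g \<in> grade F (of_bool p)" "y = cyc_rep n g"
      using mon_rep[OF m(1)] mon_rep[OF m(2)] by blast
    then have c: "f \<in> carrier F" "g \<in> carrier F" by (auto simp: F_def intro: free_grade_carrier)
    then have c': "proj n (f * g) \<in> carrier A" "proj n (g * f) \<in> carrier A" by (auto intro!: proj_carrier F_closed)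
    have "x * y = cyc_embed n (proj n (f * g))" "y * x = cyc_embed n (proj n (g * f))"
      unfolding f(2) g(2) using c by (simp_all only: cyc_rep_def[symmetric] rep_mult)
    then have "x * y - sgn_comm p p (y * x) = cyc_embed n (proj n (f * g) \<ominus> parity_sign (of_bool p) (of_bool p) \<odot> proj n (g * f))"
      using c' by (cases p) (simp_all add: embed_hom parity_sign_def tm_smult_one tm_smult_minus_one)
    then show ?thesis using proj_supercommutator[OF f(1) g(1)] by (simp add: cocenter_ideal_def)
  qed
  show "x \<in> cocenter_ideal" if m: "W.mon 1 n False x" "x + x \<in> cocenter_ideal" for x
  proof -
    \<comment> \<open>Here \<open>h\<close> is the inverse of 2. Injectivity of the embedding turns
      the hypothesis into \<open>z \<oplus> z = a\<close> with \<open>a\<close> in the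
      supercommutator span, and then \<open>z = h \<odot> a\<close>.\<close>
    obtain h :: 'r where h: "1 = 2 * h" using half by (auto elim: dvdE)
    obtain f where f: "f \<in> grade F 0" "x = cyc_rep n f" using mon_rep[OF m(1)] by auto
    have c: "f \<in> carrier F" using f(1) by (auto simp: F_def intro: free_grade_carrier)
    obtain a where a: "a \<in> supercommutator_span A" "x + x = cyc_embed n a" using m by (auto simp: cocenter_ideal_def)
    define z where "z = proj n f"
    have z: "z \<in> carrier A" "x = cyc_embed n z" using proj_carrier[OF c] f(2) by (simp_all add: z_def cyc_rep_def)
    have "cyc_embed n (z \<oplus> z) = cyc_embed n a" using a(2) z by (simp add: embed_hom)
    then have za: "z \<oplus> z = a" using z a(1) cl(1) by (intro embed_inject) auto
    have "z = (h + h) \<odot> z" using h z by (simp add: mult_2[symmetric] tm_smult_one)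
    also have "\<dots> = h \<odot> a" unfolding za[symmetric] tm_smult_l_distr[OF z(1)] tm_smult_r_distr[OF z(1) z(1)] ..
    finally have "z \<in> supercommutator_span A" using cl(5)[OF a(1)] by simp
    then show ?thesis using z by (simp add: cocenter_ideal_def)
  qed
qed

interpretation G: type_submodule "A\<lparr>carrier := grade A 0\<rparr>" "supercommutator_span A \<inter> grade A 0"
  by (rule supercommutator_submodule)

definition block_class :: "nat list \<Rightarrow> (sergeev_letter word \<Rightarrow>\<^sub>0 'r) set set" where
  "block_class ks = proj n (Poly_Mapping.single (Word (block_word 1 ks)) 1)"

lemma block_word_grade:
  assumes "ks \<in> even_strict_partitions n"
  shows "Poly_Mapping.single (Word (block_word 1 ks)) 1 \<in> grade F 0"
proof -
  have "set (block_word 1 ks) \<subseteq> sergeev_letters n"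
    using set_block_word[of 1 ks n] assms
    by (auto simp: even_strict_partitions_def strict_partitions_def clifford_letters_def sergeev_letters_def)
  then show ?thesis
    using assms by (auto simp: F_def free_superalgebra_simps word_parity_block_word even_strict_partitions_def)
qed

lemma block_class_grade: "ks \<in> even_strict_partitions n \<Longrightarrow> block_class ks \<in> grade A 0"
  unfolding block_class_def A_hom(7) by (rule imageI) (rule block_word_grade)

lemma block_class_carrier: "block_class \<in> even_strict_partitions n \<rightarrow> carrier (A\<lparr>carrier := grade A 0\<rparr>)"
  using block_class_grade by simp

definition "reached = G.spanned (even_strict_partitions n) block_class"

lemmas reached_intros =
  G.spanned_N[OF finite_even_strict_partitions block_class_carrier, folded reached_def]
  G.spanned_gen[OF finite_even_strict_partitions block_class_carrier, folded reached_def]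
  G.spanned_add[OF finite_even_strict_partitions block_class_carrier, folded reached_def, simplified]
  G.spanned_smult[OF finite_even_strict_partitions block_class_carrier, folded reached_def, simplified]

text \<open>The statement of \<open>spanning\<close> lives in the ring type and is pulled back by
  injectivity of the embedding. The witness \<open>z\<close> must be even besides lying in the
  supercommutator span; it is so as a combination of two even elements.\<close>

lemma reached_mon:
  assumes f: "f \<in> grade F 0" and mon: "W.mon 1 n False (cyc_rep n f)"
  shows "reached (proj n f)"
proof -
  have a: "proj n f \<in> grade A 0" unfolding A_hom(7) using f by (rule imageI)
  have aA: "proj n f \<in> carrier A" using a grade_sub by auto
  consider "cyc_rep n f \<in> cocenter_ideal" | ks where "ks \<in> even_strict_partitions n"
    "cyc_rep n f - W.blocks 1 ks \<in> cocenter_ideal \<or> cyc_rep n f + W.blocks 1 ks \<in> cocenter_ideal"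
    using W.spanning[OF mon n] unfolding even_strict_partitions_def strict_partitions_def by blast
  then show ?thesis
  proof cases
    case 1
    then obtain z where z: "z \<in> supercommutator_span A" "cyc_embed n (proj n f) = cyc_embed n z"
      by (auto simp: cocenter_ideal_def cyc_rep_def)
    then have "proj n f = z" using aA supercommutator_span_closed(1) by (intro embed_inject) auto
    then show ?thesis using z a by (intro reached_intros(1)) simp
  next
    case (2 ks)
    let ?b = "block_class ks"
    have b: "?b \<in> grade A 0" using 2(1) by (rule block_class_grade)
    have bA: "?b \<in> carrier A" using b grade_sub by auto
    have blocks: "W.blocks 1 ks = cyc_embed n ?b"
      using rep_blocks[of 1 ks] 2(1)
      by (simp add: block_class_def cyc_rep_def even_strict_partitions_def strict_partitions_def)
    from 2(2) show ?thesis
    proof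
      assume "cyc_rep n f - W.blocks 1 ks \<in> cocenter_ideal"
      then have "cyc_embed n (proj n f \<ominus> ?b) \<in> cocenter_ideal"
        unfolding blocks cyc_rep_def[of n f] embed_hom(4)[OF aA bA] .
      then obtain z where z: "z \<in> supercommutator_span A" "cyc_embed n (proj n f \<ominus> ?b) = cyc_embed n z"
        by (auto simp: cocenter_ideal_def)
      then have eq: "proj n f \<ominus> ?b = z" using aA bA supercommutator_span_closed(1) by (intro embed_inject) auto
      moreover have "proj n f \<ominus> ?b = proj n f \<oplus> (- 1) \<odot> ?b" using bA by (simp add: a_minus_def tm_smult_minus_one)
      ultimately have "z \<in> grade A 0" using a b by (metis grade_add grade_smult)
      then have "reached (z \<oplus> ?b)" using z 2(1) by (intro reached_intros(1-3)) simp_all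
      moreover have "z \<oplus> ?b = proj n f" unfolding eq[symmetric] using aA bA by (simp add: a_minus_def a_assoc l_neg)
      ultimately show ?thesis by simp
    next
      assume "cyc_rep n f + W.blocks 1 ks \<in> cocenter_ideal"
      then have "cyc_embed n (proj n f \<oplus> ?b) \<in> cocenter_ideal"
        unfolding blocks cyc_rep_def[of n f] embed_hom(1)[OF aA bA] .
      then obtain z where z: "z \<in> supercommutator_span A" "cyc_embed n (proj n f \<oplus> ?b) = cyc_embed n z"
        by (auto simp: cocenter_ideal_def)
      then have eq: "proj n f \<oplus> ?b = z" using aA bA supercommutator_span_closed(1) by (intro embed_inject) auto
      then have "z \<in> grade A 0" using a b by (metis grade_add)
      then have "reached (z \<oplus> (- 1) \<odot> ?b)" using z 2(1) by (intro reached_intros) simp_all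
      moreover have "z \<oplus> (- 1) \<odot> ?b = proj n f"
        unfolding eq[symmetric] using aA bA by (simp add: tm_smult_minus_one a_assoc r_neg)
      ultimately show ?thesis by simp
    qed
  qed
qed

lemma F_grade_zero: "0 \<in> grade F i"
  by (simp add: F_def free_superalgebra_simps)

lemma F_grade_add: "f \<in> grade F i \<Longrightarrow> g \<in> grade F i \<Longrightarrow> f + g \<in> grade F i"
  using Poly_Mapping.keys_add[of f g] by (auto simp: F_def free_superalgebra_simps)

lemma F_grade_carrier: "f \<in> grade F i \<Longrightarrow> f \<in> carrier F"
  unfolding F_def by (rule free_grade_carrier)

lemma reached_zero: "reached (proj n 0)"
  using supercommutator_span_closed(2) grade_zero unfolding A_hom(6) by (intro reached_intros(1)) simp

text \<open>The even polynomial is carried along because \<open>reached\<close> speaks of elements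
  of the algebra, so sums in the ring type have to be lifted back.\<close>

lemma reached_amon:
  "amon p x \<Longrightarrow> \<not> p \<Longrightarrow> \<exists>f\<in>grade F 0. x = cyc_rep n f \<and> reached (proj n f)"
proof (induction rule: amon.induct)
  case (zero p)
  then show ?case using reached_zero rep_zero F_grade_zero by metis
next
  case (add p x y)
  then obtain g where g: "g \<in> grade F 0" "y = cyc_rep n g" "reached (proj n g)" by blast
  obtain f where f: "f \<in> grade F 0" "x = cyc_rep n f" using mon_rep[OF add.hyps(1)] add.prems by auto
  have "reached (proj n f)" using f add by (intro reached_mon) simp_all
  then have "reached (proj n f \<oplus> proj n g)" using g(3) by (rule reached_intros(3))
  then have "reached (proj n (f + g))" using f g by (simp add: A_hom(2) F_grade_carrier)
  moreover have "x + y = cyc_rep n (f + g)" using f g by (simp add: rep_add F_grade_carrier)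
  ultimately show ?case using f g by (blast intro: F_grade_add)
qed

text \<open>The ring type has no scalar action. A word is therefore reduced with coefficient 1 and
  scaled afterwards in the algebra.\<close>

lemma reached_single:
  assumes "Poly_Mapping.single w (1 :: 'r) \<in> grade F 0" "(1 :: 'r) \<noteq> 0"
  shows "reached (proj n (Poly_Mapping.single w r))"
proof -
  have w: "set (letters w) \<subseteq> sergeev_letters n" "word_parity sergeev_parity w = 0"
    using assms by (simp_all add: F_def free_superalgebra_simps)
  have "amon False (cyc_rep n (Poly_Mapping.single w 1))" using amon_word[OF w(1)] w(2) by simp
  then obtain f where f: "f \<in> grade F 0" "cyc_rep n (Poly_Mapping.single w 1) = cyc_rep n f" "reached (proj n f)"
    using reached_amon by blast
  then have "proj n (Poly_Mapping.single w 1) = proj n f"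
    using assms F_grade_carrier by (intro embed_inject) (auto simp: cyc_rep_def intro!: proj_carrier)
  then have "reached (r \<odot> proj n (Poly_Mapping.single w 1))" using f by (intro reached_intros(4)) simp
  moreover have "r \<odot> proj n (Poly_Mapping.single w 1) = proj n (Poly_Mapping.single w r)"
    using A_hom(4)[OF F_grade_carrier[OF assms(1)], of r] by (simp add: map_single)
  ultimately show ?thesis by simp
qed

lemma reached_grade:
  assumes x: "x \<in> grade A 0" and one_neq: "(1 :: 'r) \<noteq> 0"
  shows "reached x"
proof -
  obtain f where f: "f \<in> grade F 0" "x = proj n f" using x unfolding A_hom(7) by blast
  \<comment> \<open>The grade is defined through the keys, so every monomial of an even polynomial
    is even and can be treated separately.\<close>
  let ?m = "\<lambda>w. Poly_Mapping.single w (Poly_Mapping.lookup f w)"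
  have "sum ?m B \<in> grade F 0 \<and> reached (proj n (sum ?m B))" if "finite B" "B \<subseteq> Poly_Mapping.keys f" for B
    using that
  proof (induction B)
    case empty
    then show ?case using reached_zero F_grade_zero by simp
  next
    case (insert w B)
    have 1: "Poly_Mapping.single w (1 :: 'r) \<in> grade F 0" "?m w \<in> grade F 0"
      using f(1) insert.prems one_neq by (auto simp: F_def free_superalgebra_simps)
    have "reached (proj n (?m w) \<oplus> proj n (sum ?m B))"
      using insert reached_single[OF 1(1) one_neq] by (intro reached_intros(3)) auto
    moreover have "sum ?m B \<in> grade F 0" using insert by auto
    ultimately show ?case
      using insert.hyps 1(2) A_hom(2)[of "?m w" "sum ?m B"] by (simp add: F_grade_carrier[of _ 0] F_grade_add)
  qed
  moreover have "sum ?m (Poly_Mapping.keys f) = f"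
    by (rule poly_mapping_eqI) (simp add: lookup_sum lookup_single when_def in_keys_iff)
  ultimately show ?thesis using f by (metis finite_keys order_refl)
qed

text \<open>The trace is taken of an arbitrary preimage in the free algebra;
  \<open>proj_kernel\<close> shows that the choice does not matter.\<close>

definition block_trace :: "nat set \<Rightarrow> (sergeev_letter word \<Rightarrow>\<^sub>0 'r) set set \<Rightarrow> 'r" where
  "block_trace L a = free_trace n L (SOME f. f \<in> carrier F \<and> proj n f = a)"

lemma block_trace_proj:
  assumes f: "f \<in> carrier F"
  shows "block_trace L (proj n f) = free_trace n L f"
proof -
  define g where "g = (SOME g. g \<in> carrier F \<and> proj n g = proj n f)"
  have g: "g \<in> carrier F" "proj n g = proj n f"
    using someI[of "\<lambda>g. g \<in> carrier F \<and> proj n g = proj n f" f] f by (simp_all add: g_def)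
  have "proj n (g - f) \<oplus> proj n f = proj n g" using f g by (simp add: A_hom(2) F_closed)
  moreover have "proj n 0 \<oplus> proj n f = proj n f" using f proj_carrier[OF f] by (simp add: A_hom(6)[symmetric])
  ultimately have "proj n (g - f) = proj n 0"
    using f g add.r_cancel[of "proj n f" "proj n (g - f)" "proj n 0"]
    by (simp add: proj_carrier F_closed F_grade_carrier[OF F_grade_zero])
  then have "model_hom (g - f) = 0"
    using F_closed(3)[OF g(1) f] proj_kernel[OF n] unfolding F_def by blast
  then have "model_hom g = model_hom f" by (simp add: model_hom_linear)
  then show ?thesis unfolding block_trace_def free_trace_def g_def by simp
qed

lemma block_trace_linear:
  "a \<in> carrier A \<Longrightarrow> b \<in> carrier A \<Longrightarrow> block_trace L (a \<oplus> b) = block_trace L a + block_trace L b"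
  "a \<in> carrier A \<Longrightarrow> block_trace L (r \<odot> a) = r * block_trace L a"
proof -
  assume "a \<in> carrier A"
  then obtain f where f: "f \<in> carrier F" "a = proj n f" unfolding A_hom(1) by blast
  have "Poly_Mapping.map ((*) r) f \<in> carrier F"
    using f(1) keys_scale[of r f] by (auto simp: F_def free_superalgebra_simps)
  then show "block_trace L (r \<odot> a) = r * block_trace L a"
    unfolding f(2) A_hom(4)[OF f(1)] by (simp only: block_trace_proj f(1) free_trace_linear)
  assume "b \<in> carrier A"
  then obtain g where g: "g \<in> carrier F" "b = proj n g" unfolding A_hom(1) by blast
  show "block_trace L (a \<oplus> b) = block_trace L a + block_trace L b"
    unfolding f(2) g(2) A_hom(2)[OF f(1) g(1)]
    by (simp only: block_trace_proj f(1) g(1) F_closed(2)[OF f(1) g(1)] free_trace_linear)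
qed

text \<open>The zeros of the trace form a submodule, and supersymmetry on the free algebra puts the
  supercommutators into it.\<close>

lemma block_trace_supercommutator_span:
  assumes "even (card L)" "a \<in> supercommutator_span A"
  shows "block_trace L a = 0"
proof -
  define K where "K = {a \<in> carrier A. block_trace L a = 0}"
  have "supercommutators A \<subseteq> K"
  proof
    fix z assume z: "z \<in> supercommutators A"
    then obtain x y i j where xy: "z = x \<otimes> y \<ominus> parity_sign i j \<odot> (y \<otimes> x)" "x \<in> grade A i" "y \<in> grade A j"
      unfolding supercommutators_def by blast
    obtain f g where f: "f \<in> grade F i" "x = proj n f" and g: "g \<in> grade F j" "y = proj n g"
      using xy(2,3) unfolding A_hom(7) by blast
    have c: "f \<in> carrier F" "g \<in> carrier F" using f g by (auto intro: F_grade_carrier)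
    have c': "proj n (f * g) \<in> carrier A" "proj n (g * f) \<in> carrier A" using c by (auto intro!: proj_carrier F_closed)
    have "z = proj n (f * g) \<oplus> (- 1) \<odot> (parity_sign i j \<odot> proj n (g * f))"
      using c c' by (simp add: xy(1) f(2) g(2) A_hom(3) a_minus_def tm_smult_minus_one)
    then have "block_trace L z = free_trace n L (f * g) - parity_sign i j * free_trace n L (g * f)"
      using c c' by (simp add: block_trace_linear block_trace_proj F_closed)
    also have "\<dots> = 0" using free_trace_commute[OF assms(1) f(1)[unfolded F_def] g(1)[unfolded F_def]] by simp
    finally show "z \<in> K" using z supercommutators_carrier by (auto simp: K_def)
  qed
  moreover have "\<zero> \<in> K"
    using block_trace_linear(1)[of \<zero> \<zero> L] by (simp add: K_def)
  ultimately have "lin_span A (supercommutators A) \<subseteq> K"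
    by (intro lin_span_minimal) (auto simp: K_def block_trace_linear)
  then show ?thesis using assms(2) by (auto simp: supercommutator_span_def K_def)
qed

text \<open>The traces attached to the sets of parts are dual to the block classes, since a
  decreasing list is recovered from its set. The parts are distinct, so an even number of them gives
  a set of even cardinality, as supersymmetry requires.\<close>

lemma SupTr_free:
  assumes "(1 :: 'r) \<noteq> 0"
  shows "free_module_of_rank (SupTr 0 A) (card (even_strict_partitions n))"
  unfolding SupTr_def
proof (rule G.free_quotient[OF finite_even_strict_partitions block_class_carrier assms, where \<phi> = "\<lambda>ks. block_trace (set ks)"])
  have g: "x \<in> carrier A" if "x \<in> grade A 0" for x using that grade_sub by auto
  show "block_trace (set ks) x = 0" if "ks \<in> even_strict_partitions n" "x \<in> supercommutator_span A \<inter> grade A 0" for ks x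
    using that sorted_wrt_greater_distinct[of ks]
    by (intro block_trace_supercommutator_span) (auto simp: even_strict_partitions_def strict_partitions_def distinct_card)
  show "block_trace (set ks) (block_class ls) = (if ks = ls then 1 else 0)"
    if "ks \<in> even_strict_partitions n" "ls \<in> even_strict_partitions n" for ks ls
  proof -
    have "block_trace (set ks) (block_class ls) = (if set ls = set ks then 1 else 0)"
      unfolding block_class_def block_trace_proj[OF F_grade_carrier[OF block_word_grade[OF that(2)]]]
      using that(2) by (intro free_trace_block_word) (auto simp: even_strict_partitions_def strict_partitions_def)
    moreover have "set ls = set ks \<longleftrightarrow> ks = ls"
      using that sorted_wrt_greater_unique[of ks ls] by (auto simp: even_strict_partitions_def strict_partitions_def)
    ultimately show ?thesis by simp
  qed
  fix x assume "x \<in> carrier (A\<lparr>carrier := grade A 0\<rparr>)"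
  then have "reached x" using assms by (intro reached_grade) simp_all
  then show "\<exists>k. x \<ominus>\<^bsub>A\<lparr>carrier := grade A 0\<rparr>\<^esub> (\<Oplus>\<^bsub>A\<lparr>carrier := grade A 0\<rparr>\<^esub>i\<in>even_strict_partitions n.
      k i \<odot>\<^bsub>A\<lparr>carrier := grade A 0\<rparr>\<^esub> block_class i) \<in> supercommutator_span A \<inter> grade A 0"
    unfolding reached_def G.spanned_def by blast
qed (use grade_sub in \<open>auto simp: block_trace_linear subset_iff\<close>)

end

end

theorem theorem5p7:
  fixes n d :: nat and a :: "nat \<Rightarrow> 'r::idom" and g :: "'r poly"
  assumes "(2 :: 'r) dvd 1"
    and "n \<ge> 1"
    and "d = 1" and "a d = 1" and "g = cyclotomic_poly d a"
  shows "free_module_of_rank (SupTr 0 (cyclotomic_sergeev n g)) (card (even_strict_partitions n))"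
proof -
  \<comment> \<open>For \<open>d = 1\<close> the index \<open>t\<close> takes only the value 0, and
    the remaining coefficient is \<open>a 1 = 1\<close>.\<close>
  have "g = Polynomial.monom 1 1" using assms(3-5) by (simp add: cyclotomic_poly_def)
  then have "cyclotomic_sergeev n g = cyc n" by (simp add: cyc_def)
  then show ?thesis using SupTr_free[OF assms(2,1)] by simp
qed

end
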